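(* Let $\mathbb{F}\in\{\mathbb{R},\mathbb{C}\}$, with $\alpha=1$ if $\mathbb{F}=\mathbb{R}$ and $\alpha=0$ if $\mathbb{F}=\mathbb{C}$. Let $A\in\mathbb{F}^{m\times n}$ be an arbitrary matrix, and let $1\le k\le s\le\min\{m,n\}$ be integers with $s\ge 2k+\alpha$. Draw independent standard normal matrices $\Upsilon\in\mathbb{F}^{k\times m}$, $\Omega\in\mathbb{F}^{k\times n}$, $\Phi\in\mathbb{F}^{s\times m}$, $\Psi\in\mathbb{F}^{s\times n}$. Form the sketch $X=\Upsilon A$, $Y=A\Omega^*$, $Z=\Phi A\Psi^*$, and let $\hat A=QCP^*$ be the initial rank-$k$ approximation constructed from $(X,Y,Z)$ as described in the context. Then $$\mathbb{E}\,\|A-\hat A\|_2^2\;\le\;\frac{s-\alpha}{s-k-\alpha}\cdot\min_{\varrho<k-\alpha}\frac{k+\varrho-\alpha}{k-\varrho-\alpha}\cdot\tau_{\varrho+1}^2(A),$$ where the minimum is over natural numbers $\varrho\geq 0$ with $\varrho<k-\alpha$ (and covers the product of both factors to its right), and the expectation is over $\Upsilon,\Omega,\Phi,\Psi$.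
   Context: Notation: $^*$ is the (conjugate) transpose, $^\dagger$ the Moore–Penrose pseudoinverse, and $\|\cdot\|_2$ is the Schatten 2-norm (Frobenius norm). A standard normal matrix over $\mathbb{R}$ has independent $N(0,1)$ entries; over $\mathbb{C}$ its entries are independent and of the form $g_1+\mathrm{i}g_2$ with $g_1,g_2$ independent real $N(0,1)$ variables. Tail energy: for an integer $r\ge 0$, $\tau_{r+1}^2(A)=\min_{\operatorname{rank}(B)\le r}\|A-B\|_2^2=\sum_{j>r}\sigma_j^2(A)$, where $\sigma_j$ is the $j$th largest singular value. Construction of $\hat A$: compute thin QR factorizations $X^*=PR_1$ with $P\in\mathbb{F}^{n\times k}$ and $Y=QR_2$ with $Q\in\mathbb{F}^{m\times k}$, where $P,Q$ have orthonormal columns (the QR factorization is a fixed procedure, so $P$ is a (measurable) function of $X$ only and $Q$ is a (measurable) function of $Y$ only). Set $C=(\Phi Q)^\dagger Z\,((\Psi P)^\dagger)^*\in\mathbb{F}^{k\times k}$ and $\hat A=QCP^*$. *)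

theory Defs
  imports "HOL-Probability.Probability" "Jordan_Normal_Form.Conjugate"
begin

text \<open>
  An \<open>m \<times> n\<close> matrix over the scalars \<open>'a\<close> has type \<open>'a^'n^'m\<close>. The definitions are polymorphic
  in \<open>'a\<close> but meant for \<open>real\<close> and \<open>complex\<close>, where \<^const>\<open>conjugate\<close> is the identity and
  \<^const>\<open>cnj\<close>, respectively. The Frobenius (Schatten 2-) norm is the library norm
  on \<open>'a^'n^'m\<close>, as this is the Euclidean norm of the vector of the Euclidean norms of the rows.
\<close>

definition ctranspose :: "'a::conjugatable_field^'n^'m \<Rightarrow> 'a^'m^'n" where
  "ctranspose A = (\<chi> i j. conjugate (A $ j $ i))"

definition is_pseudoinverse :: "'a::conjugatable_field^'n^'m \<Rightarrow> 'a^'m^'n \<Rightarrow> bool" where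
  "is_pseudoinverse A B \<longleftrightarrow>
     A ** B ** A = A \<and> B ** A ** B = B \<and>
     ctranspose (A ** B) = A ** B \<and> ctranspose (B ** A) = B ** A"

definition pseudoinverse :: "'a::conjugatable_field^'n^'m \<Rightarrow> 'a^'m^'n" where
  "pseudoinverse A = (THE B. is_pseudoinverse A B)"

lemma ctranspose_mult: "ctranspose (A ** B) = ctranspose B ** ctranspose A"
  by (simp add: ctranspose_def matrix_matrix_mult_def vec_eq_iff sum_conjugate
      conjugate_dist_mul mult.commute)

lemma is_pseudoinverse_unique:
  assumes "is_pseudoinverse A B" "is_pseudoinverse A C"
  shows "B = C"
proof -
  have B: "A ** B ** A = A" "B ** A ** B = B"
      "ctranspose (A ** B) = A ** B" "ctranspose (B ** A) = B ** A"
    and C: "A ** C ** A = A" "C ** A ** C = C"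
      "ctranspose (A ** C) = A ** C" "ctranspose (C ** A) = C ** A"
    using assms by (auto simp: is_pseudoinverse_def)
  have "A ** B = ctranspose (A ** C ** A ** B)"
    using B C by simp
  also have "\<dots> = ctranspose (A ** B) ** ctranspose (A ** C)"
    by (simp add: ctranspose_mult matrix_mul_assoc)
  also have "\<dots> = A ** C"
    using B C by (simp add: matrix_mul_assoc)
  finally have AB: "A ** B = A ** C" .
  have "B ** A = ctranspose (B ** (A ** C ** A))"
    using B C by simp
  also have "\<dots> = ctranspose (C ** A) ** ctranspose (B ** A)"
    by (simp add: ctranspose_mult matrix_mul_assoc)
  also have "\<dots> = C ** A"
    using B C by (metis matrix_mul_assoc)
  finally have BA: "B ** A = C ** A" .
  show ?thesis
    using AB BA B(2) C(2) by (metis matrix_mul_assoc)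
qed

text \<open>
  \<open>tail_energy r A\<close> is the quantity written \<open>\<tau>\<^sub>r\<^sub>+\<^sub>1\<^sup>2(A)\<close>: the least squared Frobenius distance
  from \<open>A\<close> to a matrix of rank at most \<open>r\<close>. The infimum is attained.
\<close>

definition tail_energy :: "nat \<Rightarrow> 'a::real_normed_field^'n^'m \<Rightarrow> real" where
  "tail_energy r A = (INF B \<in> {B. rank B \<le> r}. (norm (A - B))\<^sup>2)"

text \<open>
  A fixed measurable procedure for thin QR factorization, represented by the map sending a tall
  matrix to its orthonormal factor. The linear order on the column index type only serves to
  express that the factor \<open>R\<close> is upper triangular.
\<close>

definition thin_qr_procedure ::
    "('a::{real_normed_field,euclidean_space,conjugatable_field}^'k::{finite,linorder}^'m \<Rightarrow>
      'a^'k::_^'m) \<Rightarrow> bool" where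
  "thin_qr_procedure qr \<longleftrightarrow>
     qr \<in> borel_measurable borel \<and>
     (\<forall>T. ctranspose (qr T) ** qr T = mat 1 \<and>
          (\<exists>R. (\<forall>i j. j < i \<longrightarrow> R $ i $ j = 0) \<and> T = qr T ** R))"

definition initial_approx ::
    "('a::conjugatable_field^'k^'n \<Rightarrow> 'a^'k^'n) \<Rightarrow> ('a^'k^'m \<Rightarrow> 'a^'k^'m) \<Rightarrow>
     'a^'m^'s \<Rightarrow> 'a^'n^'s \<Rightarrow> 'a^'n^'k \<Rightarrow> 'a^'k^'m \<Rightarrow> 'a^'s^'s \<Rightarrow> 'a^'n^'m" where
  "initial_approx qr1 qr2 \<Phi> \<Psi> X Y Z =
     (let P = qr1 (ctranspose X);
          Q = qr2 Y;
          C = pseudoinverse (\<Phi> ** Q) ** Z ** ctranspose (pseudoinverse (\<Psi> ** P))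
      in Q ** C ** ctranspose P)"

text \<open>
  The coordinates \<open>g \<omega> \<bullet> b\<close>, \<open>b \<in> Basis\<close>, are \<open>g \<omega>\<close> itself for real scalars, and the real and
  imaginary parts of \<open>g \<omega>\<close> for complex scalars. So a complex standard normal variable is
  \<open>g\<^sub>1 + \<i> g\<^sub>2\<close> with independent \<open>N(0,1)\<close> variables \<open>g\<^sub>1, g\<^sub>2\<close>, and has variance 2.
\<close>

definition (in prob_space) std_normal_scalar :: "('a \<Rightarrow> 'b::euclidean_space) \<Rightarrow> bool" where
  "std_normal_scalar g \<longleftrightarrow>
     indep_vars (\<lambda>_. borel) (\<lambda>b \<omega>. g \<omega> \<bullet> b) Basis \<and>
     (\<forall>b\<in>Basis. distributed M lborel (\<lambda>\<omega>. g \<omega> \<bullet> b) (\<lambda>x. ennreal (std_normal_density x)))"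

definition (in prob_space) std_normal_matrix :: "('a \<Rightarrow> 'b::euclidean_space^'c^'r) \<Rightarrow> bool" where
  "std_normal_matrix G \<longleftrightarrow>
     indep_vars (\<lambda>_. borel) (\<lambda>(i, j) \<omega>. G \<omega> $ i $ j) UNIV \<and>
     (\<forall>i j. std_normal_scalar (\<lambda>\<omega>. G \<omega> $ i $ j))"

text \<open>
  \<^const>\<open>prob_space.indep_vars\<close> needs all variables to have the same type, so the mutual
  independence of four matrices of different shapes is stated for the sets of events they generate.
\<close>

definition (in prob_space) rv_events :: "('a \<Rightarrow> 'b::topological_space) \<Rightarrow> 'a set set" where
  "rv_events X = {X -` B \<inter> space M | B. B \<in> sets borel}"

definition (in prob_space) indep_vars4 ::
    "('a \<Rightarrow> 'b::topological_space) \<Rightarrow> ('a \<Rightarrow> 'c::topological_space) \<Rightarrow>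
     ('a \<Rightarrow> 'd::topological_space) \<Rightarrow> ('a \<Rightarrow> 'e::topological_space) \<Rightarrow> bool" where
  "indep_vars4 X1 X2 X3 X4 \<longleftrightarrow>
     indep_sets (\<lambda>i. [rv_events X1, rv_events X2, rv_events X3, rv_events X4] ! i) {..<4::nat}"

end

theory Submission
  imports Defs
begin

text \<open>
  The only facts about Gaussian matrices that enter are the invariance of the Gaussian measure \<open>gauss\<close> under
  linear isometries and Fubini's theorem for \<open>gauss = gauss \<Otimes>\<^sub>M gauss\<close>. If \<open>Q\<close> has \<open>r\<close> orthonormal columns,
  \<open>Q\<^sup>* B = 0\<close>, and \<open>X\<close> is a Gaussian matrix with \<open>s\<close> rows, then \<open>X Q\<close> and \<open>X B\<close> are independent, and
  \<open>\<bbbE> \<parallel>M + (X Q)\<^sup>\<dagger> X B\<parallel>\<^sup>2 = \<parallel>M\<parallel>\<^sup>2 + c \<parallel>B\<parallel>\<^sup>2\<close> with \<open>c = r / (s - r - \<alpha>)\<close>. Here a row of \<open>(X Q)\<^sup>\<dagger>\<close> is the inverse of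
  the distance of a Gaussian vector to the span of the other columns, and the mean of its square is
  computed from \<open>1 / t = \<integral> exp (- u t) du\<close>.

  With \<open>P\<close> and \<open>Q\<close> fixed, this is applied to \<open>\<Psi>\<close> and then to \<open>\<Phi>\<close>, and bounds the mean error by
  \<open>1 + k / (s - k - \<alpha>)\<close> times \<open>\<parallel>A - Q Q\<^sup>* A P P\<^sup>*\<parallel>\<^sup>2 = \<parallel>A - A P P\<^sup>*\<parallel>\<^sup>2 + \<parallel>(A - Q Q\<^sup>* A) P\<parallel>\<^sup>2\<close>. Let \<open>A\<^sub>2\<close> be what remains of
  \<open>A\<close> after projecting its rows to the row space of a matrix \<open>B\<close> of rank \<open>\<rho>\<close>. The two terms have means at
  most \<open>\<parallel>A\<^sub>2 - A\<^sub>2 P P\<^sup>*\<parallel>\<^sup>2 + c \<parallel>A\<^sub>2\<parallel>\<^sup>2\<close> and \<open>\<parallel>A\<^sub>2 P\<parallel>\<^sup>2 + c \<parallel>A\<^sub>2\<parallel>\<^sup>2\<close> with \<open>c = \<rho> / (k - \<rho> - \<alpha>)\<close>, where the mean is taken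
  over \<open>\<Upsilon>\<close> and \<open>\<Omega>\<close>, respectively; the sum is \<open>(1 + 2 c) \<parallel>A\<^sub>2\<parallel>\<^sup>2\<close>.
\<close>

text \<open>The constant forces the shape of the argument. Two separate range finder bounds would
  give \<open>2 * (1 + c)\<close> instead of \<open>1 + 2 * c\<close>; keeping \<open>P\<close> in
  both makes the leading terms complementary, so that they add up to the squared norm of the
  truncated matrix for every value of \<Upsilon>. For \<Omega> this is harmless, because
  \<open>P\<close> does not depend on it. For \<Upsilon> it is the obstacle: \<open>P\<close> is a
  function of \<Upsilon>, so its leading term cannot be averaged first. That bound is therefore
  proved pointwise in \<Upsilon>, with a remainder free of \<open>P\<close>, which is found by
  projecting also onto the column space of the part of \<open>A\<close> that was split off. The
  assumption \<open>s >= 2 * k + \<alpha>\<close> says that \<open>k / (s - k - \<alpha>)\<close> is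
  at most 1. It absorbs the product of two such constants that arises where \<Phi> and \<Psi>
  amplify the same part of the error. The final factors come from \<open>1 + k / (s - k - \<alpha>)
  = (s - \<alpha>) / (s - k - \<alpha>)\<close> and \<open>1 + 2 * \<rho> / (k - \<rho> - \<alpha>)
  = (k + \<rho> - \<alpha>) / (k - \<rho> - \<alpha>)\<close>.\<close>

subsection \<open>The standard Gaussian measure of a Euclidean space\<close>

text \<open>Fubini's theorem for \<open>indicator U (f x) * indicator B (f x + y)\<close>, with \<open>U\<close> the unit ball, compares the
  two translation invariant measures.\<close>

lemma lborel_isometry:
  fixes f :: "'a::euclidean_space \<Rightarrow> 'a"
  assumes f: "linear f" and nf: "\<And>x. norm (f x) = norm x"
  shows "distr lborel borel f = lborel"
proof (rule measure_eqI)
  have [measurable]: "f \<in> borel_measurable borel"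
    using f by (simp add: borel_measurable_continuous_onI linear_continuous_on linear_linear)
  have "orthogonal_transformation f"
    using f nf by (simp add: orthogonal_transformation)
  then have surj: "surj f"
    by (rule orthogonal_transformation_surj)
  show "sets (distr lborel borel f) = sets lborel" by simp
  fix B assume "B \<in> sets (distr lborel borel f)"
  then have B[measurable]: "B \<in> sets borel" by simp
  define U where "U = ball (0::'a) 1"
  define iU iB :: "'a \<Rightarrow> ennreal" where "iU = indicator U" and "iB = indicator B"
  have [measurable]: "iU \<in> borel_measurable borel" "iB \<in> borel_measurable borel"
    by (auto simp: iU_def iB_def U_def intro!: borel_measurable_indicator)
  have shift: "(\<integral>\<^sup>+x. h (x - c) \<partial>lborel) = (\<integral>\<^sup>+x. h x \<partial>lborel)"
    if [measurable]: "h \<in> borel_measurable borel" for h :: "'a \<Rightarrow> ennreal" and c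
    by (subst (2) lborel_distr_plus[of "- c", symmetric]) (simp add: nn_integral_distr)
  have U: "iU (f x) = iU x" "iU (x - y) = iU (y - x)" for x y
    by (simp_all add: iU_def U_def indicator_def nf norm_minus_commute)
  have int: "(\<integral>\<^sup>+x. iU x \<partial>lborel) = emeasure lborel U" "(\<integral>\<^sup>+x. iB x \<partial>lborel) = emeasure lborel B"
    by (simp_all add: iU_def iB_def U_def)
  have trans: "(\<integral>\<^sup>+x. iU (f x) * iB (f x + y) \<partial>lborel) = (\<integral>\<^sup>+x. iU (f x - y) * iB (f x) \<partial>lborel)" for y
  proof -
    \<comment> \<open>Surjectivity turns the shift by \<open>y\<close> after \<open>f\<close> into a
      shift by \<open>z\<close> before it, to which translation invariance applies.\<close>
    obtain z where z: "y = f z" using surj by (metis surjD)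
    show ?thesis
      by (subst shift[of "\<lambda>x. iU (f x) * iB (f x + y)" z, symmetric], measurable)
        (simp add: z linear_diff[OF f])
  qed
  have "emeasure lborel U * emeasure lborel B =
      (\<integral>\<^sup>+x. iU (f x) * (\<integral>\<^sup>+y. iB y \<partial>lborel) \<partial>lborel)"
    by (simp add: U(1) int nn_integral_multc)
  also have "\<dots> = (\<integral>\<^sup>+x. \<integral>\<^sup>+y. iU (f x) * iB (f x + y) \<partial>lborel \<partial>lborel)"
  proof (rule nn_integral_cong)
    fix x
    show "iU (f x) * (\<integral>\<^sup>+y. iB y \<partial>lborel) = (\<integral>\<^sup>+y. iU (f x) * iB (f x + y) \<partial>lborel)"
      using shift[of iB "- f x"] by (simp add: nn_integral_cmult add.commute)
  qed
  also have "\<dots> = (\<integral>\<^sup>+y. \<integral>\<^sup>+x. iU (f x) * iB (f x + y) \<partial>lborel \<partial>lborel)"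
    by (rule lborel_pair.Fubini'[symmetric]) measurable
  also have "\<dots> = (\<integral>\<^sup>+y. \<integral>\<^sup>+x. iU (f x - y) * iB (f x) \<partial>lborel \<partial>lborel)"
    by (simp add: trans)
  also have "\<dots> = (\<integral>\<^sup>+x. \<integral>\<^sup>+y. iU (f x - y) * iB (f x) \<partial>lborel \<partial>lborel)"
    by (rule lborel_pair.Fubini') measurable
  also have "\<dots> = (\<integral>\<^sup>+x. \<integral>\<^sup>+y. iU (y - f x) * iB (f x) \<partial>lborel \<partial>lborel)"
    by (subst U(2)) simp
  also have "\<dots> = (\<integral>\<^sup>+x. emeasure lborel U * iB (f x) \<partial>lborel)"
    by (subst nn_integral_multc) (simp_all add: shift[of iU] int)
  also have "\<dots> = emeasure lborel U * emeasure (distr lborel borel f) B"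
    by (simp add: nn_integral_cmult flip: nn_integral_indicator, subst nn_integral_distr, simp_all add: iB_def)
  finally show "emeasure (distr lborel borel f) B = emeasure lborel B"
    using emeasure_bounded_finite[of U] open_not_negligible[of U]
    by (auto simp: U_def ennreal_mult_cancel_left negligible_iff_emeasure0)
qed

section \<open>The Gaussian density, its isometries and its products\<close>

definition gauss :: "'a::euclidean_space measure" where
  "gauss = density lborel (\<lambda>x. ennreal (\<Prod>b\<in>Basis. std_normal_density (x \<bullet> b)))"

lemma sets_gauss [simp, measurable_cong]: "sets gauss = sets borel"
  by (simp add: gauss_def)

lemma space_gauss [simp]: "space gauss = UNIV"
  by (simp add: gauss_def)

text \<open>The density is a function of the norm; this is why linear isometries preserve
  \<open>gauss\<close> and why the density of a pair factors.\<close>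

lemma gauss_density_norm:
  "(\<Prod>b\<in>Basis. std_normal_density (x \<bullet> b)) =
   (1 / sqrt (2 * pi)) ^ DIM('a) * exp (- (norm x)\<^sup>2 / 2)" for x :: "'a::euclidean_space"
proof -
  have "(\<Prod>b\<in>Basis. std_normal_density (x \<bullet> b)) =
      (1 / sqrt (2 * pi)) ^ DIM('a) * exp (\<Sum>b\<in>Basis. - (x \<bullet> b)\<^sup>2 / 2)"
    by (simp add: std_normal_density_def prod.distrib exp_sum power_divide prod_dividef)
  also have "(\<Sum>b\<in>Basis. - (x \<bullet> b)\<^sup>2 / 2) = - (norm x)\<^sup>2 / 2"
    by (simp add: euclidean_inner[of x x] power2_norm_eq_inner sum_negf sum_divide_distrib
        flip: power2_eq_square)
  finally show ?thesis .
qed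

lemma nn_integral_gauss_prod_coords:
  fixes f :: "'a::euclidean_space \<Rightarrow> real \<Rightarrow> ennreal"
  assumes [measurable]: "\<And>b. b \<in> Basis \<Longrightarrow> f b \<in> borel_measurable borel"
  shows "(\<integral>\<^sup>+x. (\<Prod>b\<in>Basis. f b (x \<bullet> b)) \<partial>gauss) =
    (\<Prod>b\<in>Basis. \<integral>\<^sup>+x. ennreal (std_normal_density x) * f b x \<partial>lborel)"
proof -
  have "(\<integral>\<^sup>+x. (\<Prod>b\<in>Basis. f b (x \<bullet> b)) \<partial>gauss) =
      (\<integral>\<^sup>+x. (\<Prod>b\<in>Basis. ennreal (std_normal_density (x \<bullet> b)) * f b (x \<bullet> b)) \<partial>lborel)"
    unfolding gauss_def by (subst nn_integral_density) (simp_all add: prod.distrib prod_ennreal)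
  also have "\<dots> = (\<Prod>b\<in>Basis. \<integral>\<^sup>+x. ennreal (std_normal_density x) * f b x \<partial>lborel)"
    by (rule nn_integral_lborel_prod) simp_all
  finally show ?thesis .
qed

lemma nn_integral_std_normal_density: "(\<integral>\<^sup>+x. ennreal (std_normal_density x) \<partial>lborel) = 1"
  by (subst nn_integral_eq_integral) simp_all

lemma prob_space_gauss: "prob_space (gauss :: 'a::euclidean_space measure)"
proof
  have "emeasure gauss (space gauss :: 'a set) = (\<integral>\<^sup>+x. (\<Prod>b\<in>Basis. (\<lambda>_ _. 1) b (x \<bullet> b)) \<partial>(gauss::'a measure))"
    by simp
  also have "\<dots> = 1"
    by (subst nn_integral_gauss_prod_coords) (simp_all add: nn_integral_std_normal_density)
  finally show "emeasure gauss (space gauss :: 'a set) = 1" .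
qed

interpretation gauss: prob_space "gauss :: 'a::euclidean_space measure"
  by (rule prob_space_gauss)

lemma emeasure_gauss_UNIV [simp]: "emeasure gauss (UNIV :: 'a::euclidean_space set) = 1"
  using gauss.emeasure_space_1[where 'a='a] by simp

lemma nn_integral_gauss_isometry:
  fixes f :: "'a::euclidean_space \<Rightarrow> 'a"
  assumes f: "linear f" and nf: "\<And>x. norm (f x) = norm x"
    and [measurable]: "h \<in> borel_measurable borel"
  shows "(\<integral>\<^sup>+x. h (f x) \<partial>gauss) = (\<integral>\<^sup>+x. h x \<partial>gauss)"
proof -
  have [measurable]: "f \<in> borel_measurable borel"
    using f by (simp add: borel_measurable_continuous_onI linear_continuous_on linear_linear)
  have "(\<integral>\<^sup>+x. h x \<partial>gauss) = (\<integral>\<^sup>+x. ennreal ((1 / sqrt (2 * pi)) ^ DIM('a) * exp (- (norm x)\<^sup>2 / 2)) * h x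
     \<partial>distr lborel borel f)"
    unfolding gauss_def lborel_isometry[OF f nf] gauss_density_norm by (subst nn_integral_density) auto
  also have "\<dots> = (\<integral>\<^sup>+x. h (f x) \<partial>gauss)"
    unfolding gauss_def gauss_density_norm
    by (subst nn_integral_density, simp, simp, subst nn_integral_distr) (simp_all add: nf)
  finally show ?thesis by simp
qed

text \<open>Combined with invariance under isometries of the product space, this turns a rotation of
  a pair into a statement about two independent Gaussian vectors.\<close>

lemma gauss_prod: "(gauss :: ('a::euclidean_space \<times> 'b::euclidean_space) measure) = gauss \<Otimes>\<^sub>M gauss"
proof -
  have "gauss \<Otimes>\<^sub>M gauss = density (lborel \<Otimes>\<^sub>M lborel)
     (\<lambda>(x, y). ennreal (\<Prod>b\<in>Basis. std_normal_density ((x::'a) \<bullet> b)) *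
        ennreal (\<Prod>b\<in>Basis. std_normal_density ((y::'b) \<bullet> b)))"
    unfolding gauss_def
    by (rule pair_measure_density)
      (auto simp: sigma_finite_lborel gauss_def[symmetric] gauss.sigma_finite_measure_axioms)
  also have "\<dots> = gauss"
    unfolding gauss_def lborel_prod
    by (rule arg_cong2[where f=density])
      (auto simp: fun_eq_iff gauss_density_norm norm_Pair power_add exp_add add_divide_distrib
         simp flip: ennreal_mult exp_add)
  finally show ?thesis by simp
qed

lemma sets_gauss_pair: "sets (gauss \<Otimes>\<^sub>M gauss :: ('a::euclidean_space \<times> 'b::euclidean_space) measure) = sets borel"
  by (subst gauss_prod[symmetric]) simp

lemma nn_integral_gauss_Pair:
  fixes f :: "'a::euclidean_space \<times> 'b::euclidean_space \<Rightarrow> ennreal"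
  assumes "f \<in> borel_measurable borel"
  shows "(\<integral>\<^sup>+z. f z \<partial>gauss) = (\<integral>\<^sup>+x. \<integral>\<^sup>+y. f (x, y) \<partial>gauss \<partial>gauss)"
  using assms measurable_cong_sets[OF sets_gauss_pair refl] unfolding gauss_prod
  by (subst gauss.nn_integral_fst[symmetric]) auto

text \<open>\<open>T\<close> sends the standard basis vector \<open>h c\<close> to \<open>c\<close>.
  Substituting \<open>T y\<close> for a Gaussian vector thus turns inner products with an arbitrary
  orthonormal basis into standard coordinates, where Gaussian integrals factor.\<close>

lemma orthonormal_basis_isometry:
  fixes C :: "'a::euclidean_space set"
  assumes orth: "pairwise orthogonal C" and nC: "\<And>c. c \<in> C \<Longrightarrow> norm c = 1" and card: "card C = DIM('a)"
  obtains T :: "'a \<Rightarrow> 'a" and h :: "'a \<Rightarrow> 'a" where "linear T" "\<And>y. norm (T y) = norm y" "bij_betw h C Basis"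
    "\<And>c y. c \<in> C \<Longrightarrow> T y \<bullet> c = y \<bullet> h c"
proof -
  have fin: "finite C" using card card.infinite by fastforce
  then obtain h where h: "bij_betw h C (Basis :: 'a set)"
    using card by (metis finite_Basis finite_same_card_bij)
  define T where "T y = (\<Sum>c\<in>C. (y \<bullet> h c) *\<^sub>R c)" for y
  have lin: "linear T"
    unfolding T_def by (intro linearI) (simp_all add: inner_simps scaleR_add_left sum.distrib scaleR_sum_right)
  have inner: "c \<bullet> d = (if c = d then 1 else 0)" if "c \<in> C" "d \<in> C" for c d
    using orth nC that by (auto simp: pairwise_def orthogonal_def norm_eq_1)
  have Tc: "T y \<bullet> c = y \<bullet> h c" if "c \<in> C" for c y
    using that fin by (simp add: T_def inner_sum_left inner if_distrib sum.delta cong: if_cong)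
  have "(norm (T y))\<^sup>2 = (norm y)\<^sup>2" for y
  proof -
    have "T y \<bullet> T y = (\<Sum>c\<in>C. (y \<bullet> h c) * (y \<bullet> h c))"
      by (subst (2) T_def) (simp add: inner_sum_right Tc)
    also have "\<dots> = y \<bullet> y"
      using sum.reindex_bij_betw[OF h, of "\<lambda>b. (y \<bullet> b) * (y \<bullet> b)"] by (simp add: euclidean_inner[of y y])
    finally show ?thesis by (simp add: power2_norm_eq_inner)
  qed
  then have "norm (T y) = norm y" for y by simp
  with lin h Tc that show thesis by blast
qed

section \<open>Second moments and inverse moments\<close>

lemma nn_integral_std_normal_square: "(\<integral>\<^sup>+x. ennreal (std_normal_density x) * ennreal (x\<^sup>2) \<partial>lborel) = 1"
proof -
  have "has_bochner_integral lborel (\<lambda>x. std_normal_density x * x ^ 2) 1"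
    using std_normal_moment_even[of 1] by simp
  then show ?thesis
    by (auto simp: has_bochner_integral_iff nn_integral_eq_integral simp flip: ennreal_mult)
qed

text \<open>A rotation taking a coordinate axis to the direction of \<open>v\<close> reduces the
  claim to the second moment of one coordinate.\<close>

lemma nn_integral_gauss_inner_square:
  fixes v :: "'a::euclidean_space"
  shows "(\<integral>\<^sup>+x. ennreal ((x \<bullet> v)\<^sup>2) \<partial>gauss) = ennreal ((norm v)\<^sup>2)"
proof (cases "v = 0")
  case False
  define a where "a = v /\<^sub>R norm v"
  have v: "v = norm v *\<^sub>R a" using False by (simp add: a_def)
  have "norm a = 1" using False by (simp add: a_def)
  then obtain C where C: "a \<in> C" "pairwise orthogonal C" "\<And>x. x \<in> C \<Longrightarrow> norm x = 1" "card C = DIM('a)"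
    using vector_in_orthonormal_basis by metis
  obtain T :: "'a \<Rightarrow> 'a" and h :: "'a \<Rightarrow> 'a" where T: "linear T" "\<And>y. norm (T y) = norm y" and h: "bij_betw h C Basis"
    and Th: "\<And>c y. c \<in> C \<Longrightarrow> T y \<bullet> c = y \<bullet> h c"
    by (rule orthonormal_basis_isometry[OF C(2) C(3) C(4)]) (assumption, rule that)
  have ha: "h a \<in> Basis" using C(1) h by (auto simp: bij_betw_def)
  let ?f = "\<lambda>b t. if b = h a then ennreal (t\<^sup>2) else 1"
  have "(\<integral>\<^sup>+x. ennreal ((x \<bullet> v)\<^sup>2) \<partial>gauss) = (\<integral>\<^sup>+y. ennreal ((T y \<bullet> v)\<^sup>2) \<partial>gauss)"
    by (rule nn_integral_gauss_isometry[OF T, symmetric]) simp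
  also have "\<dots> = (\<integral>\<^sup>+y. ennreal ((norm v)\<^sup>2) * (\<Prod>b\<in>Basis. ?f b (y \<bullet> b)) \<partial>gauss)"
  proof (rule nn_integral_cong)
    fix y
    have "T y \<bullet> v = norm v * (y \<bullet> h a)"
      by (subst v) (simp add: Th C(1))
    then show "ennreal ((T y \<bullet> v)\<^sup>2) = ennreal ((norm v)\<^sup>2) * (\<Prod>b\<in>Basis. ?f b (y \<bullet> b))"
      using ha by (simp add: prod.delta power_mult_distrib ennreal_mult)
  qed
  also have "\<dots> = ennreal ((norm v)\<^sup>2) * (\<Prod>b\<in>(Basis::'a set). \<integral>\<^sup>+t. ennreal (std_normal_density t) * ?f b t \<partial>lborel)"
    by (subst nn_integral_cmult, measurable, subst nn_integral_gauss_prod_coords) auto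
  also have "(\<Prod>b\<in>(Basis::'a set). \<integral>\<^sup>+t. ennreal (std_normal_density t) * ?f b t \<partial>lborel) = 1"
    by (intro prod.neutral ballI, rename_tac b, case_tac "b = h a")
      (simp_all add: nn_integral_std_normal_square nn_integral_std_normal_density)
  finally show ?thesis by simp
qed simp

lemma inverse_eq_nn_integral_exp:
  assumes "t \<ge> 0"
  shows "inverse (ennreal t) = (\<integral>\<^sup>+u. ennreal (exp (- u * t)) * indicator {0..} u \<partial>lborel)"
proof (cases "t = 0")
  case True
  \<comment> \<open>At \<open>t = 0\<close> the inverse is \<open>top\<close>, and the integrand is
    the indicator of a half-line of infinite measure.\<close>
  have "emeasure lborel {0::real..} = \<infinity>"
  proof (rule ccontr)
    assume "emeasure lborel {0::real..} \<noteq> \<infinity>"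
    then obtain r where r: "emeasure lborel {0::real..} = ennreal r" "r \<ge> 0"
      by (cases "emeasure lborel {0::real..}") auto
    have "emeasure lborel {0..r + 1} \<le> emeasure lborel {0::real..}"
      by (intro emeasure_mono) auto
    with r show False by simp
  qed
  with True show ?thesis by simp
next
  case False
  then have t: "t > 0" using assms by simp
  have "(\<integral>\<^sup>+u. ennreal (exp (- u * t)) * indicator {0..} u \<partial>lborel) = ennreal (0 - (- exp (- 0 * t) / t))"
  proof (rule nn_integral_FTC_atLeast)
    show "((\<lambda>u. - exp (- u * t) / t) \<longlongrightarrow> 0) at_top" using t by real_asymp
    show "((\<lambda>u. - exp (- u * t) / t) has_real_derivative exp (- x * t)) (at x)" for x
      using t by (auto intro!: derivative_eq_intros)
  qed simp_all
  then show ?thesis using t by (simp add: inverse_ennreal divide_inverse)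
qed

lemma nn_integral_std_normal_exp_square:
  assumes "u \<ge> 0"
  shows "(\<integral>\<^sup>+x. ennreal (std_normal_density x) * ennreal (exp (- u * x\<^sup>2)) \<partial>lborel) =
    ennreal (1 / sqrt (1 + 2 * u))"
proof -
  let ?s = "1 / sqrt (1 + 2 * u)"
  have s: "?s > 0" using assms by simp
  have "std_normal_density x * exp (- u * x\<^sup>2) = ?s * normal_density 0 ?s x" for x
    using assms
    by (simp add: normal_density_def power_divide real_sqrt_divide real_sqrt_mult field_simps flip: exp_add)
  then have "(\<integral>\<^sup>+x. ennreal (std_normal_density x) * ennreal (exp (- u * x\<^sup>2)) \<partial>lborel) =
     (\<integral>\<^sup>+x. ennreal (?s * normal_density 0 ?s x) \<partial>lborel)"
    by (simp flip: ennreal_mult)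
  also have "\<dots> = ennreal ?s"
    using s by (subst nn_integral_eq_integral) simp_all
  finally show ?thesis .
qed

text \<open>This is the mean of the inverse of a chi-squared variable with \<open>card B\<close>
  degrees of freedom. The exponential makes the integrand factor over coordinates; each coordinate
  in \<open>B\<close> contributes \<open>1 / sqrt (1 + 2 * u)\<close>, and the remaining integral
  over \<open>u\<close> converges exactly when there are more than two of them.\<close>

lemma nn_integral_gauss_inverse_sum_squares:
  fixes B :: "'a::euclidean_space set"
  assumes B: "B \<subseteq> Basis" and d: "card B > 2"
  shows "(\<integral>\<^sup>+x. inverse (ennreal (\<Sum>b\<in>B. (x \<bullet> b)\<^sup>2)) \<partial>gauss) = ennreal (1 / (real (card B) - 2))"
proof -
  let ?d = "card B"
  interpret P: pair_sigma_finite lborel "gauss :: 'a measure" ..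
  have "(\<integral>\<^sup>+x. inverse (ennreal (\<Sum>b\<in>B. (x \<bullet> b)\<^sup>2)) \<partial>gauss) =
     (\<integral>\<^sup>+x. \<integral>\<^sup>+u. ennreal (exp (- u * (\<Sum>b\<in>B. (x \<bullet> b)\<^sup>2))) * indicator {0..} u \<partial>lborel \<partial>gauss)"
    by (simp add: inverse_eq_nn_integral_exp sum_nonneg)
  also have "\<dots> = (\<integral>\<^sup>+u. \<integral>\<^sup>+x. ennreal (exp (- u * (\<Sum>b\<in>B. (x \<bullet> b)\<^sup>2))) * indicator {0..} u \<partial>gauss \<partial>lborel)"
    by (rule P.Fubini') simp
  also have "\<dots> = (\<integral>\<^sup>+u. ennreal ((1 / sqrt (1 + 2 * u)) ^ ?d) * indicator {0..} u \<partial>lborel)"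
  proof (rule nn_integral_cong)
    fix u :: real
    show "(\<integral>\<^sup>+x. ennreal (exp (- u * (\<Sum>b\<in>B. (x \<bullet> b)\<^sup>2))) * indicator {0..} u \<partial>gauss) =
      ennreal ((1 / sqrt (1 + 2 * u)) ^ ?d) * indicator {0..} u"
    proof (cases "u \<ge> 0")
      case True
      let ?f = "\<lambda>b t. if b \<in> B then ennreal (exp (- u * t\<^sup>2)) else 1"
      have "ennreal (exp (- u * (\<Sum>b\<in>B. (x \<bullet> b)\<^sup>2))) = (\<Prod>b\<in>Basis. ?f b (x \<bullet> b))" for x
      proof -
        have "(\<Prod>b\<in>Basis. ?f b (x \<bullet> b)) = (\<Prod>b\<in>B. ennreal (exp (- u * (x \<bullet> b)\<^sup>2)))"
          using B by (subst prod.inter_restrict[symmetric]) (auto simp: Int_absorb1)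
        also have "\<dots> = ennreal (exp (- u * (\<Sum>b\<in>B. (x \<bullet> b)\<^sup>2)))"
          using finite_subset[OF B] by (simp add: prod_ennreal exp_sum sum_distrib_left flip: sum_negf)
        finally show ?thesis by simp
      qed
      then have "(\<integral>\<^sup>+x. ennreal (exp (- u * (\<Sum>b\<in>B. (x \<bullet> b)\<^sup>2))) \<partial>gauss) =
         (\<Prod>b\<in>(Basis::'a set). \<integral>\<^sup>+t. ennreal (std_normal_density t) * ?f b t \<partial>lborel)"
        by (simp only:) (rule nn_integral_gauss_prod_coords, simp)
      also have "\<dots> = (\<Prod>b\<in>(Basis::'a set). if b \<in> B then ennreal (1 / sqrt (1 + 2 * u)) else 1)"
        using nn_integral_std_normal_exp_square[OF True]
        by (intro prod.cong) (simp_all add: nn_integral_std_normal_density)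
      also have "\<dots> = (\<Prod>b\<in>B. ennreal (1 / sqrt (1 + 2 * u)))"
        using B by (subst prod.inter_restrict[symmetric]) (auto simp: Int_absorb1)
      also have "\<dots> = ennreal ((1 / sqrt (1 + 2 * u)) ^ ?d)"
        using True by (simp add: ennreal_power)
      finally show ?thesis using True by simp
    qed simp
  qed
  also have "\<dots> = (\<integral>\<^sup>+u. ennreal ((1 + 2 * u) powr (- real ?d / 2)) * indicator {0..} u \<partial>lborel)"
  proof (intro nn_integral_cong, clarsimp split: split_indicator)
    fix u :: real assume "0 \<le> u"
    then have "(1 / sqrt (1 + 2 * u)) ^ ?d = ((1 + 2 * u) powr (- 1 / 2)) powr real ?d"
      by (subst powr_realpow) (auto simp: powr_minus_divide powr_half_sqrt)
    then show "(1 / sqrt (1 + 2 * u)) ^ ?d = (1 + 2 * u) powr - (real ?d / 2)"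
      by (simp add: powr_powr)
  qed
  also have "\<dots> = ennreal (0 - (- ((1 + 2 * 0) powr (1 - real ?d / 2)) / (real ?d - 2)))"
  proof (rule nn_integral_FTC_atLeast)
    have "((\<lambda>u. (1 + 2 * u) powr (1 - real ?d / 2)) \<longlongrightarrow> 0) at_top"
      using d by (intro tendsto_neg_powr filterlim_tendsto_add_at_top[OF tendsto_const]
         filterlim_tendsto_pos_mult_at_top[OF tendsto_const _ filterlim_ident]) auto
    then show "((\<lambda>u. - ((1 + 2 * u) powr (1 - real ?d / 2)) / (real ?d - 2)) \<longlongrightarrow> 0) at_top"
      using d tendsto_divide[OF tendsto_minus tendsto_const[of "real ?d - 2"]] by fastforce
    show "((\<lambda>u. - ((1 + 2 * u) powr (1 - real ?d / 2)) / (real ?d - 2)) has_real_derivative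
        (1 + 2 * x) powr (- real ?d / 2)) (at x)" if "0 \<le> x" for x
    proof -
      have "((\<lambda>u. (1 + 2 * u) powr (1 - real ?d / 2)) has_real_derivative
        ((1 - real ?d / 2) * (1 + 2 * x) powr (1 - real ?d / 2 - 1)) * 2) (at x)"
        using that by (intro DERIV_fun_powr[THEN DERIV_cong]) (auto intro!: derivative_eq_intros)
      from DERIV_cdivide[OF DERIV_minus[OF this], of "real ?d - 2"] show ?thesis
        using d by (elim DERIV_cong) (simp add: field_simps)
    qed
  qed simp_all
  finally show ?thesis by simp
qed

lemma ennreal_inverse_antimono:
  fixes a b :: ennreal
  shows "a \<le> b \<Longrightarrow> inverse b \<le> inverse a"
  by (simp add: less_eq_ennreal.rep_eq inverse_ennreal.rep_eq ereal_inverse_antimono)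

text \<open>In an orthonormal basis adapted to \<open>W\<close> and its orthogonal complement, the
  squared distance to \<open>W\<close> is the sum of the squares of the
  \<open>DIM('a) - dim W\<close> coordinates along the complement.\<close>

lemma nn_integral_gauss_inverse_infdist:
  fixes W :: "'a::euclidean_space set"
  assumes W: "subspace W" and d: "dim W + 2 < DIM('a)"
  shows "(\<integral>\<^sup>+x. inverse (ennreal ((infdist x W)\<^sup>2)) \<partial>gauss) \<le> ennreal (1 / (real DIM('a) - real (dim W) - 2))"
proof -
  define V where "V = {y \<in> UNIV. \<forall>x\<in>W. orthogonal x y}"
  have dimV: "dim V + dim W = DIM('a)"
    using dim_subspace_orthogonal_to_vectors[OF W subspace_UNIV] by (simp add: V_def)
  have "subspace V" by (auto simp: V_def subspace_def orthogonal_clauses)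
  then obtain C where C: "C \<subseteq> V" "pairwise orthogonal C" "\<And>x. x \<in> C \<Longrightarrow> norm x = 1" "card C = dim V" "independent C"
    using orthonormal_basis_subspace by metis
  obtain D where D: "D \<subseteq> W" "pairwise orthogonal D" "\<And>x. x \<in> D \<Longrightarrow> norm x = 1" "card D = dim W" "independent D"
    using orthonormal_basis_subspace[OF W] by metis
  have perp: "orthogonal c w" if "c \<in> C" "w \<in> W" for c w
    using that C(1) by (auto simp: V_def orthogonal_commute)
  have disj: "C \<inter> D = {}"
  proof (rule ccontr)
    assume "C \<inter> D \<noteq> {}"
    then obtain x where "x \<in> C" "x \<in> D" by auto
    with perp[of x x] D(1) C(3)[of x] show False by (auto simp: orthogonal_def subset_iff)
  qed
  have fin: "finite C" "finite D" using C(5) D(5) independent_imp_finite by auto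
  have "pairwise orthogonal (C \<union> D)"
    using C(2) D(2) perp perp[THEN orthogonal_commute[THEN iffD1]] D(1) by (auto simp: pairwise_def subset_iff)
  moreover have "norm x = 1" if "x \<in> C \<union> D" for x using C(3) D(3) that by auto
  moreover have "card (C \<union> D) = DIM('a)"
    using fin disj C(4) D(4) dimV by (simp add: card_Un_disjoint)
  ultimately obtain T :: "'a \<Rightarrow> 'a" and h :: "'a \<Rightarrow> 'a" where T: "linear T" "\<And>y. norm (T y) = norm y" and h: "bij_betw h (C \<union> D) Basis"
    and Th: "\<And>c y. c \<in> C \<union> D \<Longrightarrow> T y \<bullet> c = y \<bullet> h c"
    by (rule orthonormal_basis_isometry) (assumption, rule that)
  have injC: "inj_on h C" using h by (auto simp: bij_betw_def intro: inj_on_subset)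
  have hC: "h ` C \<subseteq> Basis" using h by (auto simp: bij_betw_def)
  have "surj T" using T by (simp add: orthogonal_transformation orthogonal_transformation_surj)
  \<comment> \<open>A lower bound on the distance is enough, because taking inverses reverses the
    order.\<close>
  have le: "(\<Sum>b\<in>h ` C. (y \<bullet> b)\<^sup>2) \<le> (infdist (T y) W)\<^sup>2" for y
  proof -
    have "sqrt (\<Sum>b\<in>h ` C. (y \<bullet> b)\<^sup>2) \<le> dist (T y) w" if "w \<in> W" for w
    proof -
      obtain z where z: "w = T z" using \<open>surj T\<close> by (metis surjD)
      have "y \<bullet> h c = (y - z) \<bullet> h c" if "c \<in> C" for c
      proof -
        have "z \<bullet> h c = w \<bullet> c" using Th[of c z] that by (simp add: z)
        also have "\<dots> = 0" using perp[OF that \<open>w \<in> W\<close>] by (simp add: orthogonal_def inner_commute)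
        finally show ?thesis by (simp add: inner_diff_left)
      qed
      then have "(\<Sum>b\<in>h ` C. (y \<bullet> b)\<^sup>2) = (\<Sum>b\<in>h ` C. ((y - z) \<bullet> b)\<^sup>2)"
        by (intro sum.cong) auto
      also have "\<dots> \<le> (\<Sum>b\<in>Basis. ((y - z) \<bullet> b)\<^sup>2)"
        using hC by (intro sum_mono2) auto
      also have "\<dots> = (norm (y - z))\<^sup>2"
        unfolding power2_norm_eq_inner by (subst (2) euclidean_inner) (simp add: power2_eq_square)
      also have "\<dots> = (dist (T y) w)\<^sup>2"
        by (simp add: z dist_norm T(2) flip: linear_diff[OF T(1)])
      finally show ?thesis by (intro real_le_lsqrt) (auto simp: sum_nonneg)
    qed
    moreover have "W \<noteq> {}" using W subspace_0 by blast
    ultimately have "sqrt (\<Sum>b\<in>h ` C. (y \<bullet> b)\<^sup>2) \<le> infdist (T y) W"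
      unfolding infdist_notempty[OF \<open>W \<noteq> {}\<close>] by (intro cINF_greatest) auto
    then show ?thesis by (simp add: sum_nonneg real_sqrt_le_iff' sqrt_le_D)
  qed
  have [measurable]: "(\<lambda>x. infdist x W) \<in> borel_measurable borel"
    by (intro borel_measurable_continuous_onI continuous_intros)
  have "(\<integral>\<^sup>+x. inverse (ennreal ((infdist x W)\<^sup>2)) \<partial>gauss) =
     (\<integral>\<^sup>+y. inverse (ennreal ((infdist (T y) W)\<^sup>2)) \<partial>gauss)"
    by (rule nn_integral_gauss_isometry[OF T, symmetric]) simp
  also have "\<dots> \<le> (\<integral>\<^sup>+y. inverse (ennreal (\<Sum>b\<in>h ` C. (y \<bullet> b)\<^sup>2)) \<partial>gauss)"
    by (intro nn_integral_mono ennreal_inverse_antimono ennreal_leI le)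
  also have "\<dots> = ennreal (1 / (real (card (h ` C)) - 2))"
    using d C(4) dimV by (intro nn_integral_gauss_inverse_sum_squares[OF hC]) (simp add: card_image[OF injC])
  also have "card (h ` C) = DIM('a) - dim W"
    using C(4) dimV by (simp add: card_image[OF injC])
  finally show ?thesis using d by (simp add: of_nat_diff)
qed

subsection \<open>Real and complex matrices\<close>

text \<open>The common treatment of real and complex scalars: \<open>DIM('a)\<close> is \<open>1\<close> or \<open>2\<close>, and the paper's \<open>\<alpha>\<close> is
  \<open>2 / DIM('a) - 1\<close>.\<close>

class rc_scalar = real_normed_field + euclidean_space + conjugatable_field +
  assumes inner_mult_conjugate: "inner (a * x) y = inner x (conjugate a * y)"

instance real :: rc_scalar
  by standard simp

instance complex :: rc_scalar
  by standard (simp add: inner_complex_def algebra_simps)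

text \<open>By the class axiom, \<open>conjugate x\<close> is the adjoint of multiplication by
  \<open>x\<close>, applied to \<open>1\<close>. Adjoints depend linearly on the operator over the
  reals, which testing against all \<open>z\<close> makes precise.\<close>

lemma conjugate_scaleR: "conjugate (r *\<^sub>R x) = r *\<^sub>R conjugate x" for x :: "'a::rc_scalar"
proof -
  have "z \<bullet> conjugate (r *\<^sub>R x) = z \<bullet> (r *\<^sub>R conjugate x)" for z
    using inner_mult_conjugate[of "r *\<^sub>R x" z 1] inner_mult_conjugate[of x z 1] by simp
  then show ?thesis using vector_eq_ldot by metis
qed

lemma conjugate_1 [simp]: "conjugate (1 :: 'a::rc_scalar) = 1"
  using conjugate_dist_mul[of "conjugate 1 :: 'a" 1] by simp

lemma conjugate_diff: "conjugate (x - y) = conjugate x - conjugate (y :: 'a::rc_scalar)"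
  using conjugate_dist_add[of x "- y"] by (simp add: conjugate_neg)

lemma norm_conjugate [simp]: "norm (conjugate x) = norm (x :: 'a::rc_scalar)"
proof -
  have "conjugate x \<bullet> conjugate x = x \<bullet> x"
    using inner_mult_conjugate[of x "conjugate x" 1] inner_mult_conjugate[of "conjugate x" x 1]
    by (simp add: mult.commute)
  then show ?thesis by (simp add: norm_eq_sqrt_inner)
qed

text \<open>Polarisation of \<open>norm (a * x) = norm a * norm x\<close>.\<close>

lemma inner_mult_mult: "(a * x) \<bullet> (a * y) = (norm a)\<^sup>2 * (x \<bullet> y)" for a :: "'a::rc_scalar"
proof -
  have "(norm (a * x + a * y))\<^sup>2 = (norm a)\<^sup>2 * (norm (x + y))\<^sup>2"
    by (simp add: norm_mult power_mult_distrib flip: distrib_left)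
  then show ?thesis
    by (simp add: dot_norm norm_mult power_mult_distrib field_simps)
qed

lemma conjugate_mult_self: "conjugate a * a = of_real ((norm a)\<^sup>2)" for a :: "'a::rc_scalar"
proof -
  have "(conjugate a * a) \<bullet> z = of_real ((norm a)\<^sup>2) \<bullet> z" for z
    using inner_mult_conjugate[of "conjugate a" a z] inner_mult_mult[of a 1 z]
    by (simp add: of_real_def)
  then show ?thesis using vector_eq_rdot by metis
qed

lemma inner_conjugate_right: "x \<bullet> (c * y) = (conjugate c * x) \<bullet> y" for x :: "'a::rc_scalar"
  by (simp add: inner_mult_conjugate)

section \<open>Matrix algebra, adjoints and Pythagoras for projectors\<close>

lemma matrix_diff_ldistrib: "A ** (B - C) = A ** B - A ** (C :: 'a::ring_1^'n^'k)"
  by (simp add: matrix_matrix_mult_def vec_eq_iff right_diff_distrib sum_subtractf)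

lemma matrix_diff_rdistrib: "(B - C) ** A = B ** A - (C :: 'a::ring_1^'n^'k) ** A"
  by (simp add: matrix_matrix_mult_def vec_eq_iff left_diff_distrib sum_subtractf)

lemma matrix_add_rdistrib: "(B + C) ** A = B ** A + (C :: 'a::ring_1^'n^'k) ** A"
  by (simp add: matrix_matrix_mult_def vec_eq_iff distrib_right sum.distrib)

lemma matrix_uminus_left: "(- A) ** B = - (A ** (B :: 'a::ring_1^'n^'k))"
  by (simp add: matrix_matrix_mult_def vec_eq_iff sum_negf)

lemma matrix_scaleR_left: "(r *\<^sub>R A) ** B = r *\<^sub>R (A ** (B :: 'a::rc_scalar^'n^'k))"
  by (simp add: matrix_matrix_mult_def vec_eq_iff scaleR_sum_right)

lemma matrix_scaleR_right: "A ** (r *\<^sub>R B) = r *\<^sub>R (A ** (B :: 'a::rc_scalar^'n^'k))"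
  by (simp add: matrix_matrix_mult_def vec_eq_iff scaleR_sum_right)

lemma ctranspose_ctranspose [simp]: "ctranspose (ctranspose A) = A"
  by (simp add: ctranspose_def vec_eq_iff)

lemma ctranspose_mat_1 [simp]: "ctranspose (mat 1 :: 'a::rc_scalar^'n^'n) = mat 1"
  by (simp add: ctranspose_def mat_def vec_eq_iff)

lemma ctranspose_zero [simp]: "ctranspose 0 = 0"
  by (simp add: ctranspose_def vec_eq_iff)

lemma ctranspose_add: "ctranspose (A + B) = ctranspose A + ctranspose (B :: 'a::rc_scalar^'n^'m)"
  by (simp add: ctranspose_def vec_eq_iff conjugate_dist_add)

lemma ctranspose_diff: "ctranspose (A - B) = ctranspose A - ctranspose (B :: 'a::rc_scalar^'n^'m)"
  by (simp add: ctranspose_def vec_eq_iff conjugate_diff)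

lemma linear_ctranspose: "linear (ctranspose :: 'a::rc_scalar^'n^'m \<Rightarrow> 'a^'m^'n)"
  by (intro linearI) (simp_all add: ctranspose_def vec_eq_iff conjugate_dist_add conjugate_scaleR)

lemma linear_matrix_mult_left: "linear (\<lambda>X :: 'a::rc_scalar^'n^'k. A ** X)"
  by (intro linearI) (simp_all add: matrix_add_ldistrib matrix_scaleR_right)

lemma linear_matrix_mult_right: "linear (\<lambda>X :: 'a::rc_scalar^'n^'k. X ** A)"
  by (intro linearI) (simp_all add: matrix_add_rdistrib matrix_scaleR_left)

lemma norm_vec_squared: "(norm x)\<^sup>2 = (\<Sum>i\<in>UNIV. (norm (x $ i))\<^sup>2)"
  by (simp add: norm_vec_def L2_set_def sum_nonneg)

lemma norm_matrix_squared: "(norm A)\<^sup>2 = (\<Sum>i\<in>UNIV. \<Sum>j\<in>UNIV. (norm (A $ i $ j))\<^sup>2)"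
  by (simp add: norm_vec_squared)

lemma norm_ctranspose [simp]: "norm (ctranspose A) = norm (A :: 'a::rc_scalar^'n^'m)"
proof -
  have "(norm (ctranspose A))\<^sup>2 = (norm A)\<^sup>2"
    unfolding norm_matrix_squared by (subst sum.swap) (simp add: ctranspose_def)
  then show ?thesis by simp
qed

lemma inner_matrix_mult_left: "(A ** B) \<bullet> C = B \<bullet> (ctranspose A ** (C :: 'a::rc_scalar^'n^'m))"
proof -
  have "(A ** B) \<bullet> C = (\<Sum>i\<in>UNIV. \<Sum>j\<in>UNIV. \<Sum>k\<in>UNIV. (A $ i $ k * B $ k $ j) \<bullet> C $ i $ j)"
    by (simp add: inner_vec_def matrix_matrix_mult_def inner_sum_left)
  also have "\<dots> = (\<Sum>j\<in>UNIV. \<Sum>i\<in>UNIV. \<Sum>k\<in>UNIV. (A $ i $ k * B $ k $ j) \<bullet> C $ i $ j)"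
    by (rule sum.swap)
  also have "\<dots> = (\<Sum>j\<in>UNIV. \<Sum>k\<in>UNIV. \<Sum>i\<in>UNIV. (A $ i $ k * B $ k $ j) \<bullet> C $ i $ j)"
    by (intro sum.cong refl) (rule sum.swap)
  also have "\<dots> = (\<Sum>k\<in>UNIV. \<Sum>j\<in>UNIV. \<Sum>i\<in>UNIV. B $ k $ j \<bullet> (conjugate (A $ i $ k) * C $ i $ j))"
    by (subst sum.swap) (simp add: inner_mult_conjugate)
  also have "\<dots> = B \<bullet> (ctranspose A ** C)"
    by (simp add: inner_vec_def matrix_matrix_mult_def inner_sum_right ctranspose_def)
  finally show ?thesis .
qed

lemma inner_ctranspose: "ctranspose A \<bullet> ctranspose B = A \<bullet> (B :: 'a::rc_scalar^'n^'m)"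
  using norm_ctranspose[of "A + B"] by (simp add: dot_norm ctranspose_add)

lemma inner_matrix_mult_right: "(A ** B) \<bullet> C = A \<bullet> ((C :: 'a::rc_scalar^'n^'m) ** ctranspose B)"
  using inner_matrix_mult_left[of "ctranspose B" "ctranspose A" "ctranspose C"]
  by (simp add: inner_ctranspose flip: ctranspose_mult)
     (metis ctranspose_ctranspose ctranspose_mult inner_ctranspose)

lemma matrix_eq_0_if_ctranspose_mult_self:
  assumes "ctranspose X ** X = 0"
  shows "X = (0 :: 'a::rc_scalar^'n^'m)"
  using inner_matrix_mult_left[of X "mat 1" X] assms by simp

lemma norm_projector_left:
  assumes "ctranspose E = E" "E ** E = E"
  shows "(norm (E ** X))\<^sup>2 + (norm (X - E ** X))\<^sup>2 = (norm (X :: 'a::rc_scalar^'n^'m))\<^sup>2"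
proof -
  have "(E ** X) \<bullet> (X - E ** X) = 0"
    using assms by (simp add: inner_matrix_mult_left matrix_diff_ldistrib matrix_mul_assoc)
  then show ?thesis
    using norm_add_Pythagorean[of "E ** X" "X - E ** X"] by (simp add: orthogonal_def)
qed

lemma norm_projector_right:
  assumes "ctranspose E = E" "E ** E = E"
  shows "(norm (X ** E))\<^sup>2 + (norm (X - X ** E))\<^sup>2 = (norm (X :: 'a::rc_scalar^'n^'m))\<^sup>2"
  using norm_projector_left[OF assms, of "ctranspose X"] norm_ctranspose[of "X ** E"] norm_ctranspose[of "X - X ** E"]
  by (simp add: assms ctranspose_mult ctranspose_diff)

text \<open>A family of at most \<open>CARD('c)\<close> vectors is a matrix with columns indexed by the fixed type \<open>'c\<close> that
  vanish outside an index set \<open>S\<close>; so the number of vectors need not be the size of a type.\<close>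

definition coord_proj :: "'c set \<Rightarrow> 'a::{zero,one}^'c^'c" where
  "coord_proj S = (\<chi> i j. if i = j \<and> i \<in> S then 1 else 0)"

lemma coord_proj_UNIV [simp]: "coord_proj UNIV = mat 1"
  by (simp add: coord_proj_def mat_def vec_eq_iff)

lemma coord_proj_mult_left: "(coord_proj S ** X) $ i $ j = (if i \<in> S then X $ i $ j else 0)"
  for X :: "'a::rc_scalar^'n^'c"
proof -
  have "(coord_proj S ** X) $ i $ j = (\<Sum>k\<in>UNIV. if k = i then if i \<in> S then X $ i $ j else 0 else 0)"
    unfolding coord_proj_def matrix_matrix_mult_def vec_lambda_beta by (rule sum.cong) auto
  then show ?thesis by simp
qed

lemma coord_proj_mult_right: "(X ** coord_proj S) $ i $ j = (if j \<in> S then X $ i $ j else 0)"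
  for X :: "'a::rc_scalar^'c^'n"
proof -
  have "(X ** coord_proj S) $ i $ j = (\<Sum>k\<in>UNIV. if k = j then if j \<in> S then X $ i $ j else 0 else 0)"
    unfolding coord_proj_def matrix_matrix_mult_def vec_lambda_beta by (rule sum.cong) auto
  then show ?thesis by simp
qed

lemma coord_proj_projector [simp]:
  "ctranspose (coord_proj S :: 'a::rc_scalar^'c^'c) = coord_proj S"
  "coord_proj S ** coord_proj S = (coord_proj S :: 'a::rc_scalar^'c^'c)"
  by (auto simp: coord_proj_mult_left vec_eq_iff) (auto simp: coord_proj_def ctranspose_def)

definition orthonormal_cols :: "'c set \<Rightarrow> 'a::rc_scalar^'c^'n \<Rightarrow> bool" where
  "orthonormal_cols S Q \<longleftrightarrow> ctranspose Q ** Q = coord_proj S"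

text \<open>The columns outside \<open>S\<close> have zero diagonal entries in the Gram matrix, so
  they vanish. Here this appears as the vanishing of the Gram matrix of
  \<open>Q - Q ** coord_proj S\<close>.\<close>

lemma orthonormal_cols_mult_coord_proj:
  assumes "orthonormal_cols S Q"
  shows "Q ** coord_proj S = Q" "coord_proj S ** ctranspose Q = ctranspose Q"
proof -
  have "ctranspose (Q - Q ** coord_proj S) ** (Q - Q ** coord_proj S) = 0"
    using assms by (simp add: orthonormal_cols_def ctranspose_diff ctranspose_mult matrix_diff_ldistrib
        matrix_diff_rdistrib matrix_mul_assoc flip: matrix_mul_assoc[of _ "ctranspose Q" Q])
  from matrix_eq_0_if_ctranspose_mult_self[OF this] show 1: "Q ** coord_proj S = Q" by simp
  show "coord_proj S ** ctranspose Q = ctranspose Q"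
    by (subst (2) 1[symmetric]) (simp add: ctranspose_mult)
qed

lemma orthonormal_cols_projector:
  assumes "orthonormal_cols S Q"
  shows "ctranspose (Q ** ctranspose Q) = Q ** ctranspose Q"
    "(Q ** ctranspose Q) ** (Q ** ctranspose Q) = Q ** ctranspose Q"
    "ctranspose Q ** (Q ** ctranspose Q) = ctranspose Q"
    "(Q ** ctranspose Q) ** Q = Q"
proof -
  note * = assms[unfolded orthonormal_cols_def] orthonormal_cols_mult_coord_proj[OF assms]
  show "ctranspose (Q ** ctranspose Q) = Q ** ctranspose Q" by (simp add: ctranspose_mult)
  show "ctranspose Q ** (Q ** ctranspose Q) = ctranspose Q" by (simp add: matrix_mul_assoc *)
  show 3: "(Q ** ctranspose Q) ** Q = Q" by (simp add: * flip: matrix_mul_assoc)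
  show "(Q ** ctranspose Q) ** (Q ** ctranspose Q) = Q ** ctranspose Q"
    by (simp add: 3 matrix_mul_assoc)
qed

lemma norm_orthonormal_cols_mult:
  assumes "orthonormal_cols S Q"
  shows "norm (Q ** X) = norm (coord_proj S ** X)"
proof -
  have "(Q ** X) \<bullet> (Q ** X) = (coord_proj S ** X) \<bullet> (coord_proj S ** X)"
    using assms by (simp add: inner_matrix_mult_left matrix_mul_assoc orthonormal_cols_def)
  then show ?thesis by (simp add: norm_eq_sqrt_inner)
qed

lemma norm_orthonormal_cols_mult_le:
  assumes "orthonormal_cols S Q"
  shows "norm (Q ** X) \<le> norm X"
proof -
  have "(norm (coord_proj S ** X))\<^sup>2 \<le> (norm X)\<^sup>2"
    using norm_projector_left[OF coord_proj_projector, of S X] zero_le_power2[of "norm (X - coord_proj S ** X)"]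
    by linarith
  then show ?thesis
    by (simp add: norm_orthonormal_cols_mult[OF assms])
qed

lemma norm_ctranspose_orthonormal_cols_mult:
  assumes "orthonormal_cols S Q"
  shows "norm (ctranspose Q ** X) = norm (Q ** ctranspose Q ** X)"
  using norm_orthonormal_cols_mult[OF assms, of "ctranspose Q ** X"] orthonormal_cols_mult_coord_proj[OF assms]
  by (simp add: matrix_mul_assoc)

lemma norm_ctranspose_orthonormal_cols_mult_le:
  assumes "orthonormal_cols S Q"
  shows "norm (ctranspose Q ** X) \<le> norm X"
proof -
  note p = orthonormal_cols_projector[OF assms]
  have "(norm (Q ** ctranspose Q ** X))\<^sup>2 \<le> (norm X)\<^sup>2"
    using norm_projector_left[OF p(1,2), of X] zero_le_power2[of "norm (X - Q ** ctranspose Q ** X)"]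
    by linarith
  then show ?thesis
    by (simp add: norm_ctranspose_orthonormal_cols_mult[OF assms])
qed

section \<open>Measurability of matrix operations\<close>

lemma borel_measurable_linear:
  fixes f :: "'a::euclidean_space \<Rightarrow> 'b::euclidean_space"
  shows "linear f \<Longrightarrow> f \<in> borel_measurable borel"
  by (simp add: borel_measurable_continuous_onI linear_continuous_on linear_linear)

lemma borel_measurable_ctranspose [measurable (raw)]:
  fixes f :: "'x \<Rightarrow> 'a::rc_scalar^'n^'m"
  shows "f \<in> borel_measurable M \<Longrightarrow> (\<lambda>x. ctranspose (f x)) \<in> borel_measurable M"
  using measurable_compose[OF _ borel_measurable_linear[OF linear_ctranspose]] .

lemma borel_measurable_matrix_nth [measurable (raw)]:
  fixes f :: "'x \<Rightarrow> 'a::euclidean_space^'n"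
  shows "f \<in> borel_measurable M \<Longrightarrow> (\<lambda>x. f x $ i) \<in> borel_measurable M"
  using measurable_compose[OF _ borel_measurable_linear[of "\<lambda>x. x $ i"]]
  by (simp add: linear_iff)

lemma borel_measurable_vec_lambda [measurable (raw)]:
  fixes f :: "'n::finite \<Rightarrow> 'x \<Rightarrow> 'a::euclidean_space"
  assumes "\<And>i. f i \<in> borel_measurable M"
  shows "(\<lambda>x. \<chi> i. f i x) \<in> borel_measurable M"
proof (rule borel_measurable_euclidean_space[THEN iffD2], intro ballI)
  fix b :: "'a^'n" assume "b \<in> Basis"
  then obtain i e where b: "b = axis i e" "e \<in> Basis" by (auto simp: Basis_vec_def)
  show "(\<lambda>x. (\<chi> i. f i x) \<bullet> b) \<in> borel_measurable M"
    using assms by (simp add: b inner_axis)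
qed

lemma borel_measurable_matrix_mult [measurable (raw)]:
  fixes f :: "'x \<Rightarrow> 'a::rc_scalar^'k^'m" and g :: "'x \<Rightarrow> 'a^'n^'k"
  assumes [measurable]: "f \<in> borel_measurable M" "g \<in> borel_measurable M"
  shows "(\<lambda>x. f x ** g x) \<in> borel_measurable M"
  unfolding matrix_matrix_mult_def by measurable

lemma borel_measurable_det:
  fixes f :: "'x \<Rightarrow> 'a::rc_scalar^'n^'n"
  assumes [measurable]: "\<And>i j. (\<lambda>x. f x $ i $ j) \<in> borel_measurable M"
  shows "(\<lambda>x. det (f x)) \<in> borel_measurable M"
  unfolding det_def by measurable

subsection \<open>Left inverses of Gaussian matrices\<close>

text \<open>Cramer's rule makes the measurability of the inverse evident; for a singular matrix the
  division by \<open>det M = 0\<close> gives \<open>0\<close>.\<close>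

definition cramer_inverse :: "'a::field^'n^'n \<Rightarrow> 'a^'n^'n" where
  "cramer_inverse M = (\<chi> k j. det (\<chi> i l. if l = k then axis j 1 $ i else M $ i $ l) / det M)"

lemma cramer_inverse:
  fixes M :: "'a::field^'n^'n"
  assumes "det M \<noteq> 0"
  shows "M ** cramer_inverse M = mat 1" "cramer_inverse M ** M = mat 1"
proof -
  have "M *v (\<chi> k. cramer_inverse M $ k $ j) = axis j 1" for j
    using cramer[OF assms] by (simp add: cramer_inverse_def)
  then have "(M ** cramer_inverse M) $ i $ j = mat 1 $ i $ j" for i j
    by (simp add: matrix_vector_mult_def matrix_matrix_mult_def vec_eq_iff mat_def axis_def)
  then show "M ** cramer_inverse M = mat 1" by (simp add: vec_eq_iff)
  then show "cramer_inverse M ** M = mat 1" by (simp add: matrix_left_right_inverse)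
qed

lemma cramer_inverse_singular: "det M = 0 \<Longrightarrow> cramer_inverse M = 0"
  by (simp add: cramer_inverse_def vec_eq_iff)

lemma borel_measurable_cramer_inverse [measurable (raw)]:
  fixes f :: "'x \<Rightarrow> 'a::rc_scalar^'n^'n"
  assumes [measurable]: "f \<in> borel_measurable M"
  shows "(\<lambda>x. cramer_inverse (f x)) \<in> borel_measurable M"
  unfolding cramer_inverse_def
  by (intro borel_measurable_vec_lambda borel_measurable_divide borel_measurable_det)
    (auto simp: borel_measurable_matrix_nth)

text \<open>The matrices \<open>T\<close> of interest have zero columns outside \<open>S\<close>; the summand \<open>mat 1 - coord_proj S\<close>
  makes their Gram matrix regular if and only if the columns with index in \<open>S\<close> are independent. Then
  \<open>left_inv S T\<close> is the pseudoinverse of \<open>T\<close>.\<close>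

definition gram :: "'c set \<Rightarrow> 'a::conjugatable_field^'c^'s \<Rightarrow> 'a^'c^'c" where
  "gram S T = ctranspose T ** T + (mat 1 - coord_proj S)"

definition left_inv :: "'c set \<Rightarrow> 'a::conjugatable_field^'c^'s \<Rightarrow> 'a^'s^'c" where
  "left_inv S T = cramer_inverse (gram S T) ** ctranspose T"

lemma borel_measurable_gram [measurable (raw)]:
  fixes f :: "'x \<Rightarrow> 'a::rc_scalar^'c^'s"
  assumes [measurable]: "f \<in> borel_measurable M"
  shows "(\<lambda>x. gram S (f x)) \<in> borel_measurable M"
  unfolding gram_def by measurable

lemma borel_measurable_left_inv [measurable (raw)]:
  fixes f :: "'x \<Rightarrow> 'a::rc_scalar^'c^'s"
  assumes [measurable]: "f \<in> borel_measurable M"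
  shows "(\<lambda>x. left_inv S (f x)) \<in> borel_measurable M"
  unfolding left_inv_def by measurable

lemma left_inv_singular: "det (gram S T) = 0 \<Longrightarrow> left_inv S T = 0"
  by (simp add: left_inv_def cramer_inverse_singular matrix_matrix_mult_def vec_eq_iff)

text \<open>\<open>T\<close> annihilates the complementary projector
  \<open>mat 1 - coord_proj S\<close>, so \<open>gram S T\<close> acts as the identity on its range,
  and so does the inverse. Since \<open>ctranspose T ** T\<close> is the Gram matrix minus this
  projector, multiplying by the inverse leaves \<open>mat 1\<close> minus the projector.\<close>

lemma
  fixes T :: "'a::rc_scalar^'c^'s"
  assumes det: "det (gram S T) \<noteq> 0" and T: "T ** coord_proj S = T"
  shows left_inv_mult: "left_inv S T ** T = coord_proj S"
    and coord_proj_left_inv: "coord_proj S ** left_inv S T = left_inv S T"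
    and ctranspose_mult_left_inv: "ctranspose (T ** left_inv S T) = T ** left_inv S T"
proof -
  let ?I = "cramer_inverse (gram S T)" and ?D = "mat 1 - coord_proj S :: 'a^'c^'c"
  have T': "coord_proj S ** ctranspose T = ctranspose T"
    by (subst (2) T[symmetric]) (simp add: ctranspose_mult)
  have TD: "T ** ?D = 0" "?D ** ctranspose T = 0" "?D ** ?D = ?D"
    by (simp_all add: matrix_diff_ldistrib matrix_diff_rdistrib T T')
  have GD: "gram S T ** ?D = ?D" "?D ** gram S T = ?D"
    unfolding gram_def matrix_add_rdistrib matrix_add_ldistrib
    by (simp_all add: TD matrix_mul_assoc flip: matrix_mul_assoc[of _ T])
  have ID: "?I ** ?D = ?D" "?D ** ?I = ?D"
    using GD cramer_inverse[OF det] by (metis matrix_mul_assoc matrix_mul_lid matrix_mul_rid)+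
  have "left_inv S T ** T = ?I ** (gram S T - ?D)"
    by (simp add: left_inv_def gram_def matrix_mul_assoc)
  also have "\<dots> = coord_proj S"
    using ID cramer_inverse[OF det] by (simp add: matrix_diff_ldistrib)
  finally show "left_inv S T ** T = coord_proj S" .
  have "?D ** left_inv S T = 0"
    by (simp add: left_inv_def matrix_mul_assoc ID TD)
  then show "coord_proj S ** left_inv S T = left_inv S T"
    by (simp add: matrix_diff_rdistrib)
  have "ctranspose (gram S T) = gram S T"
    by (simp add: gram_def ctranspose_add ctranspose_diff ctranspose_mult)
  then have "ctranspose ?I ** gram S T = mat 1"
    using arg_cong[OF cramer_inverse(1)[OF det], of ctranspose] by (simp add: ctranspose_mult)
  then have "ctranspose ?I = ?I"
    using cramer_inverse[OF det] by (metis matrix_mul_assoc matrix_mul_lid matrix_mul_rid)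
  then show "ctranspose (T ** left_inv S T) = T ** left_inv S T"
    by (simp add: left_inv_def ctranspose_mult matrix_mul_assoc)
qed

text \<open>Links the definite description to the measurable formula by Cramer's rule. The condition
  on the determinant will hold almost surely.\<close>

lemma pseudoinverse_eq_left_inv:
  fixes T :: "'a::rc_scalar^'c^'s"
  assumes det: "det (gram UNIV T) \<noteq> 0"
  shows "pseudoinverse T = left_inv UNIV T"
proof -
  have T: "T ** coord_proj UNIV = T" by simp
  have "is_pseudoinverse T (left_inv UNIV T)"
    using left_inv_mult[OF det T] ctranspose_mult_left_inv[OF det T]
    by (simp add: is_pseudoinverse_def flip: matrix_mul_assoc)
  then show ?thesis
    unfolding pseudoinverse_def by (blast intro: the_equality is_pseudoinverse_unique)
qed

text \<open>The real span of the \<open>'a\<close>-multiples of some columns; working over the reals lets the metric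
  theory of Euclidean spaces apply to real and complex scalars alike.\<close>

definition cols_span :: "'c set \<Rightarrow> 'a::rc_scalar^'c^'s \<Rightarrow> ('a^'s) set" where
  "cols_span S T = span ((\<lambda>(e, j). \<chi> l. e * T $ l $ j) ` (Basis \<times> S))"

lemma subspace_cols_span [simp]: "subspace (cols_span S T)"
  by (simp add: cols_span_def)

lemma dim_cols_span_le:
  fixes T :: "'a::rc_scalar^'c^'s"
  shows "dim (cols_span S T) \<le> DIM('a) * card (S :: 'c::finite set)"
proof -
  have "dim (cols_span S T) \<le> card ((\<lambda>(e, j). \<chi> l. e * T $ l $ j :: 'a^'s) ` (Basis \<times> S))"
    unfolding cols_span_def by (rule dim_le_card) auto
  also have "\<dots> \<le> card ((Basis :: 'a set) \<times> S)" by (intro card_image_le) auto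
  finally show ?thesis by (simp add: card_cartesian_product)
qed

lemma scaled_col_in_cols_span:
  fixes T :: "'a::rc_scalar^'c^'s"
  assumes "j \<in> S"
  shows "(\<chi> l. c * T $ l $ j) \<in> cols_span S T"
proof -
  have "(\<chi> l. c * T $ l $ j) = (\<Sum>e\<in>Basis. (c \<bullet> e) *\<^sub>R (\<chi> l. e * T $ l $ j))"
    by (subst (1) euclidean_representation[of c, symmetric])
      (simp add: vec_eq_iff sum_distrib_right)
  also have "\<dots> \<in> cols_span S T"
    unfolding cols_span_def
  proof (intro span_sum span_scale span_base)
    fix e :: 'a assume "e \<in> Basis"
    then show "(\<chi> l. e * T $ l $ j) \<in> (\<lambda>(e, j). \<chi> l. e * T $ l $ j) ` (Basis \<times> S)"
      using assms by (intro image_eqI[of _ _ "(e, j)"]) auto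
  qed
  finally show ?thesis .
qed

lemma sum_cols_in_cols_span:
  fixes T :: "'a::rc_scalar^'c^'s"
  assumes "\<And>l. v $ l = (\<Sum>j\<in>S. c j * T $ l $ j)"
  shows "v \<in> cols_span S T"
proof -
  have "v = (\<Sum>j\<in>S. (\<chi> l. c j * T $ l $ j))" using assms by (simp add: vec_eq_iff)
  also have "\<dots> \<in> cols_span S T"
    by (intro subspace_sum subspace_cols_span scaled_col_in_cols_span)
  finally show ?thesis .
qed

text \<open>The conjugate \<open>q\<close> of row \<open>i\<close> of the left inverse is a multiple of the component of column \<open>i\<close>
  orthogonal to the other columns, and its product with column \<open>i\<close> is \<open>1\<close>.\<close>

lemma norm_left_inv_row_le:
  fixes T :: "'a::rc_scalar^'c^'s"
  assumes T: "T ** coord_proj S = T" and i: "i \<in> S"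
  shows "ennreal ((norm (left_inv S T $ i))\<^sup>2) \<le> inverse (ennreal ((infdist (column i T) (cols_span (S - {i}) T))\<^sup>2))"
proof (cases "det (gram S T) = 0")
  case False
  let ?I = "cramer_inverse (gram S T)" and ?L = "left_inv S T"
  define q where "q = (\<chi> l. conjugate (?L $ i $ l))"
  define c where "c j = conjugate (?I $ i $ j)" for j
  have T0: "T $ l $ j = 0" if "j \<notin> S" for l j
    using coord_proj_mult_right[of T S l j] that by (simp add: T)
  have LT: "(\<Sum>l\<in>UNIV. ?L $ i $ l * T $ l $ j) = (if i = j then 1 else 0)" for j
    using arg_cong[OF left_inv_mult[OF False T], of "\<lambda>M. M $ i $ j"] i
    by (simp add: matrix_matrix_mult_def coord_proj_def)
  have q: "q $ l = (\<Sum>j\<in>S. c j * T $ l $ j)" for l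
  proof -
    have "q $ l = (\<Sum>j\<in>UNIV. c j * T $ l $ j)"
      by (simp add: q_def left_inv_def matrix_matrix_mult_def sum_conjugate conjugate_dist_mul c_def ctranspose_def)
    also have "\<dots> = (\<Sum>j\<in>S. c j * T $ l $ j)"
      by (rule sum.mono_neutral_right) (auto simp: T0)
    finally show ?thesis .
  qed
  have "norm (q $ l) = norm (?L $ i $ l)" for l by (simp add: q_def)
  then have nq: "norm q = norm (?L $ i)"
    by (simp add: norm_vec_def)
  have cq: "conjugate (q $ l) = ?L $ i $ l" for l by (simp add: q_def)
  \<comment> \<open>Expanding one factor \<open>q\<close> in the columns and using that row
    \<open>i\<close> is dual to them shows that the coefficient \<open>c i\<close> of column
    \<open>i\<close> in \<open>q\<close> is the squared norm of \<open>q\<close>.\<close>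
  have "of_real ((norm q)\<^sup>2) = (\<Sum>l\<in>UNIV. conjugate (q $ l) * q $ l)"
    by (simp add: conjugate_mult_self norm_vec_squared)
  also have "\<dots> = (\<Sum>l\<in>UNIV. ?L $ i $ l * (\<Sum>j\<in>S. c j * T $ l $ j))"
    by (intro sum.cong refl) (simp add: cq flip: q)
  also have "\<dots> = (\<Sum>j\<in>S. c j * (\<Sum>l\<in>UNIV. ?L $ i $ l * T $ l $ j))"
    unfolding sum_distrib_left by (subst sum.swap) (simp add: mult_ac)
  also have "\<dots> = c i"
    using i by (simp add: LT if_distrib cong: if_cong)
  finally have ci: "c i = of_real ((norm q)\<^sup>2)" ..
  have "?L $ i \<noteq> 0" using LT[of i] by auto
  then have "norm q \<noteq> 0" using nq by simp
  \<comment> \<open>Solving the expansion of \<open>q\<close> for column \<open>i\<close> writes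
    that column as \<open>q / c i\<close> plus \<open>w\<close>, a combination of the other columns.
    Hence the norm of \<open>q / c i\<close>, which is \<open>1 / norm q\<close>, bounds the
    distance.\<close>
  define w where "w = column i T - (\<chi> l. q $ l / c i)"
  have "w $ l = (\<Sum>j\<in>S - {i}. (- (c j / c i)) * T $ l $ j)" for l
    using \<open>norm q \<noteq> 0\<close> ci i
    by (simp add: w_def q column_def sum.remove[OF _ i] add_divide_distrib sum_divide_distrib sum_negf)
  then have "w \<in> cols_span (S - {i}) T" by (rule sum_cols_in_cols_span)
  then have "infdist (column i T) (cols_span (S - {i}) T) \<le> dist (column i T) w" by (rule infdist_le)
  also have "\<dots> = norm ((1 / (norm q)\<^sup>2) *\<^sub>R q)"
  proof -
    have "(\<chi> l. q $ l / c i) = (1 / (norm q)\<^sup>2) *\<^sub>R q"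
      by (simp add: vec_eq_iff) (simp add: ci scaleR_conv_of_real)
    then show ?thesis by (simp add: dist_norm w_def)
  qed
  also have "\<dots> = 1 / norm q" by (simp add: power2_eq_square)
  finally have le: "infdist (column i T) (cols_span (S - {i}) T) \<le> 1 / norm q" .
  have "ennreal ((norm (?L $ i))\<^sup>2) = inverse (ennreal ((1 / norm q)\<^sup>2))"
    using \<open>norm q \<noteq> 0\<close> nq by (simp add: inverse_ennreal power_divide divide_inverse power_inverse)
  also have "\<dots> \<le> inverse (ennreal ((infdist (column i T) (cols_span (S - {i}) T))\<^sup>2))"
    by (intro ennreal_inverse_antimono ennreal_leI power_mono le infdist_nonneg)
  finally show ?thesis .
qed (simp add: left_inv_singular)

text \<open>Replacing the component of the Gaussian matrix \<open>X\<close> along a unit vector \<open>q\<close> by an independent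
  Gaussian vector \<open>y\<close> is a marginal of an isometry of the pair \<open>(X, y)\<close>.\<close>

definition replace_component :: "'a::rc_scalar^'n \<Rightarrow> 'a^'n^'s \<Rightarrow> 'a^'s \<Rightarrow> 'a^'n^'s" where
  "replace_component q X y = (\<chi> l j. X $ l $ j + (y $ l - (X *v q) $ l) * conjugate (q $ j))"

lemma nn_integral_replace_component:
  fixes q :: "'a::rc_scalar^'n" and h :: "'a^'n^'s \<Rightarrow> ennreal"
  assumes q: "norm q = 1" and [measurable]: "h \<in> borel_measurable borel"
  shows "(\<integral>\<^sup>+X. h X \<partial>gauss) = (\<integral>\<^sup>+X. \<integral>\<^sup>+y. h (replace_component q X y) \<partial>gauss \<partial>gauss)"
proof -
  \<comment> \<open>The second output is the component that was removed. The map exchanges it with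
    \<open>y\<close>, which makes it an isometry; integrating a function of the first output gives
    the claim.\<close>
  let ?f = "\<lambda>(X, y). (replace_component q X y, X *v q) :: ('a^'n^'s) \<times> ('a^'s)"
  have "(r *\<^sub>R X) *v q = r *\<^sub>R (X *v q)" for r and X :: "'a^'n^'s"
    by (simp add: matrix_vector_mult_def vec_eq_iff scaleR_sum_right)
  then have lin: "linear ?f"
    by (intro linearI) (auto simp: replace_component_def vec_eq_iff matrix_vector_mult_add_rdistrib
        algebra_simps)
  have isom: "norm (?f Xy) = norm Xy" for Xy
  proof -
    obtain X y where Xy: "Xy = (X, y)" by fastforce
    define z where "z = y - X *v q"
    define R where "R = (\<chi> l j. z $ l * conjugate (q $ j))"
    have "(norm R)\<^sup>2 = (\<Sum>l\<in>UNIV. (norm (z $ l))\<^sup>2 * (\<Sum>j\<in>UNIV. (norm (q $ j))\<^sup>2))"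
      unfolding norm_matrix_squared by (simp add: R_def norm_mult power_mult_distrib sum_distrib_left)
    then have nO: "(norm R)\<^sup>2 = (norm z)\<^sup>2"
      using q by (simp flip: norm_vec_squared)
    have "X \<bullet> R = (\<Sum>l\<in>UNIV. \<Sum>j\<in>UNIV. (X $ l $ j * q $ j) \<bullet> z $ l)"
      unfolding inner_vec_def R_def vec_lambda_beta
      by (intro sum.cong refl) (metis conjugate_id inner_conjugate_right mult.commute)
    then have XO: "X \<bullet> R = (X *v q) \<bullet> z"
      by (simp add: inner_vec_def matrix_vector_mult_def inner_sum_left)
    have "(norm (X + R))\<^sup>2 = (norm X)\<^sup>2 + 2 * ((X *v q) \<bullet> z) + (norm z)\<^sup>2"
      unfolding XO[symmetric] nO[symmetric]
      by (simp add: power2_norm_eq_inner inner_simps inner_commute)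
    moreover have "(norm z)\<^sup>2 = (norm y)\<^sup>2 + (norm (X *v q))\<^sup>2 - 2 * ((X *v q) \<bullet> y)"
      by (simp add: z_def power2_norm_eq_inner inner_diff inner_commute)
    ultimately have "(norm (X + R))\<^sup>2 + (norm (X *v q))\<^sup>2 = (norm X)\<^sup>2 + (norm y)\<^sup>2"
      by (simp add: z_def inner_diff_right power2_norm_eq_inner)
    moreover have "?f Xy = (X + R, X *v q)"
      by (simp add: Xy replace_component_def R_def z_def vec_eq_iff)
    ultimately show ?thesis by (simp add: Xy norm_Pair)
  qed
  have [measurable]: "(\<lambda>z. h (fst z)) \<in> borel_measurable (borel :: (('a^'n^'s) \<times> ('a^'s)) measure)"
    by (simp flip: borel_prod)
  have [measurable]: "?f \<in> borel_measurable borel" using lin by (rule borel_measurable_linear)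
  have "(\<integral>\<^sup>+X. h X \<partial>gauss) = (\<integral>\<^sup>+X. \<integral>\<^sup>+y. h (fst (X, y :: 'a^'s)) \<partial>gauss \<partial>gauss)"
    by (simp add: emeasure_gauss_UNIV)
  also have "\<dots> = (\<integral>\<^sup>+z. h (fst (z :: ('a^'n^'s) \<times> ('a^'s))) \<partial>gauss)"
    by (rule nn_integral_gauss_Pair[symmetric]) simp
  also have "\<dots> = (\<integral>\<^sup>+z. h (fst (?f z)) \<partial>gauss)"
    by (rule nn_integral_gauss_isometry[OF lin isom, symmetric]) simp
  also have "\<dots> = (\<integral>\<^sup>+X. \<integral>\<^sup>+y. h (fst (?f (X, y))) \<partial>gauss \<partial>gauss)"
    by (rule nn_integral_gauss_Pair) (rule measurable_compose[of ?f _ borel], simp_all)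
  finally show ?thesis by simp
qed

lemma orthonormal_cols_column:
  fixes Q :: "'a::rc_scalar^'c^'n"
  assumes "orthonormal_cols S Q" "i \<in> S"
  shows "norm (column i Q) = 1"
proof -
  have "(ctranspose Q ** Q) $ i $ i = 1"
    using assms by (simp add: orthonormal_cols_def coord_proj_def)
  then have "of_real ((norm (column i Q))\<^sup>2) = (1 :: 'a)"
    by (simp add: matrix_matrix_mult_def ctranspose_def conjugate_mult_self norm_vec_squared column_def)
  then have "(norm (column i Q))\<^sup>2 = 1\<^sup>2" by (simp flip: of_real_power)
  then show ?thesis by (simp only: power2_eq_iff_nonneg norm_ge_zero zero_le_one)
qed

text \<open>Orthonormality keeps the substitution away from the other columns of
  \<open>X ** Q\<close>. So column \<open>i\<close> can be redrawn while the span of the others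
  stays fixed.\<close>

lemma replace_component_mult:
  fixes Q :: "'a::rc_scalar^'c^'n"
  assumes Q: "orthonormal_cols S Q" and i: "i \<in> S"
  shows "(replace_component (column i Q) X y ** Q) $ l $ j = (if j = i then y $ l else (X ** Q) $ l $ j)"
proof -
  have "(\<Sum>k\<in>UNIV. conjugate (Q $ k $ i) * Q $ k $ j) = (if i = j then 1 else 0)"
    using arg_cong[OF Q[unfolded orthonormal_cols_def], of "\<lambda>M. M $ i $ j"] i
    by (simp add: matrix_matrix_mult_def ctranspose_def coord_proj_def)
  moreover have "(replace_component (column i Q) X y ** Q) $ l $ j =
     (X ** Q) $ l $ j + (y $ l - (X *v column i Q) $ l) * (\<Sum>k\<in>UNIV. conjugate (Q $ k $ i) * Q $ k $ j)"
    by (simp add: replace_component_def matrix_matrix_mult_def column_def distrib_right sum.distrib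
        sum_distrib_left mult.assoc)
  moreover have "(X *v column i Q) $ l = (X ** Q) $ l $ i"
    by (simp add: matrix_matrix_mult_def matrix_vector_mult_def column_def)
  ultimately show ?thesis by simp
qed

lemma cols_span_cong:
  assumes "\<And>l j. j \<in> S \<Longrightarrow> T $ l $ j = T' $ l $ j"
  shows "cols_span S T = cols_span S T'"
  unfolding cols_span_def using assms by (intro arg_cong[where f=span] image_cong) (auto simp: vec_eq_iff)

text \<open>With \<open>X\<close> fixed, column \<open>i\<close> is a fresh Gaussian vector
  \<open>y\<close> of real dimension \<open>DIM('a) * CARD('s)\<close>, and the other columns span a
  real space of dimension at most \<open>DIM('a) * (card S - 1)\<close>. The inverse squared
  distance has mean at most \<open>1 / (d - 2)\<close> with
  \<open>d = DIM('a) * (CARD('s) - card S + 1)\<close>; the numerical assumption says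
  \<open>d > 2\<close>.\<close>

lemma nn_integral_left_inv_row_le:
  fixes Q :: "'a::rc_scalar^'c^'n"
  assumes Q: "orthonormal_cols S Q" and i: "i \<in> S"
    and d: "DIM('a) * card S + 2 < DIM('a) * (CARD('s) + 1)"
  shows "(\<integral>\<^sup>+X. ennreal ((norm (left_inv S ((X :: 'a^'n^'s) ** Q) $ i))\<^sup>2) \<partial>gauss) \<le>
     ennreal (1 / (real DIM('a) * (real CARD('s) - real (card S) + 1) - 2))"
proof -
  let ?q = "column i Q"
  have QS: "X ** Q ** coord_proj S = X ** Q" for X :: "'a^'n^'s"
    using orthonormal_cols_mult_coord_proj[OF Q] by (simp flip: matrix_mul_assoc)
  have "(\<integral>\<^sup>+X. ennreal ((norm (left_inv S ((X :: 'a^'n^'s) ** Q) $ i))\<^sup>2) \<partial>gauss) =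
     (\<integral>\<^sup>+X. \<integral>\<^sup>+y. ennreal ((norm (left_inv S (replace_component ?q (X :: 'a^'n^'s) y ** Q) $ i))\<^sup>2) \<partial>gauss \<partial>gauss)"
    by (rule nn_integral_replace_component[OF orthonormal_cols_column[OF Q i]]) measurable
  also have "\<dots> \<le> (\<integral>\<^sup>+X. ennreal (1 / (real DIM('a) * (real CARD('s) - real (card S) + 1) - 2)) \<partial>(gauss :: ('a^'n^'s) measure))"
  proof (rule nn_integral_mono)
    fix X :: "'a^'n^'s"
    let ?W = "cols_span (S - {i}) (X ** Q)"
    obtain r where r: "card S = Suc r" using i by (metis card_gt_0_iff empty_iff finite gr0_implies_Suc)
    have dimW: "dim ?W \<le> DIM('a) * (card S - 1)"
      using dim_cols_span_le[of "S - {i}" "X ** Q"] i by simp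
    have "(\<integral>\<^sup>+y. ennreal ((norm (left_inv S (replace_component ?q X y ** Q) $ i))\<^sup>2) \<partial>gauss) \<le>
      (\<integral>\<^sup>+y. inverse (ennreal ((infdist y ?W)\<^sup>2)) \<partial>gauss)"
    proof (rule nn_integral_mono)
      fix y
      have "column i (replace_component ?q X y ** Q) = y"
        using replace_component_mult[OF Q i, of X y] by (simp add: column_def vec_eq_iff)
      moreover have "cols_span (S - {i}) (replace_component ?q X y ** Q) = ?W"
        using replace_component_mult[OF Q i, of X y] by (intro cols_span_cong) auto
      ultimately show "ennreal ((norm (left_inv S (replace_component ?q X y ** Q) $ i))\<^sup>2) \<le>
          inverse (ennreal ((infdist y ?W)\<^sup>2))"
        using norm_left_inv_row_le[OF QS i, of "replace_component ?q X y"] by simp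
    qed
    also have "\<dots> \<le> ennreal (1 / (real DIM('a^'s) - real (dim ?W) - 2))"
      using dimW d by (intro nn_integral_gauss_inverse_infdist) (auto simp: mult.commute r)
    also have "\<dots> \<le> ennreal (1 / (real DIM('a) * (real CARD('s) - real (card S) + 1) - 2))"
    proof (intro ennreal_leI divide_left_mono mult_pos_pos)
      have "real DIM('a) * real (card S) + 2 < real DIM('a) * (real CARD('s) + 1)"
        using d unfolding of_nat_less_iff[where 'a = real, symmetric] of_nat_add of_nat_mult by simp
      then show pos: "0 < real DIM('a) * (real CARD('s) - real (card S) + 1) - 2"
        by (simp add: algebra_simps)
      have "real (dim ?W) \<le> real DIM('a) * (real (card S) - 1)"
        using dimW unfolding of_nat_le_iff[where 'a = real, symmetric] of_nat_mult by (simp add: r)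
      then show "real DIM('a) * (real CARD('s) - real (card S) + 1) - 2 \<le> real DIM('a^'s) - real (dim ?W) - 2"
        by (simp add: algebra_simps)
      with pos show "0 < real DIM('a^'s) - real (dim ?W) - 2" by linarith
    qed simp
    finally show "(\<integral>\<^sup>+y. ennreal ((norm (left_inv S (replace_component ?q X y ** Q) $ i))\<^sup>2) \<partial>gauss) \<le> \<dots>" .
  qed
  also have "\<dots> = ennreal (1 / (real DIM('a) * (real CARD('s) - real (card S) + 1) - 2))"
    by (simp add: emeasure_gauss_UNIV)
  finally show ?thesis .
qed

section \<open>Almost sure regularity of the Gram matrix\<close>

lemma coord_proj_mult_coord_proj: "coord_proj S ** coord_proj S' = (coord_proj (S \<inter> S') :: 'a::rc_scalar^'c^'c)"
  by (auto simp: vec_eq_iff coord_proj_mult_left) (auto simp: coord_proj_def)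

lemma coord_proj_empty [simp]: "coord_proj {} = 0"
  by (simp add: coord_proj_def vec_eq_iff)

lemma column_nth: "column i M $ l = M $ l $ i"
  by (simp add: column_def)

text \<open>On the indices outside \<open>S\<close> the Gram matrix is the identity, so a kernel
  vector is supported in \<open>S\<close>. There \<open>ctranspose T ** T\<close> annihilates it,
  hence so does \<open>T\<close>.\<close>

lemma gram_mult_kernel:
  fixes T :: "'a::rc_scalar^'c^'s"
  assumes "det (gram S T) = 0" and T: "T ** coord_proj S = T"
  obtains X :: "'a^'c^'c" where "X \<noteq> 0" "T ** X = 0" "coord_proj S ** X = X"
proof -
  have "\<not> invertible (gram S T)" using assms by (simp add: invertible_det_nz)
  then obtain x where x: "gram S T *v x = 0" "x \<noteq> 0"
    unfolding invertible_left_inverse matrix_left_invertible_ker by blast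
  \<comment> \<open>The kernel vector is copied into every column, so that the matrix identities
    apply to it.\<close>
  define X :: "'a^'c^'c" where "X = (\<chi> i j. x $ i)"
  have GX: "gram S T ** X = 0"
    using x(1) by (simp add: X_def matrix_matrix_mult_def matrix_vector_mult_def vec_eq_iff)
  have T': "coord_proj S ** ctranspose T = ctranspose T"
    by (subst (2) T[symmetric]) (simp add: ctranspose_mult)
  have "(mat 1 - coord_proj S) ** gram S T = mat 1 - coord_proj S"
    by (simp add: gram_def matrix_add_ldistrib matrix_diff_rdistrib matrix_diff_ldistrib matrix_mul_assoc T')
  then have "(mat 1 - coord_proj S) ** X = 0"
    using GX by (metis matrix_mul_assoc matrix_mul_rid mult_zero_right matrix_eq_0_if_ctranspose_mult_self linear_matrix_mult_left linear_0)
  then have DX: "coord_proj S ** X = X" by (simp add: matrix_diff_rdistrib)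
  have "ctranspose T ** T ** X = 0"
    using GX DX by (simp add: gram_def matrix_add_rdistrib matrix_diff_rdistrib)
  then have "ctranspose (T ** X) ** (T ** X) = 0"
    using linear_0[OF linear_matrix_mult_left[of "ctranspose X"]]
    by (simp add: ctranspose_mult flip: matrix_mul_assoc)
  then have "T ** X = 0" by (rule matrix_eq_0_if_ctranspose_mult_self)
  moreover have "X \<noteq> 0" using x(2) by (auto simp: X_def vec_eq_iff)
  ultimately show thesis using that DX by blast
qed

lemma gram_singularI:
  fixes T :: "'a::rc_scalar^'c^'s" and X :: "'a^'c^'c"
  assumes "X \<noteq> 0" "T ** X = 0" "coord_proj S ** X = X"
  shows "det (gram S T) = 0"
proof (rule ccontr)
  assume det: "det (gram S T) \<noteq> 0"
  have "gram S T ** X = 0"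
    using assms linear_0[OF linear_matrix_mult_left[of "ctranspose T"]]
    by (simp add: gram_def matrix_add_rdistrib matrix_diff_rdistrib flip: matrix_mul_assoc)
  then have "cramer_inverse (gram S T) ** gram S T ** X = 0"
    using linear_0[OF linear_matrix_mult_left[of "cramer_inverse (gram S T)"]]
    by (simp flip: matrix_mul_assoc)
  with assms(1) show False by (simp add: cramer_inverse[OF det])
qed

text \<open>In a nontrivial linear relation between the columns in \<open>S\<close>, either column
  \<open>i\<close> occurs and lies in the span of the others, or it does not and the others are
  already dependent. This is the step of an induction on the columns.\<close>

lemma gram_singular_cases:
  fixes T :: "'a::rc_scalar^'c^'s"
  assumes "det (gram S T) = 0" and T: "T ** coord_proj S = T" and i: "i \<in> S"
  shows "det (gram (S - {i}) (T ** coord_proj (S - {i}))) = 0 \<or> column i T \<in> cols_span (S - {i}) T"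
proof -
  obtain X :: "'a^'c^'c" where X: "X \<noteq> 0" "T ** X = 0" "coord_proj S ** X = X"
    using gram_mult_kernel[OF assms(1,2)] .
  have X0: "X $ j $ p = 0" if "j \<notin> S" for j p
    using coord_proj_mult_left[of S X j p] that by (simp add: X)
  show ?thesis
  proof (cases "\<exists>p. X $ i $ p \<noteq> 0")
    case True
    then obtain p where p: "X $ i $ p \<noteq> 0" by blast
    have "T $ l $ i = (\<Sum>j\<in>S - {i}. - (X $ j $ p / X $ i $ p) * T $ l $ j)" for l
    proof -
      have "0 = (\<Sum>j\<in>UNIV. T $ l $ j * X $ j $ p)"
        using arg_cong[OF X(2), of "\<lambda>M. M $ l $ p"] by (simp add: matrix_matrix_mult_def)
      also have "\<dots> = (\<Sum>j\<in>S. T $ l $ j * X $ j $ p)"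
        by (rule sum.mono_neutral_right) (auto simp: X0)
      also have "\<dots> = T $ l $ i * X $ i $ p + (\<Sum>j\<in>S - {i}. T $ l $ j * X $ j $ p)"
        using i by (simp add: sum.remove)
      finally have "T $ l $ i * X $ i $ p = - (\<Sum>j\<in>S - {i}. T $ l $ j * X $ j $ p)"
        by (simp add: eq_neg_iff_add_eq_0)
      then have "T $ l $ i = - (\<Sum>j\<in>S - {i}. T $ l $ j * X $ j $ p) / X $ i $ p"
        using p by (metis nonzero_mult_div_cancel_right)
      then show ?thesis by (simp add: sum_divide_distrib sum_negf mult.commute)
    qed
    then have "column i T \<in> cols_span (S - {i}) T"
      by (intro sum_cols_in_cols_span[where c = "\<lambda>j. - (X $ j $ p / X $ i $ p)"])
        (simp only: column_def vec_lambda_beta)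
    then show ?thesis ..
  next
    case False
    then have DX: "coord_proj (S - {i}) ** X = X"
      by (auto simp: vec_eq_iff coord_proj_mult_left X0)
    then have "T ** coord_proj (S - {i}) ** X = 0" by (simp add: X flip: matrix_mul_assoc)
    from gram_singularI[OF X(1) this DX] show ?thesis ..
  qed
qed

lemma AE_gauss_not_in_subspace:
  fixes W :: "'a::euclidean_space set"
  assumes "subspace W" "dim W < DIM('a)"
  shows "AE x in gauss. x \<notin> W"
proof -
  have "W \<in> sets borel" using assms by (simp add: closed_subspace)
  moreover have "W \<in> null_sets lebesgue"
    using negligible_lowdim[OF assms(2)] by (simp add: negligible_iff_null_sets)
  ultimately have "W \<in> null_sets lborel" by (simp add: null_sets_completion_iff)
  then have "AE x in lborel. x \<notin> W" by (rule AE_not_in)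
  then show ?thesis unfolding gauss_def by (subst AE_density) auto
qed

text \<open>Columns are added one at a time: given the others, the new column is a Gaussian vector,
  and the others span a proper real subspace, which is a null set.\<close>

lemma AE_gram_nonsingular:
  fixes Q :: "'a::rc_scalar^'c^'n"
  assumes "orthonormal_cols S Q" "card S \<le> CARD('s)"
  shows "AE X in gauss. det (gram S ((X :: 'a^'n^'s) ** Q)) \<noteq> 0"
proof -
  have "finite S" by simp
  then show ?thesis using assms
  proof (induction S arbitrary: Q)
    case empty
    have "Q = 0"
      using orthonormal_cols_mult_coord_proj(1)[OF empty(1)] linear_0[OF linear_matrix_mult_left[of Q]] by simp
    then have "gram {} (X ** Q) = mat 1" for X :: "'a^'n^'s"
      by (simp add: gram_def ctranspose_mult matrix_matrix_mult_def vec_eq_iff ctranspose_def)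
    then show ?case by simp
  next
    case (insert i S)
    let ?S = "insert i S" and ?D = "coord_proj S :: 'a^'c^'c"
    \<comment> \<open>The induction hypothesis concerns matrices whose columns outside
      \<open>S\<close> are zero.\<close>
    define Q0 where "Q0 = Q ** ?D"
    have S: "?S - {i} = S" "i \<in> ?S" using insert by auto
    note Q = insert.prems(1)
    have "ctranspose Q0 ** Q0 = ?D ** (ctranspose Q ** Q) ** ?D"
      by (simp add: Q0_def ctranspose_mult matrix_mul_assoc)
    also have "\<dots> = ?D"
      using Q insert.hyps by (simp add: orthonormal_cols_def coord_proj_mult_coord_proj Int_insert_right)
    finally have Q0: "orthonormal_cols S Q0" by (simp add: orthonormal_cols_def)
    define sing where "sing X \<longleftrightarrow> det (gram ?S (X ** Q)) = 0" for X :: "'a^'n^'s"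
    define sing0 where "sing0 X \<longleftrightarrow> det (gram S (X ** Q0)) = 0" for X :: "'a^'n^'s"
    have [measurable]: "Measurable.pred borel sing" "Measurable.pred borel sing0"
      unfolding sing_def sing0_def
      by (intro borel_measurable_det pred_eq_const1[of _ _ borel] borel_measurable_matrix_nth; simp)+
    have AE0: "AE X in gauss. \<not> sing0 X"
      using insert.IH[OF Q0] insert.prems(2) insert.hyps by (simp add: sing0_def)
    let ?q = "column i Q"
    let ?h = "\<lambda>X. if sing X then 1 else 0 :: ennreal"
    have "(\<integral>\<^sup>+X. ?h X \<partial>gauss) = (\<integral>\<^sup>+X. \<integral>\<^sup>+y. ?h (replace_component ?q X y) \<partial>gauss \<partial>gauss)"
      by (rule nn_integral_replace_component[OF orthonormal_cols_column[OF Q S(2)]]) measurable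
    also have "\<dots> = (\<integral>\<^sup>+X. 0 \<partial>(gauss :: ('a^'n^'s) measure))"
    proof (rule nn_integral_cong_AE, rule AE_mp[OF AE0], intro AE_I2 impI)
      fix X assume X: "\<not> sing0 X"
      let ?W = "cols_span S (X ** Q)"
      have "dim ?W \<le> DIM('a) * card S" by (rule dim_cols_span_le)
      also have "\<dots> < DIM('a) * CARD('s)" using insert.prems(2) insert.hyps by simp
      finally have AEW: "AE y in gauss. y \<notin> ?W"
        by (intro AE_gauss_not_in_subspace) (simp_all add: mult.commute)
      have "\<not> sing (replace_component ?q X y)" if "y \<notin> ?W" for y
      proof
        let ?Y = "replace_component ?q X y"
        assume "sing ?Y"
        then have "det (gram S (?Y ** Q ** ?D)) = 0 \<or> column i (?Y ** Q) \<in> cols_span S (?Y ** Q)"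
          using gram_singular_cases[of ?S "?Y ** Q" i] orthonormal_cols_mult_coord_proj[OF Q]
          by (simp add: sing_def S flip: matrix_mul_assoc)
        moreover have "?Y ** Q ** ?D = X ** Q0"
          using insert.hyps
          by (auto simp: replace_component_mult[OF Q S(2)] Q0_def matrix_mul_assoc vec_eq_iff coord_proj_mult_right)
        moreover have "column i (?Y ** Q) = y"
          by (simp add: replace_component_mult[OF Q S(2)] column_nth vec_eq_iff)
        moreover have "cols_span S (?Y ** Q) = ?W"
          using insert.hyps by (intro cols_span_cong) (auto simp: replace_component_mult[OF Q S(2)])
        ultimately show False using X that by (simp add: sing0_def)
      qed
      then show "(\<integral>\<^sup>+y. ?h (replace_component ?q X y) \<partial>gauss) = 0"
        using AEW by (subst nn_integral_cong_AE[where v = "\<lambda>_. 0"]) auto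
    qed
    finally have "(\<integral>\<^sup>+X. ?h X \<partial>gauss) = 0" by simp
    then have "AE X in gauss. ?h X = 0" by (subst (asm) nn_integral_0_iff_AE) auto
    then show ?case by eventually_elim (auto simp: sing_def split: if_splits)
  qed
qed

section \<open>Mean squares of products with a Gaussian left inverse\<close>

lemma nn_integral_norm_left_inv_le:
  fixes Q :: "'a::rc_scalar^'c^'n"
  assumes Q: "orthonormal_cols S Q" and d: "DIM('a) * card S + 2 < DIM('a) * (CARD('s) + 1)"
  shows "(\<integral>\<^sup>+X. ennreal ((norm (left_inv S ((X :: 'a^'n^'s) ** Q)))\<^sup>2) \<partial>gauss) \<le>
     ennreal (real (card S) / (real DIM('a) * (real CARD('s) - real (card S) + 1) - 2))"
proof -
  let ?c = "1 / (real DIM('a) * (real CARD('s) - real (card S) + 1) - 2)"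
  have QS: "X ** Q ** coord_proj S = X ** Q" for X :: "'a^'n^'s"
    using orthonormal_cols_mult_coord_proj[OF Q] by (simp flip: matrix_mul_assoc)
  have row0: "left_inv S (X ** Q) $ i = 0" if "i \<notin> S" for i and X :: "'a^'n^'s"
  proof (cases "det (gram S (X ** Q)) = 0")
    case False
    show ?thesis
      using that coord_proj_mult_left[of S "left_inv S (X ** Q)" i] coord_proj_left_inv[OF False QS]
      by (simp add: vec_eq_iff)
  qed (simp add: left_inv_singular)
  have "(norm (left_inv S (X ** Q)))\<^sup>2 = (\<Sum>i\<in>S. (norm (left_inv S (X ** Q) $ i))\<^sup>2)" for X :: "'a^'n^'s"
    unfolding norm_vec_squared[of "left_inv S (X ** Q)"]
    by (rule sum.mono_neutral_right) (auto simp: row0)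
  then have "(\<integral>\<^sup>+X. ennreal ((norm (left_inv S ((X :: 'a^'n^'s) ** Q)))\<^sup>2) \<partial>gauss) =
     (\<Sum>i\<in>S. \<integral>\<^sup>+X. ennreal ((norm (left_inv S ((X :: 'a^'n^'s) ** Q) $ i))\<^sup>2) \<partial>gauss)"
    by (simp add: nn_integral_sum flip: sum_ennreal)
  also have "\<dots> \<le> (\<Sum>i\<in>S. ennreal ?c)"
    by (intro sum_mono nn_integral_left_inv_row_le Q d)
  also have "\<dots> = ennreal (real (card S) * ?c)"
    by (simp add: ennreal_of_nat_eq_real_of_nat flip: ennreal_mult')
  finally show ?thesis by simp
qed

lemma sum_Basis_vec:
  "(\<Sum>b\<in>(Basis :: ('a::euclidean_space^'n) set). f b) = (\<Sum>i\<in>UNIV. \<Sum>e\<in>Basis. f (axis i e))"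
proof -
  have "(\<Sum>b\<in>(Basis :: ('a^'n) set). f b) = (\<Sum>i\<in>UNIV. \<Sum>b\<in>axis i ` Basis. f b)"
    unfolding Basis_vec_def UNION_singleton_eq_range
    by (subst sum.UNION_disjoint) (auto simp: axis_eq_axis)
  also have "\<dots> = (\<Sum>i\<in>UNIV. \<Sum>e\<in>Basis. f (axis i e))"
    by (intro sum.cong refl sum.reindex[THEN trans]) (auto simp: inj_on_def axis_eq_axis)
  finally show ?thesis .
qed

text \<open>Each real coordinate of \<open>L ** X ** B\<close> is the inner product of
  \<open>X\<close> with an outer product of a row of \<open>L\<close> and a column of
  \<open>B\<close>, so its second moment is the product of their squared norms. The factor
  \<open>DIM('a)\<close> is the mean square of one Gaussian scalar.\<close>

lemma nn_integral_gauss_norm_mult_mult: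
  fixes L :: "'a::rc_scalar^'s^'c" and B :: "'a^'p^'n"
  shows "(\<integral>\<^sup>+X. ennreal ((norm (L ** X ** B))\<^sup>2) \<partial>gauss) = ennreal (real DIM('a) * (norm L)\<^sup>2 * (norm B)\<^sup>2)"
proof -
  have "(norm M)\<^sup>2 = (\<Sum>b\<in>Basis. (M \<bullet> b)\<^sup>2)" for M :: "'a^'p^'c"
    unfolding power2_norm_eq_inner by (subst euclidean_inner) (simp add: power2_eq_square)
  moreover have "(L ** X ** B) \<bullet> b = X \<bullet> (ctranspose L ** b ** ctranspose B)" for b X
    by (simp add: inner_matrix_mult_right[of "L ** X" B b] inner_matrix_mult_left[of L X] matrix_mul_assoc)
  ultimately have "(\<integral>\<^sup>+X. ennreal ((norm (L ** X ** B))\<^sup>2) \<partial>gauss) =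
     (\<Sum>b\<in>Basis. ennreal ((norm (ctranspose L ** b ** ctranspose B))\<^sup>2))"
    by (simp add: nn_integral_sum nn_integral_gauss_inner_square flip: sum_ennreal)
  also have "\<dots> = ennreal (\<Sum>b\<in>Basis. (norm (ctranspose L ** b ** ctranspose B))\<^sup>2)"
    by (simp add: sum_ennreal)
  also have "(\<Sum>b\<in>Basis. (norm (ctranspose L ** b ** ctranspose B))\<^sup>2) =
     (\<Sum>i\<in>UNIV. \<Sum>p\<in>UNIV. \<Sum>e\<in>(Basis :: 'a set). (\<Sum>l\<in>UNIV. (norm (L $ i $ l))\<^sup>2) * (\<Sum>j\<in>UNIV. (norm (B $ j $ p))\<^sup>2))"
    unfolding sum_Basis_vec
  proof (intro sum.cong refl)
    fix i :: 'c and p :: 'p and e :: 'a assume e: "e \<in> Basis"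
    have "(ctranspose L ** axis i (axis p e)) $ l $ k =
        (\<Sum>m\<in>UNIV. if m = i then if k = p then conjugate (L $ i $ l) * e else 0 else 0)" for l k
      unfolding matrix_matrix_mult_def vec_lambda_beta
      by (rule sum.cong) (auto simp: axis_def ctranspose_def)
    then have "(ctranspose L ** axis i (axis p e)) $ l $ k = (if k = p then conjugate (L $ i $ l) * e else 0)" for l k
      by simp
    then have "(ctranspose L ** axis i (axis p e) ** ctranspose B) $ l $ j =
       (\<Sum>k\<in>UNIV. if k = p then conjugate (L $ i $ l) * e * conjugate (B $ j $ p) else 0)" for l j
      unfolding matrix_matrix_mult_def[of "ctranspose L ** axis i (axis p e)"] vec_lambda_beta
      by (intro sum.cong) (auto simp: ctranspose_def)
    then have "(ctranspose L ** axis i (axis p e) ** ctranspose B) $ l $ j =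
       conjugate (L $ i $ l) * e * conjugate (B $ j $ p)" for l j
      by simp
    then show "(norm (ctranspose L ** axis i (axis p e) ** ctranspose B))\<^sup>2 =
       (\<Sum>l\<in>UNIV. (norm (L $ i $ l))\<^sup>2) * (\<Sum>j\<in>UNIV. (norm (B $ j $ p))\<^sup>2)"
      using e by (simp add: norm_matrix_squared norm_mult power_mult_distrib sum_product)
  qed
  also have "\<dots> = real DIM('a) * (norm L)\<^sup>2 * (norm B)\<^sup>2"
  proof -
    have "(norm B)\<^sup>2 = (\<Sum>p\<in>UNIV. \<Sum>j\<in>UNIV. (norm (B $ j $ p))\<^sup>2)"
      unfolding norm_matrix_squared by (rule sum.swap)
    moreover have "(\<Sum>i\<in>UNIV. \<Sum>p\<in>UNIV. \<Sum>e\<in>(Basis :: 'a set). r i * c p) = real DIM('a) * sum r UNIV * sum c UNIV"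
      for r :: "'c \<Rightarrow> real" and c :: "'p \<Rightarrow> real"
      unfolding mult.assoc sum_product by (simp add: sum_distrib_left)
    ultimately show ?thesis
      by (simp only: norm_matrix_squared[of L])
  qed
  finally show ?thesis .
qed

text \<open>This expresses the independence of \<open>X ** Q\<close> and \<open>X ** B\<close>.
  Exchanging the parts of \<open>X\<close> and of an independent copy \<open>Y\<close> that are
  orthogonal to \<open>Q\<close> is an isometry of the pair; afterwards the left inverse sees only
  \<open>X\<close>, and the factor multiplied by \<open>B\<close> only \<open>Y\<close>.\<close>

lemma nn_integral_norm_left_inv_mult_mult:
  fixes Q :: "'a::rc_scalar^'c^'n" and B :: "'a^'p^'n"
  assumes Q: "orthonormal_cols S Q" and B: "ctranspose Q ** B = 0"
  shows "(\<integral>\<^sup>+X. ennreal ((norm (left_inv S ((X :: 'a^'n^'s) ** Q) ** X ** B))\<^sup>2) \<partial>gauss) =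
    (\<integral>\<^sup>+X. ennreal ((norm (left_inv S ((X :: 'a^'n^'s) ** Q)))\<^sup>2) \<partial>gauss) * ennreal (real DIM('a) * (norm B)\<^sup>2)"
proof -
  define E where "E = Q ** ctranspose Q"
  note p = orthonormal_cols_projector[OF Q, folded E_def]
  have EB: "E ** B = 0"
    using linear_0[OF linear_matrix_mult_left[of Q]] by (simp add: E_def B flip: matrix_mul_assoc)
  let ?f = "\<lambda>(X, Y). (X ** E + (Y - Y ** E), Y ** E + (X - X ** E)) :: ('a^'n^'s) \<times> ('a^'n^'s)"
  have lin: "linear ?f"
    by (intro linearI) (auto simp: matrix_add_rdistrib matrix_scaleR_left algebra_simps)
  have isom: "norm (?f Z) = norm Z" for Z
  proof -
    obtain X Y where Z: "Z = (X, Y)" by fastforce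
    have "(U ** E) \<bullet> (V - V ** E) = 0" for U V :: "'a^'n^'s"
      using p(1,2) by (simp add: inner_matrix_mult_right matrix_diff_rdistrib flip: matrix_mul_assoc)
    then have "(norm (U ** E + (V - V ** E)))\<^sup>2 = (norm (U ** E))\<^sup>2 + (norm (V - V ** E))\<^sup>2" for U V :: "'a^'n^'s"
      by (intro norm_add_Pythagorean) (simp add: orthogonal_def)
    then have "(norm (?f Z))\<^sup>2 = (norm Z)\<^sup>2"
      using norm_projector_right[OF p(1,2), of X] norm_projector_right[OF p(1,2), of Y]
      by (simp add: Z norm_Pair)
    then show ?thesis by simp
  qed
  define h where "h X = ennreal ((norm (left_inv S ((X :: 'a^'n^'s) ** Q) ** X ** B))\<^sup>2)" for X
  have [measurable]: "h \<in> borel_measurable borel" unfolding h_def by measurable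
  have [measurable]: "(\<lambda>z. h (fst z)) \<in> borel_measurable (borel :: (('a^'n^'s) \<times> ('a^'n^'s)) measure)"
    by (simp flip: borel_prod)
  have [measurable]: "?f \<in> borel_measurable borel" using lin by (rule borel_measurable_linear)
  have "(\<integral>\<^sup>+X. h X \<partial>gauss) = (\<integral>\<^sup>+X. \<integral>\<^sup>+Y. h (fst (X, Y :: 'a^'n^'s)) \<partial>gauss \<partial>gauss)"
    by simp
  also have "\<dots> = (\<integral>\<^sup>+z. h (fst (z :: ('a^'n^'s) \<times> ('a^'n^'s))) \<partial>gauss)"
    by (rule nn_integral_gauss_Pair[symmetric]) simp
  also have "\<dots> = (\<integral>\<^sup>+z. h (fst (?f z)) \<partial>gauss)"
    by (rule nn_integral_gauss_isometry[OF lin isom, symmetric]) simp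
  also have "\<dots> = (\<integral>\<^sup>+X. \<integral>\<^sup>+Y. h (fst (?f (X, Y))) \<partial>gauss \<partial>gauss)"
    by (rule nn_integral_gauss_Pair) (rule measurable_compose[of ?f _ borel], simp_all)
  also have "\<dots> = (\<integral>\<^sup>+X. \<integral>\<^sup>+Y. ennreal ((norm (left_inv S ((X :: 'a^'n^'s) ** Q) ** Y ** B))\<^sup>2) \<partial>gauss \<partial>gauss)"
  proof (intro nn_integral_cong)
    fix X Y :: "'a^'n^'s"
    have "(X ** E + (Y - Y ** E)) ** Q = X ** Q"
      using p(4) by (simp add: matrix_add_rdistrib matrix_diff_rdistrib flip: matrix_mul_assoc)
    moreover have "(X ** E + (Y - Y ** E)) ** B = Y ** B"
      using EB linear_0[OF linear_matrix_mult_left] by (simp add: matrix_add_rdistrib matrix_diff_rdistrib flip: matrix_mul_assoc)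
    ultimately show "h (fst (?f (X, Y))) = ennreal ((norm (left_inv S (X ** Q) ** Y ** B))\<^sup>2)"
      by (simp add: h_def flip: matrix_mul_assoc)
  qed
  also have "\<dots> = (\<integral>\<^sup>+X. ennreal ((norm (left_inv S ((X :: 'a^'n^'s) ** Q)))\<^sup>2) * ennreal (real DIM('a) * (norm B)\<^sup>2) \<partial>gauss)"
    by (simp add: nn_integral_gauss_norm_mult_mult mult_ac flip: ennreal_mult)
  also have "\<dots> = (\<integral>\<^sup>+X. ennreal ((norm (left_inv S ((X :: 'a^'n^'s) ** Q)))\<^sup>2) \<partial>gauss) * ennreal (real DIM('a) * (norm B)\<^sup>2)"
    by (rule nn_integral_multc) measurable
  finally show ?thesis by (simp add: h_def)
qed

text \<open>With \<open>d\<close> real dimensions per scalar, \<open>proj_coef d r s\<close> is the constant \<open>r / (s - r - \<alpha>)\<close> of the theorem.\<close>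

definition proj_coef :: "nat \<Rightarrow> nat \<Rightarrow> nat \<Rightarrow> real" where
  "proj_coef d r s = real d * real r / (real d * (real s - real r + 1) - 2)"

lemma proj_coef_nonneg:
  assumes "d * r + 2 < d * (s + 1)"
  shows "0 \<le> proj_coef d r s"
proof -
  have "real d * real r + 2 < real d * (real s + 1)"
    using assms unfolding of_nat_less_iff[where 'a = real, symmetric] of_nat_add of_nat_mult by simp
  then have "0 \<le> real d * (real s - real r + 1) - 2"
    by (simp add: algebra_simps)
  then show ?thesis by (simp add: proj_coef_def)
qed

text \<open>The reflection \<open>X \<mapsto> X ** (2 Q Q\<^sup>* - 1)\<close> preserves the Gaussian measure and negates \<open>X ** B\<close>, which
  removes the cross term.\<close>

lemma nn_integral_norm_add_left_inv_le:
  fixes Q :: "'a::rc_scalar^'c^'n" and B :: "'a^'p^'n" and M :: "'a^'p^'q"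
  assumes Q: "orthonormal_cols S Q" and B: "ctranspose Q ** B = 0"
    and H: "\<And>Y. norm (H ** Y :: 'a^'p^'q) \<le> norm Y"
    and d: "DIM('a) * card S + 2 < DIM('a) * (CARD('s) + 1)"
  shows "(\<integral>\<^sup>+X. ennreal ((norm (M + H ** (left_inv S ((X :: 'a^'n^'s) ** Q) ** X ** B)))\<^sup>2) \<partial>gauss) \<le>
     ennreal ((norm M)\<^sup>2 + proj_coef DIM('a) (card S) CARD('s) * (norm B)\<^sup>2)"
proof -
  define E where "E = Q ** ctranspose Q"
  note p = orthonormal_cols_projector[OF Q, folded E_def]
  have EB: "E ** B = 0"
    using linear_0[OF linear_matrix_mult_left[of Q]] by (simp add: E_def B flip: matrix_mul_assoc)
  define N where "N X = left_inv S ((X :: 'a^'n^'s) ** Q) ** X ** B" for X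
  have [measurable]: "N \<in> borel_measurable borel" unfolding N_def by measurable
  let ?f = "\<lambda>X :: 'a^'n^'s. X ** E - (X - X ** E)"
  have lin: "linear ?f"
    by (intro linearI) (auto simp: matrix_add_rdistrib matrix_scaleR_left algebra_simps)
  have isom: "norm (?f X) = norm X" for X
  proof -
    have "(X ** E) \<bullet> (- (X - X ** E)) = 0"
      using p(1,2) by (simp add: inner_matrix_mult_right matrix_diff_rdistrib flip: matrix_mul_assoc)
    then have "(norm (X ** E + - (X - X ** E)))\<^sup>2 = (norm X)\<^sup>2"
      by (subst norm_add_Pythagorean) (auto simp: orthogonal_def norm_minus_commute simp flip: norm_projector_right[OF p(1,2), of X])
    then show ?thesis by simp
  qed
  have Nf: "N (?f X) = - N X" for X
  proof -
    have "X ** E ** Q = X ** Q"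
      by (simp add: p(4) flip: matrix_mul_assoc)
    then have "?f X ** Q = X ** Q"
      by (simp only: matrix_diff_rdistrib) simp
    moreover have "X ** E ** B = 0"
      using EB linear_0[OF linear_matrix_mult_left] by (simp flip: matrix_mul_assoc)
    then have "?f X ** B = - (X ** B)"
      by (simp only: matrix_diff_rdistrib) simp
    ultimately show ?thesis
      using linear_neg[OF linear_matrix_mult_left] by (simp add: N_def flip: matrix_mul_assoc)
  qed
  let ?I = "\<integral>\<^sup>+X. ennreal ((norm (M + H ** N X))\<^sup>2) \<partial>gauss"
  have "?I = (\<integral>\<^sup>+X. ennreal ((norm (M + H ** N (?f X)))\<^sup>2) \<partial>gauss)"
    by (rule nn_integral_gauss_isometry[OF lin isom, symmetric]) measurable
  also have "\<dots> = (\<integral>\<^sup>+X. ennreal ((norm (M - H ** N X))\<^sup>2) \<partial>gauss)"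
    by (simp only: Nf linear_neg[OF linear_matrix_mult_left[of H]] add_uminus_conv_diff)
  finally have "2 * ?I = ?I + (\<integral>\<^sup>+X. ennreal ((norm (M - H ** N X))\<^sup>2) \<partial>gauss)"
    by (simp add: mult_2)
  also have "\<dots> = (\<integral>\<^sup>+X. ennreal ((norm (M + H ** N X))\<^sup>2) + ennreal ((norm (M - H ** N X))\<^sup>2) \<partial>gauss)"
    by (rule nn_integral_add[symmetric]) measurable
  also have "\<dots> = (\<integral>\<^sup>+X. 2 * (ennreal ((norm M)\<^sup>2) + ennreal ((norm (H ** N X))\<^sup>2)) \<partial>gauss)"
  proof (intro nn_integral_cong)
    fix X
    have "(norm (M + H ** N X))\<^sup>2 + (norm (M - H ** N X))\<^sup>2 = 2 * ((norm M)\<^sup>2 + (norm (H ** N X))\<^sup>2)"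
      by (simp add: power2_norm_eq_inner inner_simps algebra_simps)
    then have "ennreal ((norm (M + H ** N X))\<^sup>2 + (norm (M - H ** N X))\<^sup>2) = ennreal (2 * ((norm M)\<^sup>2 + (norm (H ** N X))\<^sup>2))"
      by (rule arg_cong)
    then show "ennreal ((norm (M + H ** N X))\<^sup>2) + ennreal ((norm (M - H ** N X))\<^sup>2) =
       2 * (ennreal ((norm M)\<^sup>2) + ennreal ((norm (H ** N X))\<^sup>2))"
      by (simp add: ennreal_mult' distrib_left)
  qed
  also have "\<dots> = 2 * (ennreal ((norm M)\<^sup>2) + (\<integral>\<^sup>+X. ennreal ((norm (H ** N X))\<^sup>2) \<partial>gauss))"
    by (subst nn_integral_cmult, measurable, subst nn_integral_add) auto
  finally have "?I = ennreal ((norm M)\<^sup>2) + (\<integral>\<^sup>+X. ennreal ((norm (H ** N X))\<^sup>2) \<partial>gauss)"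
    by (subst (asm) ennreal_mult_cancel_left) auto
  \<comment> \<open>In the applications \<open>H\<close> is the identity up to sign or
    \<open>- (ctranspose P ** V)\<close>; these are contractions.\<close>
  also have "\<dots> \<le> ennreal ((norm M)\<^sup>2) + (\<integral>\<^sup>+X. ennreal ((norm (N X))\<^sup>2) \<partial>gauss)"
    by (intro add_left_mono nn_integral_mono ennreal_leI power_mono H) simp
  also have "(\<integral>\<^sup>+X. ennreal ((norm (N X))\<^sup>2) \<partial>gauss) \<le>
     ennreal (real (card S) / (real DIM('a) * (real CARD('s) - real (card S) + 1) - 2)) * ennreal (real DIM('a) * (norm B)\<^sup>2)"
    unfolding N_def nn_integral_norm_left_inv_mult_mult[OF Q B]
    by (intro mult_right_mono nn_integral_norm_left_inv_le[OF Q d]) simp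
  also have "\<dots> = ennreal (proj_coef DIM('a) (card S) CARD('s) * (norm B)\<^sup>2)"
    by (subst ennreal_mult''[symmetric]) (simp_all add: proj_coef_def mult_ac)
  finally show ?thesis
    using proj_coef_nonneg[OF d] by (subst ennreal_plus) (auto simp: N_def)
qed

subsection \<open>The core matrix\<close>

lemma orthonormal_cols_UNIV_iff: "orthonormal_cols UNIV Q \<longleftrightarrow> ctranspose Q ** Q = mat 1"
  by (simp add: orthonormal_cols_def)

lemma matrix_mult_zero [simp]: "A ** 0 = (0 :: 'a::rc_scalar^'n^'m)" "0 ** B = (0 :: 'a::rc_scalar^'n^'m)"
  using linear_0[OF linear_matrix_mult_left] linear_0[OF linear_matrix_mult_right] by auto

lemma norm_mult_ctranspose_orthonormal:
  assumes "orthonormal_cols UNIV P"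
  shows "norm (Z ** ctranspose P) = norm Z"
  using norm_orthonormal_cols_mult[OF assms, of "ctranspose Z"] norm_ctranspose[of "P ** ctranspose Z"]
  by (simp add: ctranspose_mult)

text \<open>Pythagoras twice: first the part of \<open>A\<close> outside the range of
  \<open>Q\<close> is split off, then, inside that range, the part outside the row space given by
  \<open>P\<close>. What remains is compared with \<open>C\<close>, so the sketches \<Phi> and
  \<Psi> affect the last term alone.\<close>

lemma norm_approx_error:
  fixes A :: "'a::rc_scalar^'n^'m" and Q :: "'a^'k^'m" and P :: "'a^'k^'n"
  assumes Q: "orthonormal_cols UNIV Q" and P: "orthonormal_cols UNIV P"
  shows "(norm (A - Q ** C ** ctranspose P))\<^sup>2 = (norm (A - Q ** ctranspose Q ** A))\<^sup>2 +
     (norm (ctranspose Q ** A - ctranspose Q ** A ** P ** ctranspose P))\<^sup>2 +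
     (norm (ctranspose Q ** A ** P - C))\<^sup>2"
proof -
  note pQ = orthonormal_cols_projector[OF Q] and pP = orthonormal_cols_projector[OF P]
  note Q1 = Q[unfolded orthonormal_cols_UNIV_iff] and P1 = P[unfolded orthonormal_cols_UNIV_iff]
  let ?X = "A - Q ** C ** ctranspose P" and ?Y = "ctranspose Q ** A - C ** ctranspose P"
  have QX: "Q ** ctranspose Q ** ?X = Q ** ?Y"
    by (simp add: matrix_diff_ldistrib Q1 flip: matrix_mul_assoc) (simp add: Q1 matrix_mul_assoc)
  have XQ: "?X - Q ** ?Y = A - Q ** ctranspose Q ** A"
    by (simp add: matrix_diff_ldistrib matrix_mul_assoc)
  have nY: "norm (Q ** ?Y) = norm ?Y"
    using norm_orthonormal_cols_mult[OF Q, of ?Y] by simp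
  have 1: "(norm ?X)\<^sup>2 = (norm ?Y)\<^sup>2 + (norm (A - Q ** ctranspose Q ** A))\<^sup>2"
    using norm_projector_left[OF pQ(1,2), of ?X, unfolded QX XQ nY] by simp
  have YP: "?Y ** (P ** ctranspose P) = (ctranspose Q ** A ** P - C) ** ctranspose P"
    by (simp add: matrix_diff_rdistrib P1 flip: matrix_mul_assoc) (simp add: P1 matrix_mul_assoc)
  have PY: "?Y - (ctranspose Q ** A ** P - C) ** ctranspose P = ctranspose Q ** A - ctranspose Q ** A ** P ** ctranspose P"
    by (simp add: matrix_diff_rdistrib)
  have "(norm ?Y)\<^sup>2 = (norm (ctranspose Q ** A ** P - C))\<^sup>2 +
     (norm (ctranspose Q ** A - ctranspose Q ** A ** P ** ctranspose P))\<^sup>2"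
    using norm_projector_right[OF pP(1,2), of ?Y, unfolded YP PY norm_mult_ctranspose_orthonormal[OF P]] by simp
  with 1 show ?thesis by simp
qed

text \<open>In terms of least squares, the sketch recovers exactly the coefficients of the part of
  \<open>B\<close> in the range of \<open>P\<close>. All error stems from the residual, which is
  orthogonal to \<open>P\<close> and hence meets an independent part of a Gaussian
  \<open>X\<close>.\<close>

lemma left_inv_mult_split:
  fixes X :: "'a::rc_scalar^'n^'s" and P :: "'a^'k^'n"
  assumes P: "orthonormal_cols UNIV P" and det: "det (gram UNIV (X ** P)) \<noteq> 0"
  shows "left_inv UNIV (X ** P) ** X ** B = ctranspose P ** B + left_inv UNIV (X ** P) ** X ** (B - P ** ctranspose P ** B)"
proof -
  have "left_inv UNIV (X ** P) ** X ** P = mat 1"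
    using left_inv_mult[OF det] by (simp add: matrix_mul_assoc)
  then have "left_inv UNIV (X ** P) ** X ** (P ** ctranspose P ** B) = ctranspose P ** B"
    by (simp add: matrix_mul_assoc)
  then show ?thesis by (simp add: matrix_diff_ldistrib)
qed

lemma ctranspose_mult_residual:
  assumes "orthonormal_cols S P"
  shows "ctranspose P ** (B - P ** ctranspose P ** B) = 0"
  using orthonormal_cols_projector(3)[OF assms] by (simp add: matrix_diff_ldistrib matrix_mul_assoc)

text \<open>The right half of the core matrix, with \<Phi> frozen inside \<open>J\<close>. Conjugate
  transposition brings \<Psi> to the left, where the bound for left inverses applies with
  \<open>H = - mat 1\<close>.\<close>

lemma nn_integral_core_inner:
  fixes J :: "'a::rc_scalar^'n^'q" and P :: "'a^'k^'n" and D :: "'a^'k^'q"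
  assumes P: "orthonormal_cols UNIV P" and d: "DIM('a) * CARD('k) + 2 < DIM('a) * (CARD('s) + 1)"
    and ks: "CARD('k) \<le> CARD('s)"
  shows "(\<integral>\<^sup>+\<Psi>. ennreal ((norm (D - J ** ctranspose (\<Psi> :: 'a^'n^'s) ** ctranspose (left_inv UNIV (\<Psi> ** P))))\<^sup>2) \<partial>gauss)
    \<le> ennreal ((norm (D - J ** P))\<^sup>2 + proj_coef DIM('a) CARD('k) CARD('s) * (norm (J - J ** P ** ctranspose P))\<^sup>2)"
proof -
  let ?B = "ctranspose J - P ** ctranspose P ** ctranspose J"
  let ?M = "ctranspose D - ctranspose P ** ctranspose J"
  have H: "norm ((- mat 1 :: 'a^'k^'k) ** Y) \<le> norm Y" for Y :: "'a^'q^'k"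
    by (simp add: matrix_uminus_left)
  have "(\<integral>\<^sup>+\<Psi>. ennreal ((norm (D - J ** ctranspose (\<Psi> :: 'a^'n^'s) ** ctranspose (left_inv UNIV (\<Psi> ** P))))\<^sup>2) \<partial>gauss) =
     (\<integral>\<^sup>+\<Psi>. ennreal ((norm (?M + (- mat 1 :: 'a^'k^'k) ** (left_inv UNIV ((\<Psi> :: 'a^'n^'s) ** P) ** \<Psi> ** ?B)))\<^sup>2) \<partial>gauss)"
  proof (rule nn_integral_cong_AE, rule AE_mp[OF AE_gram_nonsingular[OF P ks]], intro AE_I2 impI)
    fix \<Psi> :: "'a^'n^'s" assume det: "det (gram UNIV (\<Psi> ** P)) \<noteq> 0"
    have "norm (D - J ** ctranspose \<Psi> ** ctranspose (left_inv UNIV (\<Psi> ** P))) =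
       norm (ctranspose D - left_inv UNIV (\<Psi> ** P) ** \<Psi> ** ctranspose J)"
      using norm_ctranspose[of "D - J ** ctranspose \<Psi> ** ctranspose (left_inv UNIV (\<Psi> ** P))"]
      by (simp add: ctranspose_diff ctranspose_mult matrix_mul_assoc)
    also have "ctranspose D - left_inv UNIV (\<Psi> ** P) ** \<Psi> ** ctranspose J =
       ?M + (- mat 1 :: 'a^'k^'k) ** (left_inv UNIV (\<Psi> ** P) ** \<Psi> ** ?B)"
      by (subst left_inv_mult_split[OF P det]) (simp add: matrix_uminus_left)
    finally show "ennreal ((norm (D - J ** ctranspose \<Psi> ** ctranspose (left_inv UNIV (\<Psi> ** P))))\<^sup>2) =
       ennreal ((norm (?M + (- mat 1 :: 'a^'k^'k) ** (left_inv UNIV (\<Psi> ** P) ** \<Psi> ** ?B)))\<^sup>2)" by simp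
  qed
  also have "\<dots> \<le> ennreal ((norm ?M)\<^sup>2 + proj_coef DIM('a) CARD('k) CARD('s) * (norm ?B)\<^sup>2)"
    by (rule nn_integral_norm_add_left_inv_le[OF P ctranspose_mult_residual[OF P] H d])
  also have "norm ?M = norm (D - J ** P)"
    using norm_ctranspose[of "D - J ** P"] by (simp add: ctranspose_diff ctranspose_mult)
  also have "norm ?B = norm (J - J ** P ** ctranspose P)"
    using norm_ctranspose[of "J - J ** P ** ctranspose P"] by (simp add: ctranspose_diff ctranspose_mult matrix_mul_assoc)
  finally show ?thesis .
qed

text \<open>Averaging over \<Psi> replaces the core error by terms in \<open>J \<Phi>\<close>;
  averaging over \<Phi> then gives multiples of \<open>x\<close>, \<open>y\<close> and
  \<open>z\<close>, the squared norms of the three orthogonal parts of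
  \<open>A - Q ** ctranspose Q ** A ** P ** ctranspose P\<close>.\<close>

lemma nn_integral_core:
  fixes A :: "'a::rc_scalar^'n^'m" and Q :: "'a^'k^'m" and P :: "'a^'k^'n"
  assumes Q: "orthonormal_cols UNIV Q" and P: "orthonormal_cols UNIV P"
    and d: "DIM('a) * CARD('k) + 2 < DIM('a) * (CARD('s) + 1)" and ks: "CARD('k) \<le> CARD('s)"
    and c1: "proj_coef DIM('a) CARD('k) CARD('s) \<le> 1"
  shows "(\<integral>\<^sup>+\<Phi>. \<integral>\<^sup>+\<Psi>. ennreal ((norm (A - Q ** (left_inv UNIV (\<Phi> ** Q) ** (\<Phi> ** A ** ctranspose \<Psi>)
       ** ctranspose (left_inv UNIV ((\<Psi> :: 'a^'n^'s) ** P))) ** ctranspose P))\<^sup>2) \<partial>gauss \<partial>(gauss :: ('a^'m^'s) measure))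
    \<le> ennreal ((1 + proj_coef DIM('a) CARD('k) CARD('s)) *
       ((norm (A - A ** P ** ctranspose P))\<^sup>2 + (norm ((A - Q ** ctranspose Q ** A) ** P))\<^sup>2))"
proof -
  define c where "c = proj_coef DIM('a) CARD('k) CARD('s)"
  have c: "0 \<le> c" "c \<le> 1" using c1 proj_coef_nonneg[OF d] by (auto simp: c_def)
  define R where "R = A - Q ** ctranspose Q ** A"
  define D where "D = ctranspose Q ** A - ctranspose Q ** A ** P ** ctranspose P"
  define x where "x = (norm (R ** P))\<^sup>2"
  define y where "y = (norm (R - R ** P ** ctranspose P))\<^sup>2"
  define z where "z = (norm D)\<^sup>2"
  define J where "J \<Phi> = left_inv UNIV (\<Phi> ** Q) ** \<Phi> ** A" for \<Phi> :: "'a^'m^'s"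
  have [measurable]: "J \<in> borel_measurable borel" unfolding J_def by measurable
  note pQ = orthonormal_cols_projector[OF Q] and pP = orthonormal_cols_projector[OF P]
  have nn: "x \<ge> 0" "y \<ge> 0" "z \<ge> 0" by (simp_all add: x_def y_def z_def)
  have H: "norm ((mat 1 :: 'a^'k^'k) ** Y) \<le> norm Y" for Y :: "'a^'b^'k" by simp
  have Jsplit: "J \<Phi> = ctranspose Q ** A + left_inv UNIV (\<Phi> ** Q) ** \<Phi> ** R" if "det (gram UNIV (\<Phi> ** Q)) \<noteq> 0" for \<Phi>
    using left_inv_mult_split[OF Q that, of A] by (simp add: J_def R_def)
  have "(\<integral>\<^sup>+\<Phi>. ennreal ((norm (ctranspose Q ** A ** P - J \<Phi> ** P))\<^sup>2) \<partial>gauss) =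
     (\<integral>\<^sup>+\<Phi>. ennreal ((norm (0 + (mat 1 :: 'a^'k^'k) ** (left_inv UNIV ((\<Phi> :: 'a^'m^'s) ** Q) ** \<Phi> ** (R ** P))))\<^sup>2) \<partial>gauss)"
    by (rule nn_integral_cong_AE, rule AE_mp[OF AE_gram_nonsingular[OF Q ks]], intro AE_I2 impI)
      (simp add: Jsplit matrix_add_rdistrib matrix_mul_assoc)
  also have "\<dots> \<le> ennreal ((norm (0 :: 'a^'k^'k))\<^sup>2 + c * (norm (R ** P))\<^sup>2)"
    unfolding c_def R_def
    by (rule nn_integral_norm_add_left_inv_le[OF Q _ H d]) (simp add: matrix_mul_assoc ctranspose_mult_residual[OF Q])
  finally have I1: "(\<integral>\<^sup>+\<Phi>. ennreal ((norm (ctranspose Q ** A ** P - J \<Phi> ** P))\<^sup>2) \<partial>gauss) \<le> ennreal (c * x)"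
    by (simp add: x_def)
  have "(\<integral>\<^sup>+\<Phi>. ennreal ((norm (J \<Phi> - J \<Phi> ** P ** ctranspose P))\<^sup>2) \<partial>gauss) =
     (\<integral>\<^sup>+\<Phi>. ennreal ((norm (D + (mat 1 :: 'a^'k^'k) ** (left_inv UNIV ((\<Phi> :: 'a^'m^'s) ** Q) ** \<Phi> ** (R - R ** P ** ctranspose P))))\<^sup>2) \<partial>gauss)"
    by (rule nn_integral_cong_AE, rule AE_mp[OF AE_gram_nonsingular[OF Q ks]], intro AE_I2 impI)
      (simp add: Jsplit D_def matrix_add_rdistrib matrix_diff_ldistrib matrix_mul_assoc algebra_simps)
  also have "\<dots> \<le> ennreal ((norm D)\<^sup>2 + c * (norm (R - R ** P ** ctranspose P))\<^sup>2)"
    unfolding c_def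
  proof (rule nn_integral_norm_add_left_inv_le[OF Q _ H d])
    have "ctranspose Q ** R = 0" unfolding R_def by (rule ctranspose_mult_residual[OF Q])
    then show "ctranspose Q ** (R - R ** P ** ctranspose P) = 0"
      by (simp add: matrix_diff_ldistrib matrix_mul_assoc)
  qed
  finally have I2: "(\<integral>\<^sup>+\<Phi>. ennreal ((norm (J \<Phi> - J \<Phi> ** P ** ctranspose P))\<^sup>2) \<partial>gauss) \<le> ennreal (z + c * y)"
    by (simp add: z_def y_def)
  have RP: "norm (R ** (P ** ctranspose P)) = norm (R ** P)"
    using norm_mult_ctranspose_orthonormal[OF P, of "R ** P"] by (simp add: matrix_mul_assoc)
  have nR: "(norm R)\<^sup>2 = x + y"
    using norm_projector_right[OF pP(1,2), of R] RP by (simp add: x_def y_def matrix_mul_assoc)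
  have nA: "(norm (A - A ** P ** ctranspose P))\<^sup>2 = z + y"
  proof -
    let ?X = "A - A ** P ** ctranspose P"
    have "Q ** ctranspose Q ** ?X = Q ** D"
      by (simp add: D_def matrix_diff_ldistrib matrix_mul_assoc)
    moreover have "?X - Q ** D = R - R ** P ** ctranspose P"
      by (simp add: D_def R_def matrix_diff_ldistrib matrix_diff_rdistrib matrix_mul_assoc algebra_simps)
    ultimately show ?thesis
      using norm_projector_left[OF pQ(1,2), of ?X] norm_orthonormal_cols_mult[OF Q, of D]
      by (simp add: y_def z_def)
  qed
  have "(\<integral>\<^sup>+\<Phi>. \<integral>\<^sup>+\<Psi>. ennreal ((norm (A - Q ** (left_inv UNIV (\<Phi> ** Q) ** (\<Phi> ** A ** ctranspose \<Psi>)
       ** ctranspose (left_inv UNIV ((\<Psi> :: 'a^'n^'s) ** P))) ** ctranspose P))\<^sup>2) \<partial>gauss \<partial>(gauss :: ('a^'m^'s) measure))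
    \<le> (\<integral>\<^sup>+\<Phi>. ennreal (x + y + z) + (ennreal ((norm (ctranspose Q ** A ** P - J \<Phi> ** P))\<^sup>2) +
        ennreal c * ennreal ((norm (J \<Phi> - J \<Phi> ** P ** ctranspose P))\<^sup>2)) \<partial>gauss)"
  proof (rule nn_integral_mono)
    fix \<Phi> :: "'a^'m^'s"
    have "(\<integral>\<^sup>+\<Psi>. ennreal ((norm (A - Q ** (left_inv UNIV (\<Phi> ** Q) ** (\<Phi> ** A ** ctranspose \<Psi>)
       ** ctranspose (left_inv UNIV ((\<Psi> :: 'a^'n^'s) ** P))) ** ctranspose P))\<^sup>2) \<partial>gauss) =
      (\<integral>\<^sup>+\<Psi>. ennreal (x + y + z) + ennreal ((norm (ctranspose Q ** A ** P - J \<Phi> ** ctranspose \<Psi>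
         ** ctranspose (left_inv UNIV ((\<Psi> :: 'a^'n^'s) ** P))))\<^sup>2) \<partial>gauss)"
      using nn nR unfolding norm_approx_error[OF Q P] R_def[symmetric] D_def[symmetric] z_def[symmetric]
      by (simp add: J_def matrix_mul_assoc)
    also have "\<dots> = ennreal (x + y + z) + (\<integral>\<^sup>+\<Psi>. ennreal ((norm (ctranspose Q ** A ** P - J \<Phi> ** ctranspose \<Psi>
         ** ctranspose (left_inv UNIV ((\<Psi> :: 'a^'n^'s) ** P))))\<^sup>2) \<partial>gauss)"
      by (subst nn_integral_add) auto
    also have "\<dots> \<le> ennreal (x + y + z) + ennreal ((norm (ctranspose Q ** A ** P - J \<Phi> ** P))\<^sup>2 +
        c * (norm (J \<Phi> - J \<Phi> ** P ** ctranspose P))\<^sup>2)"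
      unfolding c_def by (intro add_left_mono nn_integral_core_inner[OF P d ks])
    finally show "(\<integral>\<^sup>+\<Psi>. ennreal ((norm (A - Q ** (left_inv UNIV (\<Phi> ** Q) ** (\<Phi> ** A ** ctranspose \<Psi>)
       ** ctranspose (left_inv UNIV ((\<Psi> :: 'a^'n^'s) ** P))) ** ctranspose P))\<^sup>2) \<partial>gauss) \<le>
       ennreal (x + y + z) + (ennreal ((norm (ctranspose Q ** A ** P - J \<Phi> ** P))\<^sup>2) +
        ennreal c * ennreal ((norm (J \<Phi> - J \<Phi> ** P ** ctranspose P))\<^sup>2))"
      using c by (simp add: ennreal_mult)
  qed
  also have "\<dots> = ennreal (x + y + z) + ((\<integral>\<^sup>+\<Phi>. ennreal ((norm (ctranspose Q ** A ** P - J \<Phi> ** P))\<^sup>2) \<partial>gauss) +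
        ennreal c * (\<integral>\<^sup>+\<Phi>. ennreal ((norm (J \<Phi> - J \<Phi> ** P ** ctranspose P))\<^sup>2) \<partial>gauss))"
    by (simp add: nn_integral_add nn_integral_cmult)
  also have "\<dots> \<le> ennreal (x + y + z) + (ennreal (c * x) + ennreal c * ennreal (z + c * y))"
    by (intro add_left_mono add_mono mult_left_mono I1 I2) simp
  also have "\<dots> = ennreal (x + y + z + (c * x + c * (z + c * y)))"
    using nn c by (simp add: ennreal_mult)
  also have "\<dots> \<le> ennreal ((1 + c) * (z + y + x))"
  proof (rule ennreal_leI)
    \<comment> \<open>The part \<open>y\<close>, outside the ranges of both factors, is amplified by
      both sketches and carries \<open>c * c\<close>; \<open>c \<le> 1\<close> reduces this to
      \<open>c\<close>.\<close>
    have "c * (c * y) \<le> c * (1 * y)" using nn c by (intro mult_left_mono mult_right_mono)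
    then show "x + y + z + (c * x + c * (z + c * y)) \<le> (1 + c) * (z + y + x)"
      by (simp add: algebra_simps)
  qed
  finally show ?thesis by (simp add: c_def nA x_def R_def)
qed

subsection \<open>The range finder\<close>

text \<open>Limits the families in the maximality argument that follows. The dimension is taken over
  \<open>'a\<close>, in contrast to the real dimensions used for distances.\<close>

lemma orthonormal_cols_independent:
  fixes V :: "'a::rc_scalar^'k^'q"
  assumes V: "orthonormal_cols S V" and sub: "(\<lambda>j. column j V) ` S \<subseteq> W"
  shows "card S \<le> vec.dim W"
proof -
  have h: "(\<Sum>l\<in>UNIV. conjugate (V $ l $ i) * V $ l $ j) = (if i = j then 1 else 0)" if "i \<in> S" for i j
    using arg_cong[OF V[unfolded orthonormal_cols_def], of "\<lambda>M. M $ i $ j"] that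
    by (simp add: matrix_matrix_mult_def ctranspose_def coord_proj_def)
  have inj: "inj_on (\<lambda>j. column j V) S"
  proof (rule inj_onI)
    fix i j assume ij: "i \<in> S" "j \<in> S" "column i V = column j V"
    then have "V $ l $ i = V $ l $ j" for l by (simp add: column_def vec_eq_iff)
    then show "i = j" using h[OF ij(1), of i] h[OF ij(1), of j] by (simp split: if_splits)
  qed
  have "vec.independent ((\<lambda>j. column j V) ` S)"
  proof
    assume "vec.dependent ((\<lambda>j. column j V) ` S)"
    then obtain u where "\<exists>v\<in>(\<lambda>j. column j V) ` S. u v \<noteq> 0"
      and 0: "(\<Sum>v\<in>(\<lambda>j. column j V) ` S. u v *s v) = 0"
      using vec.dependent_finite[of "(\<lambda>j. column j V) ` S"] by auto
    then obtain i where i: "i \<in> S" "u (column i V) \<noteq> 0" by blast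
    have "(\<Sum>j\<in>S. u (column j V) * V $ l $ j) = 0" for l
      using arg_cong[OF 0, of "\<lambda>x. x $ l"] by (simp add: sum.reindex[OF inj]) (simp add: column_def)
    then have "0 = (\<Sum>l\<in>UNIV. conjugate (V $ l $ i) * (\<Sum>j\<in>S. u (column j V) * V $ l $ j))"
      by simp
    also have "\<dots> = (\<Sum>j\<in>S. u (column j V) * (\<Sum>l\<in>UNIV. conjugate (V $ l $ i) * V $ l $ j))"
      unfolding sum_distrib_left by (subst sum.swap) (simp add: mult_ac)
    also have "\<dots> = u (column i V)"
      using i by (simp add: h if_distrib cong: if_cong)
    finally show False using i by simp
  qed
  then have "card ((\<lambda>j. column j V) ` S) \<le> vec.dim W"
    using sub by (rule vec.independent_card_le_dim[rotated])
  then show ?thesis by (simp add: card_image[OF inj])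
qed

text \<open>An orthonormal family of maximal size in the span of \<open>X\<close> spans it: otherwise it could be
  extended by a normalised residual.\<close>

lemma orthonormal_cols_exist:
  fixes X :: "('a::rc_scalar^'q) set"
  assumes dim: "vec.dim X \<le> r" and r: "r < CARD('k::finite)"
  obtains V :: "'a^'k^'q" and S where "orthonormal_cols S V" "card S \<le> r"
    "\<And>x. x \<in> X \<Longrightarrow> (V ** ctranspose V) *v x = x"
proof -
  define good where "good = (\<lambda>(S :: 'k set, V :: 'a^'k^'q). orthonormal_cols S V \<and> (\<lambda>j. column j V) ` S \<subseteq> vec.span X)"
  have good0: "good ({}, 0)" by (simp add: good_def orthonormal_cols_def)
  have bound: "\<forall>Z. good Z \<longrightarrow> card (fst Z) < Suc CARD('k)" by (simp add: card_mono less_Suc_eq_le)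
  obtain Z where "good Z \<and> (\<forall>Z'. good Z' \<longrightarrow> card (fst Z') \<le> card (fst Z))"
    using ex_has_greatest_nat[of good, OF good0 bound] by (rule exE)
  then have Z: "good Z" "\<And>Z'. good Z' \<Longrightarrow> card (fst Z') \<le> card (fst Z)"
    by blast+
  obtain S V where SV: "Z = (S, V)" by fastforce
  have V: "orthonormal_cols S V" and sub: "(\<lambda>j. column j V) ` S \<subseteq> vec.span X"
    using Z(1) by (auto simp: good_def SV)
  have card: "card S \<le> r"
    using orthonormal_cols_independent[OF V sub] dim by (simp add: vec.dim_span)
  note p = orthonormal_cols_projector[OF V] and pS = orthonormal_cols_mult_coord_proj[OF V]
  have "(V ** ctranspose V) *v x = x" if x: "x \<in> X" for x
  proof (rule ccontr)
    assume neq: "(V ** ctranspose V) *v x \<noteq> x"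
    define y where "y = x - (V ** ctranspose V) *v x"
    have y0: "y \<noteq> 0" using neq by (simp add: y_def)
    have "ctranspose V *v y = 0"
      using p(3) by (simp add: y_def matrix_vector_mult_diff_distrib matrix_vector_mul_assoc)
    then have Vy: "(\<Sum>l\<in>UNIV. conjugate (V $ l $ j) * y $ l) = 0" for j
      by (simp add: vec_eq_iff matrix_vector_mult_def ctranspose_def)
    have V0: "V $ l $ j = 0" if "j \<notin> S" for l j
      using coord_proj_mult_right[of V S l j] that by (simp add: pS)
    have "(V ** ctranspose V) *v x = (\<Sum>j\<in>S. (ctranspose V *v x) $ j *s column j V)"
    proof -
      have "((V ** ctranspose V) *v x) $ l = (\<Sum>j\<in>S. V $ l $ j * (ctranspose V *v x) $ j)" for l
        unfolding matrix_vector_mul_assoc[symmetric] matrix_vector_mult_def[of V] vec_lambda_beta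
        by (rule sum.mono_neutral_right) (auto simp: V0)
      then show ?thesis by (simp add: vec_eq_iff column_def mult.commute)
    qed
    also have "\<dots> \<in> vec.span X"
      using sub by (intro vec.span_sum vec.span_scale) auto
    finally have y_span: "y \<in> vec.span X"
      unfolding y_def by (intro vec.span_diff vec.span_base[OF x])
    \<comment> \<open>The strict bound \<open>r < CARD('k)\<close> leaves a free column index for
      the normalised residual.\<close>
    obtain i where i: "i \<notin> S" using card r by (metis UNIV_eq_I not_le)
    define w where "w = (\<chi> l. y $ l / of_real (norm y))"
    have "w = (1 / of_real (norm y)) *s y" by (simp add: w_def vec_eq_iff)
    then have w_span: "w \<in> vec.span X" using y_span by (simp add: vec.span_scale)
    have w1: "(\<Sum>l\<in>UNIV. conjugate (w $ l) * w $ l) = 1"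
    proof -
      have "w = (1 / norm y) *\<^sub>R y"
        by (simp add: vec_eq_iff w_def) (simp add: scaleR_conv_of_real)
      then have "norm w = 1" using y0 by simp
      have "(\<Sum>l\<in>UNIV. conjugate (w $ l) * w $ l) = of_real ((norm w)\<^sup>2)"
        by (simp add: conjugate_mult_self norm_vec_squared)
      then show ?thesis by (simp add: \<open>norm w = 1\<close>)
    qed
    have Vw: "(\<Sum>l\<in>UNIV. conjugate (V $ l $ j) * w $ l) = 0" for j
    proof -
      have "(\<Sum>l\<in>UNIV. conjugate (V $ l $ j) * w $ l) = (\<Sum>l\<in>UNIV. conjugate (V $ l $ j) * y $ l) / of_real (norm y)"
        by (simp add: w_def sum_divide_distrib)
      then show ?thesis by (simp add: Vy)
    qed
    have wV: "(\<Sum>l\<in>UNIV. conjugate (w $ l) * V $ l $ j) = 0" for j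
    proof -
      have "(\<Sum>l\<in>UNIV. conjugate (w $ l) * V $ l $ j) = conjugate (\<Sum>l\<in>UNIV. conjugate (V $ l $ j) * w $ l)"
        by (simp add: sum_conjugate conjugate_dist_mul mult.commute)
      then show ?thesis by (simp add: Vw)
    qed
    define V' where "V' = (\<chi> l j. if j = i then w $ l else V $ l $ j)"
    have VV: "(\<Sum>l\<in>UNIV. conjugate (V $ l $ j) * V $ l $ j') = (if j = j' \<and> j \<in> S then 1 else 0)" for j j'
      using arg_cong[OF V[unfolded orthonormal_cols_def], of "\<lambda>M. M $ j $ j'"]
      by (simp add: matrix_matrix_mult_def ctranspose_def coord_proj_def)
    have "(ctranspose V' ** V') $ j $ j' = coord_proj (insert i S) $ j $ j'" for j j'
      using i by (cases "j = i"; cases "j' = i")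
        (simp_all add: matrix_matrix_mult_def ctranspose_def coord_proj_def V'_def w1 wV Vw VV)
    then have "orthonormal_cols (insert i S) V'"
      by (simp add: orthonormal_cols_def vec_eq_iff)
    moreover have "column j V' = (if j = i then w else column j V)" for j
      by (auto simp: column_def V'_def vec_eq_iff)
    ultimately have "good (insert i S, V')"
      using sub w_span by (auto simp: good_def)
    from Z(2)[OF this] i show False by (simp add: SV)
  qed
  with V card show thesis by (rule that)
qed

section \<open>Projectors onto row and column spaces\<close>

lemma row_space_projector:
  fixes B :: "'a::rc_scalar^'n^'m"
  assumes "rank B \<le> r" and r: "r < CARD('k::finite)"
  obtains V :: "'a^'k^'n" and S where "orthonormal_cols S V" "card S \<le> r" "B ** V ** ctranspose V = B"
proof -
  have "vec.dim (rows B) \<le> r" using assms(1) by (simp add: row_rank_def_gen)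
  then obtain W :: "'a^'k^'n" and S where W: "orthonormal_cols S W" "card S \<le> r"
    and x: "\<And>x. x \<in> rows B \<Longrightarrow> (W ** ctranspose W) *v x = x"
    using orthonormal_cols_exist[OF _ r] by blast
  \<comment> \<open>The projector of \<open>W\<close> fixes the rows of \<open>B\<close>, read as
    column vectors, from the left. Acting from the right needs the transposed projector, hence the
    entrywise conjugate of \<open>W\<close>.\<close>
  define V where "V = (\<chi> i j. conjugate (W $ i $ j))"
  have "ctranspose V ** V = (\<chi> i j. conjugate ((ctranspose W ** W) $ i $ j))"
    by (simp add: V_def vec_eq_iff ctranspose_def matrix_matrix_mult_def sum_conjugate conjugate_dist_mul)
  also have "\<dots> = coord_proj S"
    using W(1) by (simp add: orthonormal_cols_def coord_proj_def vec_eq_iff)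
  finally have V: "orthonormal_cols S V" by (simp add: orthonormal_cols_def)
  have "(B ** (V ** ctranspose V)) $ l $ j = B $ l $ j" for l j
  proof -
    have "row l B \<in> rows B" by (auto simp: rows_def)
    from arg_cong[OF x[OF this], of "\<lambda>x. x $ j"]
    have "(\<Sum>k\<in>UNIV. (W ** ctranspose W) $ j $ k * B $ l $ k) = B $ l $ j"
      by (simp add: row_def matrix_vector_mult_def)
    moreover have "(V ** ctranspose V) $ k $ j = (W ** ctranspose W) $ j $ k" for k
      by (simp add: V_def ctranspose_def matrix_matrix_mult_def mult.commute)
    ultimately show ?thesis
      by (simp add: matrix_matrix_mult_def[of B] mult.commute)
  qed
  then have "B ** V ** ctranspose V = B" by (simp add: vec_eq_iff flip: matrix_mul_assoc)
  with V W(2) show thesis by (rule that)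
qed

text \<open>\<Upsilon> multiplies \<open>A\<close> from the left, so its range finder needs a test
  space among the columns. The range of \<open>A ** V\<close> contains all columns of the part of
  \<open>A\<close> that is split off, at no cost in dimension.\<close>

lemma col_space_projector:
  fixes A :: "'a::rc_scalar^'n^'m" and V :: "'a^'k^'n"
  assumes V: "orthonormal_cols S V" and S: "card S < CARD('k)"
  obtains U :: "'a^'k^'m" and S' where "orthonormal_cols S' U" "card S' \<le> card S"
    "U ** ctranspose U ** (A ** V) = A ** V"
proof -
  have AV: "(A ** V) $ l $ j = 0" if "j \<notin> S" for l j
    using coord_proj_mult_right[of "A ** V" S l j] orthonormal_cols_mult_coord_proj(1)[OF V] that
    by (simp flip: matrix_mul_assoc)
  have "column j (A ** V) \<in> vec.span ((\<lambda>j. column j (A ** V)) ` S)" for j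
  proof (cases "j \<in> S")
    case False
    then have "column j (A ** V) = 0" by (simp add: column_def vec_eq_iff AV)
    then show ?thesis by (simp add: vec.span_zero)
  qed (simp add: vec.span_base)
  then have "columns (A ** V) \<subseteq> vec.span ((\<lambda>j. column j (A ** V)) ` S)"
    by (auto simp: columns_def)
  then have "vec.dim (columns (A ** V)) \<le> card ((\<lambda>j. column j (A ** V)) ` S)"
    by (rule vec.dim_le_card) simp
  also have "\<dots> \<le> card S" by (rule card_image_le) simp
  finally obtain U :: "'a^'k^'m" and S' where U: "orthonormal_cols S' U" "card S' \<le> card S"
    and x: "\<And>x. x \<in> columns (A ** V) \<Longrightarrow> (U ** ctranspose U) *v x = x"
    using orthonormal_cols_exist[OF _ S] by blast
  have "(U ** ctranspose U ** (A ** V)) $ l $ j = (A ** V) $ l $ j" for l j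
  proof -
    have "column j (A ** V) \<in> columns (A ** V)" by (auto simp: columns_def)
    from arg_cong[OF x[OF this], of "\<lambda>x. x $ l"] show ?thesis
      by (simp add: column_def matrix_vector_mult_def matrix_matrix_mult_def[of "U ** ctranspose U"])
  qed
  then have "U ** ctranspose U ** (A ** V) = A ** V" by (simp add: vec_eq_iff)
  with U show thesis by (rule that)
qed

lemma norm_residual_le:
  assumes "orthonormal_cols S Q"
  shows "norm (X - Q ** ctranspose Q ** X) \<le> norm (X :: 'a::rc_scalar^'n^'m)"
proof -
  have "(norm (X - Q ** ctranspose Q ** X))\<^sup>2 \<le> (norm X)\<^sup>2"
    using norm_projector_left[OF orthonormal_cols_projector(1,2)[OF assms], of X]
      zero_le_power2[of "norm (Q ** ctranspose Q ** X)"] by linarith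
  then show ?thesis by simp
qed

text \<open>Deterministic range finder bound: \<open>A ** ctranspose \<Omega>\<close> is annihilated by the projector onto the
  complement of the range of \<open>Q\<close>, so a multiple of it may be subtracted from \<open>A\<close> that removes the part
  of \<open>A\<close> with row space spanned by \<open>V\<close>.\<close>

lemma range_finder_residual:
  fixes A :: "'a::rc_scalar^'n^'m" and Q :: "'a^'k^'m" and \<Omega> :: "'a^'n^'s" and V :: "'a^'c^'n"
  assumes Q: "orthonormal_cols UNIV Q" and Y: "A ** ctranspose \<Omega> = Q ** R"
    and V: "orthonormal_cols S V" and det: "det (gram S (\<Omega> ** V)) \<noteq> 0"
  defines "A2 \<equiv> A - A ** V ** ctranspose V"
  shows "A - Q ** ctranspose Q ** A =
     (A2 - A2 ** ctranspose \<Omega> ** ctranspose (left_inv S (\<Omega> ** V)) ** ctranspose V) -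
     Q ** ctranspose Q ** (A2 - A2 ** ctranspose \<Omega> ** ctranspose (left_inv S (\<Omega> ** V)) ** ctranspose V)"
proof -
  note pQ = orthonormal_cols_projector[OF Q] and pV = orthonormal_cols_mult_coord_proj[OF V]
  define M where "M = ctranspose (left_inv S (\<Omega> ** V)) ** ctranspose V"
  have "left_inv S (\<Omega> ** V) ** (\<Omega> ** V) = coord_proj S"
    using left_inv_mult[OF det] pV(1) by (simp flip: matrix_mul_assoc)
  then have "ctranspose (left_inv S (\<Omega> ** V) ** (\<Omega> ** V)) = coord_proj S"
    by simp
  then have VL: "ctranspose V ** ctranspose \<Omega> ** ctranspose (left_inv S (\<Omega> ** V)) = coord_proj S"
    by (simp only: ctranspose_mult)
  have "A ** V ** ctranspose V ** ctranspose \<Omega> ** M =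
     A ** V ** ((ctranspose V ** ctranspose \<Omega> ** ctranspose (left_inv S (\<Omega> ** V))) ** ctranspose V)"
    by (simp add: M_def matrix_mul_assoc)
  also have "\<dots> = A ** V ** ctranspose V"
    by (simp add: VL pV)
  finally have "A2 - A2 ** ctranspose \<Omega> ** M = A - A ** ctranspose \<Omega> ** M"
    by (simp add: A2_def matrix_diff_rdistrib)
  also have "\<dots> - Q ** ctranspose Q ** (A - A ** ctranspose \<Omega> ** M) = A - Q ** ctranspose Q ** A"
    using pQ(4) by (simp add: Y matrix_diff_ldistrib matrix_mul_assoc)
  finally show ?thesis by (simp add: M_def matrix_mul_assoc)
qed

text \<open>Here \<open>P\<close> is fixed, since it does not depend on \<Omega>. It is kept in the
  leading term and estimated away in the random one, where it enters through the contraction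
  \<open>ctranspose P ** V\<close>.\<close>

lemma nn_integral_range_finder:
  fixes A :: "'a::rc_scalar^'n^'m" and P :: "'a^'p^'n" and V :: "'a^'c^'n"
    and q :: "'a^'n^'k \<Rightarrow> 'a^'k^'m"
  assumes q: "\<And>\<Omega>. orthonormal_cols UNIV (q \<Omega>)" "\<And>\<Omega>. \<exists>R. A ** ctranspose \<Omega> = q \<Omega> ** R"
    and V: "orthonormal_cols S V" and P: "orthonormal_cols UNIV P"
    and d: "DIM('a) * card S + 2 < DIM('a) * (CARD('k) + 1)" and S: "card S \<le> CARD('k)"
  defines "A2 \<equiv> A - A ** V ** ctranspose V"
  shows "(\<integral>\<^sup>+\<Omega>. ennreal ((norm ((A - q \<Omega> ** ctranspose (q \<Omega>) ** A) ** P))\<^sup>2) \<partial>gauss) \<le>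
    ennreal ((norm (A2 ** P))\<^sup>2 + proj_coef DIM('a) (card S) CARD('k) * (norm A2)\<^sup>2)"
proof -
  let ?H = "- (ctranspose P ** V)"
  have AE: "AE \<Omega> in gauss. norm ((A - q \<Omega> ** ctranspose (q \<Omega>) ** A) ** P) \<le>
       norm (ctranspose P ** ctranspose A2 + ?H ** (left_inv S (\<Omega> ** V) ** \<Omega> ** ctranspose A2))"
    using AE_gram_nonsingular[OF V S]
  proof eventually_elim
    case (elim \<Omega>)
    then have det: "det (gram S (\<Omega> ** V)) \<noteq> 0" .
    obtain R where R: "A ** ctranspose \<Omega> = q \<Omega> ** R" using q(2) by blast
    let ?Z = "A2 - A2 ** ctranspose \<Omega> ** ctranspose (left_inv S (\<Omega> ** V)) ** ctranspose V"
    have "(Z - E ** Z) ** P = Z ** P - E ** (Z ** P)" for Z and E :: "'a^'m^'m"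
      by (simp add: matrix_diff_rdistrib matrix_mul_assoc)
    then have "(A - q \<Omega> ** ctranspose (q \<Omega>) ** A) ** P = ?Z ** P - q \<Omega> ** ctranspose (q \<Omega>) ** (?Z ** P)"
      unfolding range_finder_residual[OF q(1) R V det, folded A2_def] .
    then have "norm ((A - q \<Omega> ** ctranspose (q \<Omega>) ** A) ** P) \<le> norm (?Z ** P)"
      using norm_residual_le[OF q(1)] by simp
    also have "\<dots> = norm (ctranspose P ** ctranspose A2 + ?H ** (left_inv S (\<Omega> ** V) ** \<Omega> ** ctranspose A2))"
      using norm_ctranspose[of "?Z ** P"]
      by (simp add: ctranspose_mult ctranspose_diff matrix_diff_rdistrib matrix_diff_ldistrib matrix_uminus_left matrix_mul_assoc)
    finally show ?case .
  qed
  have "(\<integral>\<^sup>+\<Omega>. ennreal ((norm ((A - q \<Omega> ** ctranspose (q \<Omega>) ** A) ** P))\<^sup>2) \<partial>gauss) \<le>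
     (\<integral>\<^sup>+\<Omega>. ennreal ((norm (ctranspose P ** ctranspose A2 + ?H ** (left_inv S ((\<Omega> :: 'a^'n^'k) ** V) ** \<Omega> ** ctranspose A2)))\<^sup>2) \<partial>gauss)"
    by (rule nn_integral_mono_AE, use AE in eventually_elim) (intro ennreal_leI power_mono norm_ge_zero)
  also have "\<dots> \<le> ennreal ((norm (ctranspose P ** ctranspose A2))\<^sup>2 + proj_coef DIM('a) (card S) CARD('k) * (norm (ctranspose A2))\<^sup>2)"
  proof (rule nn_integral_norm_add_left_inv_le[OF V _ _ d])
    show "ctranspose V ** ctranspose A2 = 0"
      using orthonormal_cols_projector(4)[OF V]
      by (simp add: A2_def matrix_diff_rdistrib flip: ctranspose_mult matrix_mul_assoc)
    show "norm (?H ** Y) \<le> norm Y" for Y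
    proof -
      have "norm (?H ** Y) = norm (ctranspose P ** (V ** Y))"
        by (simp add: matrix_uminus_left matrix_mul_assoc)
      also have "\<dots> \<le> norm (V ** Y)" by (rule norm_ctranspose_orthonormal_cols_mult_le[OF P])
      also have "\<dots> \<le> norm Y" by (rule norm_orthonormal_cols_mult_le[OF V])
      finally show ?thesis .
    qed
  qed
  also have "norm (ctranspose P ** ctranspose A2) = norm (A2 ** P)"
    by (simp flip: ctranspose_mult)
  finally show ?thesis by simp
qed

text \<open>The orthonormal families may have fewer members than the rank bound; this passes to the
  constant for the rank bound itself.\<close>

lemma proj_coef_mono:
  assumes "r \<le> r'" "d * r' + 2 < d * (s + 1)"
  shows "proj_coef d r s \<le> proj_coef d r' s"
proof -
  have "real d * real r' + 2 < real d * (real s + 1)"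
    using assms(2) unfolding of_nat_less_iff[where 'a = real, symmetric] of_nat_add of_nat_mult by simp
  moreover have "real d * real r \<le> real d * real r'"
    using assms(1) by (intro mult_left_mono) auto
  ultimately show ?thesis
    unfolding proj_coef_def by (intro frac_le) (auto simp: algebra_simps)
qed

text \<open>The range finder for the transpose, with test space \<open>U\<close>. Projecting the
  residual onto \<open>U\<close> isolates the random part, where \<open>P\<close> disappears as a
  contraction; off \<open>U\<close> only the residual of \<open>A2\<close> remains. These two pieces
  are orthogonal, so the leading term can retain \<open>P\<close> for each individual
  \<Upsilon>.\<close>

lemma range_finder_residual_norm:
  fixes A :: "'a::rc_scalar^'n^'m" and P :: "'a^'k^'n" and \<Upsilon> :: "'a^'m^'s" and V :: "'a^'c^'n" and U :: "'a^'c^'m"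
  assumes P: "orthonormal_cols UNIV P" and X: "ctranspose A ** ctranspose \<Upsilon> = P ** R"
    and V: "orthonormal_cols S V" and U: "orthonormal_cols S' U" "U ** ctranspose U ** (A ** V) = A ** V"
    and det: "det (gram S' (\<Upsilon> ** U)) \<noteq> 0"
  defines "A2 \<equiv> A - A ** V ** ctranspose V"
  defines "G \<equiv> ctranspose A2 - ctranspose A2 ** U ** ctranspose U"
  shows "(norm (A - A ** P ** ctranspose P))\<^sup>2 \<le>
     (norm (A2 - A2 ** P ** ctranspose P))\<^sup>2 + (norm (left_inv S' (\<Upsilon> ** U) ** \<Upsilon> ** ctranspose G))\<^sup>2"
proof -
  note pP = orthonormal_cols_projector[OF P] and pU = orthonormal_cols_projector[OF U(1)]
  define W where "W = G ** ctranspose \<Upsilon> ** ctranspose (left_inv S' (\<Upsilon> ** U))"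
  define Z where "Z = G - W ** ctranspose U"
  define E where "E = P ** ctranspose P"
  \<comment> \<open>The columns of \<open>A ** V ** ctranspose V\<close> lie in the range of
    \<open>U\<close>, so removing that range from \<open>A\<close> or from \<open>A2\<close> leaves
    the same matrix.\<close>
  have "ctranspose A ** U ** ctranspose U - ctranspose A2 ** U ** ctranspose U =
      ctranspose (U ** ctranspose U ** (A ** V) ** ctranspose V)"
    by (simp add: A2_def ctranspose_diff ctranspose_mult matrix_diff_rdistrib matrix_mul_assoc)
  also have "\<dots> = ctranspose A - ctranspose A2"
    by (simp add: U(2)) (simp add: A2_def ctranspose_diff)
  finally have G: "ctranspose A - ctranspose A ** U ** ctranspose U = G"
    by (simp add: G_def algebra_simps)
  have res: "ctranspose A - E ** ctranspose A = Z - E ** Z"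
    unfolding range_finder_residual[OF P X U(1) det, unfolded G, folded E_def] Z_def W_def ..
  have GU: "G ** U = 0"
    using pU(4) by (simp add: G_def matrix_diff_rdistrib flip: matrix_mul_assoc)
  have ZU: "Z ** (U ** ctranspose U) = - (W ** ctranspose U)"
  proof -
    have "Z ** (U ** ctranspose U) = G ** U ** ctranspose U - W ** (ctranspose U ** (U ** ctranspose U))"
      by (simp add: Z_def matrix_diff_rdistrib matrix_mul_assoc)
    then show ?thesis unfolding GU pU(3) by simp
  qed
  have "(Z - E ** Z) ** (U ** ctranspose U) = - (W ** ctranspose U - E ** (W ** ctranspose U))"
  proof -
    have "(Z - E ** Z) ** (U ** ctranspose U) = Z ** (U ** ctranspose U) - E ** (Z ** (U ** ctranspose U))"
      by (simp add: matrix_diff_rdistrib matrix_mul_assoc)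
    then show ?thesis unfolding ZU by (simp add: linear_neg[OF linear_matrix_mult_left])
  qed
  then have "norm ((Z - E ** Z) ** (U ** ctranspose U)) \<le> norm (W ** ctranspose U)"
    using norm_residual_le[OF P, of "W ** ctranspose U"] by (simp add: E_def norm_minus_commute)
  also have "\<dots> \<le> norm W"
    using norm_orthonormal_cols_mult_le[OF U(1), of "ctranspose W"] norm_ctranspose[of "W ** ctranspose U"]
    by (simp add: ctranspose_mult)
  also have "\<dots> = norm (left_inv S' (\<Upsilon> ** U) ** \<Upsilon> ** ctranspose G)"
    using norm_ctranspose[of W] by (simp add: W_def ctranspose_mult matrix_mul_assoc)
  finally have 1: "norm ((Z - E ** Z) ** (U ** ctranspose U)) \<le> \<dots>" .
  have Z_res: "(Z - E ** Z) - (Z - E ** Z) ** (U ** ctranspose U) = (ctranspose A2 - E ** ctranspose A2) -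
      (ctranspose A2 - E ** ctranspose A2) ** (U ** ctranspose U)"
  proof -
    have "Z - Z ** (U ** ctranspose U) = G" unfolding ZU by (simp add: Z_def)
    moreover have "(Z - E ** Z) - (Z - E ** Z) ** (U ** ctranspose U) =
        (Z - Z ** (U ** ctranspose U)) - E ** (Z - Z ** (U ** ctranspose U))"
      by (simp add: matrix_diff_rdistrib matrix_diff_ldistrib matrix_mul_assoc)
    moreover have "G - E ** G = (ctranspose A2 - E ** ctranspose A2) -
      (ctranspose A2 - E ** ctranspose A2) ** (U ** ctranspose U)"
      by (simp add: G_def matrix_diff_rdistrib matrix_diff_ldistrib matrix_mul_assoc)
    ultimately show ?thesis by simp
  qed
  have "(norm ((ctranspose A2 - E ** ctranspose A2) -
      (ctranspose A2 - E ** ctranspose A2) ** (U ** ctranspose U)))\<^sup>2 \<le> (norm (ctranspose A2 - E ** ctranspose A2))\<^sup>2"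
    using norm_projector_right[OF pU(1,2), of "ctranspose A2 - E ** ctranspose A2"]
      zero_le_power2[of "norm ((ctranspose A2 - E ** ctranspose A2) ** (U ** ctranspose U))"] by linarith
  moreover have "(norm ((Z - E ** Z) ** (U ** ctranspose U)))\<^sup>2 \<le> (norm (left_inv S' (\<Upsilon> ** U) ** \<Upsilon> ** ctranspose G))\<^sup>2"
    using 1 by (intro power_mono) auto
  ultimately have "(norm (Z - E ** Z))\<^sup>2 \<le> (norm (ctranspose A2 - E ** ctranspose A2))\<^sup>2 +
      (norm (left_inv S' (\<Upsilon> ** U) ** \<Upsilon> ** ctranspose G))\<^sup>2"
    using norm_projector_right[OF pU(1,2), of "Z - E ** Z", unfolded Z_res] by linarith
  moreover have "norm (ctranspose A2 - E ** ctranspose A2) = norm (A2 - A2 ** P ** ctranspose P)"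
    using norm_ctranspose[of "A2 - A2 ** P ** ctranspose P"]
    by (simp add: E_def ctranspose_diff ctranspose_mult matrix_mul_assoc)
  moreover have "norm (Z - E ** Z) = norm (A - A ** P ** ctranspose P)"
    unfolding res[symmetric] using norm_ctranspose[of "A - A ** P ** ctranspose P"]
    by (simp add: E_def ctranspose_diff ctranspose_mult matrix_mul_assoc)
  ultimately show ?thesis by simp
qed

text \<open>The leading terms of the two bounds are complementary projections of \<open>A2\<close>
  and share one copy of its squared norm; only the random terms are counted twice.\<close>

lemma nn_integral_two_sided_range_finder:
  fixes A B :: "'a::rc_scalar^'n^'m" and p :: "'a^'m^'k \<Rightarrow> 'a^'k^'n" and q :: "'a^'n^'k \<Rightarrow> 'a^'k^'m"
  assumes p: "\<And>\<Upsilon>. orthonormal_cols UNIV (p \<Upsilon>)" "\<And>\<Upsilon>. \<exists>R. ctranspose A ** ctranspose \<Upsilon> = p \<Upsilon> ** R"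
    and q: "\<And>\<Omega>. orthonormal_cols UNIV (q \<Omega>)" "\<And>\<Omega>. \<exists>R. A ** ctranspose \<Omega> = q \<Omega> ** R"
    and B: "rank B \<le> r" and r: "r < CARD('k)" and d: "DIM('a) * r + 2 < DIM('a) * (CARD('k) + 1)"
    and pm [measurable]: "p \<in> borel_measurable borel" and qm [measurable]: "q \<in> borel_measurable borel"
  shows "(\<integral>\<^sup>+\<Upsilon>. \<integral>\<^sup>+\<Omega>. ennreal ((norm (A - A ** p \<Upsilon> ** ctranspose (p \<Upsilon>)))\<^sup>2 +
       (norm ((A - q \<Omega> ** ctranspose (q \<Omega>) ** A) ** p \<Upsilon>))\<^sup>2) \<partial>gauss \<partial>gauss)
    \<le> ennreal ((1 + 2 * proj_coef DIM('a) r CARD('k)) * (norm (A - B))\<^sup>2)"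
proof -
  define c where "c = proj_coef DIM('a) r CARD('k)"
  obtain V :: "'a^'k^'n" and S where V: "orthonormal_cols S V" "card S \<le> r" "B ** V ** ctranspose V = B"
    using row_space_projector[OF B r] .
  obtain U :: "'a^'k^'m" and S' where U: "orthonormal_cols S' U" "card S' \<le> card S"
    "U ** ctranspose U ** (A ** V) = A ** V"
    using col_space_projector[OF V(1) le_less_trans[OF V(2) r], of A] .
  define A2 where "A2 = A - A ** V ** ctranspose V"
  define G where "G = ctranspose A2 - ctranspose A2 ** U ** ctranspose U"
  have less: "DIM('a) * t + 2 < DIM('a) * (CARD('k) + 1)" if "t \<le> r" for t
    using d mult_le_mono2[OF that, of "DIM('a)"] by linarith
  have dS: "DIM('a) * card S + 2 < DIM('a) * (CARD('k) + 1)" and dS': "DIM('a) * card S' + 2 < DIM('a) * (CARD('k) + 1)"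
    using less V(2) U(2) by auto
  have cS: "proj_coef DIM('a) (card S) CARD('k) \<le> c" "proj_coef DIM('a) (card S') CARD('k) \<le> c"
    unfolding c_def using V(2) U(2) d by (auto intro!: proj_coef_mono)
  have c0: "0 \<le> c" unfolding c_def using d by (rule proj_coef_nonneg)
  have cards: "card S \<le> CARD('k)" "card S' \<le> CARD('k)" by (simp_all add: card_mono)
  \<comment> \<open>Projecting \<open>A\<close> to the row space of \<open>B\<close> approximates at
    least as well as \<open>B\<close>, because the complementary projection annihilates
    \<open>B\<close>.\<close>
  have "(norm A2)\<^sup>2 \<le> (norm (A - B))\<^sup>2"
  proof -
    have eq: "(A - B) - (A - B) ** (V ** ctranspose V) = A2"
      using V(3) by (simp add: A2_def matrix_diff_rdistrib matrix_mul_assoc)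
    show ?thesis
      using norm_projector_right[OF orthonormal_cols_projector(1,2)[OF V(1)], of "A - B", unfolded eq]
        zero_le_power2[of "norm ((A - B) ** (V ** ctranspose V))"] by linarith
  qed
  have "(norm G)\<^sup>2 \<le> (norm A2)\<^sup>2"
  proof -
    have eq: "ctranspose A2 - ctranspose A2 ** (U ** ctranspose U) = G"
      by (simp add: G_def matrix_mul_assoc)
    show ?thesis
      using norm_projector_right[OF orthonormal_cols_projector(1,2)[OF U(1)], of "ctranspose A2", unfolded eq norm_ctranspose]
        zero_le_power2[of "norm (ctranspose A2 ** (U ** ctranspose U))"] by linarith
  qed
  let ?N = "\<lambda>\<Upsilon> :: 'a^'m^'k. left_inv S' (\<Upsilon> ** U) ** \<Upsilon> ** ctranspose G"
  have "(\<integral>\<^sup>+\<Upsilon>. \<integral>\<^sup>+\<Omega>. ennreal ((norm (A - A ** p \<Upsilon> ** ctranspose (p \<Upsilon>)))\<^sup>2 +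
       (norm ((A - q \<Omega> ** ctranspose (q \<Omega>) ** A) ** p \<Upsilon>))\<^sup>2) \<partial>gauss \<partial>gauss) \<le>
    (\<integral>\<^sup>+\<Upsilon>. ennreal ((1 + c) * (norm A2)\<^sup>2) + ennreal ((norm (?N \<Upsilon>))\<^sup>2) \<partial>gauss)"
  proof (rule nn_integral_mono_AE, use AE_gram_nonsingular[OF U(1) cards(2)] in eventually_elim)
    fix \<Upsilon> :: "'a^'m^'k" assume det: "det (gram S' (\<Upsilon> ** U)) \<noteq> 0"
    obtain R where R: "ctranspose A ** ctranspose \<Upsilon> = p \<Upsilon> ** R" using p(2) by blast
    have nA2: "(norm A2)\<^sup>2 = (norm (A2 - A2 ** p \<Upsilon> ** ctranspose (p \<Upsilon>)))\<^sup>2 + (norm (A2 ** p \<Upsilon>))\<^sup>2"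
      using norm_projector_right[OF orthonormal_cols_projector(1,2)[OF p(1)], of A2 \<Upsilon>]
        norm_mult_ctranspose_orthonormal[OF p(1), of "A2 ** p \<Upsilon>"] by (simp add: matrix_mul_assoc)
    have "(\<integral>\<^sup>+\<Omega>. ennreal ((norm (A - A ** p \<Upsilon> ** ctranspose (p \<Upsilon>)))\<^sup>2 +
       (norm ((A - q \<Omega> ** ctranspose (q \<Omega>) ** A) ** p \<Upsilon>))\<^sup>2) \<partial>gauss) =
      ennreal ((norm (A - A ** p \<Upsilon> ** ctranspose (p \<Upsilon>)))\<^sup>2) +
      (\<integral>\<^sup>+\<Omega>. ennreal ((norm ((A - q \<Omega> ** ctranspose (q \<Omega>) ** A) ** p \<Upsilon>))\<^sup>2) \<partial>gauss)"
      by (simp add: nn_integral_add)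
    also have "\<dots> \<le> ennreal ((norm (A2 - A2 ** p \<Upsilon> ** ctranspose (p \<Upsilon>)))\<^sup>2 + (norm (?N \<Upsilon>))\<^sup>2) +
       ennreal ((norm (A2 ** p \<Upsilon>))\<^sup>2 + proj_coef DIM('a) (card S) CARD('k) * (norm A2)\<^sup>2)"
      unfolding A2_def G_def
      by (intro add_mono ennreal_leI range_finder_residual_norm[OF p(1) R V(1) U(1,3) det]
          nn_integral_range_finder[OF q V(1) p(1) dS cards(1)])
    also have "\<dots> = ennreal ((norm A2)\<^sup>2 + proj_coef DIM('a) (card S) CARD('k) * (norm A2)\<^sup>2 + (norm (?N \<Upsilon>))\<^sup>2)"
      using proj_coef_nonneg[OF dS] unfolding nA2 by (subst ennreal_plus[symmetric]) (auto simp: algebra_simps)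
    also have "\<dots> \<le> ennreal ((1 + c) * (norm A2)\<^sup>2 + (norm (?N \<Upsilon>))\<^sup>2)"
      using mult_right_mono[OF cS(1), of "(norm A2)\<^sup>2"] by (intro ennreal_leI) (simp add: distrib_right)
    also have "\<dots> = ennreal ((1 + c) * (norm A2)\<^sup>2) + ennreal ((norm (?N \<Upsilon>))\<^sup>2)"
      using c0 by (intro ennreal_plus) auto
    finally show "(\<integral>\<^sup>+\<Omega>. ennreal ((norm (A - A ** p \<Upsilon> ** ctranspose (p \<Upsilon>)))\<^sup>2 +
       (norm ((A - q \<Omega> ** ctranspose (q \<Omega>) ** A) ** p \<Upsilon>))\<^sup>2) \<partial>gauss) \<le> \<dots>" .
  qed
  also have "\<dots> = ennreal ((1 + c) * (norm A2)\<^sup>2) + (\<integral>\<^sup>+\<Upsilon>. ennreal ((norm (0 + (mat 1 :: 'a^'k^'k) ** ?N \<Upsilon>))\<^sup>2) \<partial>gauss)"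
    by (simp add: nn_integral_add)
  also have "\<dots> \<le> ennreal ((1 + c) * (norm A2)\<^sup>2) +
      ennreal ((norm (0 :: 'a^'n^'k))\<^sup>2 + proj_coef DIM('a) (card S') CARD('k) * (norm (ctranspose G))\<^sup>2)"
  proof (intro add_left_mono nn_integral_norm_add_left_inv_le[OF U(1) _ _ dS'])
    show "ctranspose U ** ctranspose G = 0"
      using orthonormal_cols_projector(4)[OF U(1)]
      by (simp add: G_def matrix_diff_rdistrib flip: ctranspose_mult matrix_mul_assoc)
  qed simp
  also have "\<dots> \<le> ennreal ((1 + c) * (norm A2)\<^sup>2) + ennreal (c * (norm A2)\<^sup>2)"
    using cS(2) c0 \<open>(norm G)\<^sup>2 \<le> (norm A2)\<^sup>2\<close>
    by (intro add_left_mono ennreal_leI) (auto intro: mult_mono)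
  also have "\<dots> = ennreal ((1 + 2 * c) * (norm A2)\<^sup>2)"
    using c0 by (subst ennreal_plus[symmetric]) (auto simp: algebra_simps)
  also have "\<dots> \<le> ennreal ((1 + 2 * c) * (norm (A - B))\<^sup>2)"
    using c0 \<open>(norm A2)\<^sup>2 \<le> (norm (A - B))\<^sup>2\<close> by (intro ennreal_leI mult_left_mono) auto
  finally show ?thesis by (simp add: c_def)
qed

subsection \<open>Random matrices\<close>

lemma mem_box_vec: "x \<in> box l u \<longleftrightarrow> (\<forall>i. x $ i \<in> box (l $ i) (u $ i))" for x :: "'a::euclidean_space^'n"
  by (auto simp: mem_box Basis_vec_def inner_axis)

lemma prod_Basis_vec:
  "(\<Prod>b\<in>(Basis :: ('a::euclidean_space^'n) set). f b) = (\<Prod>i\<in>UNIV. \<Prod>e\<in>Basis. f (axis i e))"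
proof -
  have "(\<Prod>b\<in>(Basis :: ('a^'n) set). f b) = (\<Prod>i\<in>UNIV. \<Prod>b\<in>axis i ` Basis. f b)"
    unfolding Basis_vec_def UNION_singleton_eq_range
    by (subst prod.UNION_disjoint) (auto simp: axis_eq_axis)
  also have "\<dots> = (\<Prod>i\<in>UNIV. \<Prod>e\<in>Basis. f (axis i e))"
    by (intro prod.cong refl prod.reindex[THEN trans]) (auto simp: inj_on_def axis_eq_axis)
  finally show ?thesis .
qed

lemma emeasure_gauss_box:
  fixes l u :: "'a::euclidean_space"
  shows "emeasure gauss (box l u) = (\<Prod>b\<in>Basis. emeasure (density lborel (\<lambda>x. ennreal (std_normal_density x))) {l \<bullet> b<..<u \<bullet> b})"
proof -
  have ind: "indicator (box l u) x = (\<Prod>b\<in>Basis. indicator {l \<bullet> b<..<u \<bullet> b} (x \<bullet> b) :: ennreal)" for x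
  proof (cases "x \<in> box l u")
    case True
    then show ?thesis by (simp add: mem_box)
  next
    case False
    then obtain b where "b \<in> Basis" "x \<bullet> b \<notin> {l \<bullet> b<..<u \<bullet> b}" by (auto simp: mem_box)
    then have "(\<Prod>b\<in>Basis. indicator {l \<bullet> b<..<u \<bullet> b} (x \<bullet> b)) = (0 :: ennreal)"
      by (intro prod_zero finite_Basis bexI[of _ b]) (simp_all add: indicator_def)
    with False show ?thesis by simp
  qed
  have "emeasure gauss (box l u) = (\<integral>\<^sup>+x. indicator (box l u) x \<partial>gauss)"
    by simp
  also have "\<dots> = (\<integral>\<^sup>+x. (\<Prod>b\<in>Basis. indicator {l \<bullet> b<..<u \<bullet> b} (x \<bullet> b)) \<partial>gauss)"
    by (simp only: ind)
  also have "\<dots> = (\<Prod>b\<in>(Basis :: 'a set). \<integral>\<^sup>+x. ennreal (std_normal_density x) * indicator {l \<bullet> b<..<u \<bullet> b} x \<partial>lborel)"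
    by (rule nn_integral_gauss_prod_coords) simp
  finally show ?thesis by (simp add: emeasure_density)
qed

lemma emeasure_gauss_box_vec:
  "emeasure gauss (box l u) = (\<Prod>i\<in>UNIV. emeasure gauss (box (l $ i) (u $ i)))" for l u :: "'a::euclidean_space^'n"
  by (simp add: emeasure_gauss_box prod_Basis_vec inner_axis)

text \<open>Open boxes generate the Borel sets and are closed under intersection; on them
  independence is a product formula.\<close>

lemma gauss_eqI:
  fixes M :: "'a::euclidean_space measure"
  assumes sets: "sets M = sets borel" and box: "\<And>l u. emeasure M (box l u) = emeasure gauss (box l u)"
  shows "M = gauss"
proof (rule sym, rule measure_eqI_generator_eq)
  let ?E = "range (\<lambda>(a, b). box a b::'a set)"
  show "Int_stable ?E"
    by (auto simp: Int_stable_def box_Int_box)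
  show "?E \<subseteq> Pow UNIV" "sets gauss = sigma_sets UNIV ?E" "sets M = sigma_sets UNIV ?E"
    by (simp_all add: borel_eq_box sets)
  let ?A = "\<lambda>n::nat. box (- (real n *\<^sub>R One)) (real n *\<^sub>R One) :: 'a set"
  show "range ?A \<subseteq> ?E" "(\<Union>i. ?A i) = UNIV"
    unfolding UN_box_eq_UNIV by auto
  show "emeasure gauss (?A i) \<noteq> \<infinity>" for i by simp
  show "emeasure gauss X = emeasure M X" if "X \<in> ?E" for X
    using that box by auto
qed

lemma box_Pair: "box (a, b) (c, d) = box a c \<times> box b d"
  for a c :: "'x::euclidean_space" and b d :: "'y::euclidean_space"
  by (auto simp: mem_box Basis_prod_def ball_Un)

lemma emeasure_gauss_Times:
  fixes A :: "'x::euclidean_space set" and B :: "'y::euclidean_space set"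
  assumes "A \<in> sets borel" "B \<in> sets borel"
  shows "emeasure gauss (A \<times> B) = emeasure gauss A * emeasure gauss B"
  unfolding gauss_prod using assms by (subst gauss.emeasure_pair_measure_Times) auto

section \<open>Laws of the random matrices\<close>

context prob_space
begin

lemma emeasure_box_indep:
  fixes X :: "'i::finite \<Rightarrow> 'a \<Rightarrow> 'b::euclidean_space"
  assumes "indep_vars (\<lambda>_. borel) X UNIV"
  shows "emeasure M {\<omega> \<in> space M. \<forall>i. X i \<omega> \<in> box (l i) (u i)} =
    (\<Prod>i\<in>UNIV. emeasure (distr M borel (X i)) (box (l i) (u i)))"
proof -
  have [measurable]: "random_variable borel (X i)" for i
    using assms by (simp add: indep_vars_def)
  have "{\<omega> \<in> space M. \<forall>i. X i \<omega> \<in> box (l i) (u i)} = (\<Inter>i. X i -` box (l i) (u i) \<inter> space M)"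
    by auto
  then have "emeasure M {\<omega> \<in> space M. \<forall>i. X i \<omega> \<in> box (l i) (u i)} =
      ennreal (prob (\<Inter>i. X i -` box (l i) (u i) \<inter> space M))"
    by (simp add: emeasure_eq_measure)
  also have "prob (\<Inter>i. X i -` box (l i) (u i) \<inter> space M) = (\<Prod>i\<in>UNIV. prob (X i -` box (l i) (u i) \<inter> space M))"
    by (rule indep_varsD[OF assms]) auto
  also have "ennreal \<dots> = (\<Prod>i\<in>UNIV. emeasure (distr M borel (X i)) (box (l i) (u i)))"
    by (simp add: prod_ennreal emeasure_distr emeasure_eq_measure)
  finally show ?thesis .
qed

lemma std_normal_scalar_distr:
  fixes g :: "'a \<Rightarrow> 'b::euclidean_space"
  assumes "std_normal_scalar g"
  shows "random_variable borel g" "distr M borel g = gauss"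
proof -
  have indep: "indep_vars (\<lambda>_. borel) (\<lambda>b \<omega>. g \<omega> \<bullet> b) Basis"
    and d: "\<And>b. b \<in> Basis \<Longrightarrow> distributed M lborel (\<lambda>\<omega>. g \<omega> \<bullet> b) (\<lambda>x. ennreal (std_normal_density x))"
    using assms by (auto simp: std_normal_scalar_def)
  have gb [measurable]: "random_variable borel (\<lambda>\<omega>. g \<omega> \<bullet> b)" if "b \<in> Basis" for b
    using indep that by (simp add: indep_vars_def)
  then show g [measurable]: "random_variable borel g"
    by (subst borel_measurable_euclidean_space) simp
  show "distr M borel g = gauss"
  proof (rule gauss_eqI)
    fix l u :: 'b
    let ?I = "\<lambda>b. {l \<bullet> b<..<u \<bullet> b}"
    have "emeasure (distr M borel g) (box l u) = emeasure M (g -` box l u \<inter> space M)"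
      by (rule emeasure_distr) auto
    also have "g -` box l u \<inter> space M = (\<Inter>b\<in>Basis. (\<lambda>\<omega>. g \<omega> \<bullet> b) -` ?I b \<inter> space M)"
      by (auto simp: mem_box)
    also have "emeasure M \<dots> = ennreal (prob (\<Inter>b\<in>Basis. (\<lambda>\<omega>. g \<omega> \<bullet> b) -` ?I b \<inter> space M))"
      by (rule emeasure_eq_measure)
    also have "prob (\<Inter>b\<in>Basis. (\<lambda>\<omega>. g \<omega> \<bullet> b) -` ?I b \<inter> space M) = (\<Prod>b\<in>Basis. prob ((\<lambda>\<omega>. g \<omega> \<bullet> b) -` ?I b \<inter> space M))"
      by (rule indep_varsD[OF indep]) auto
    also have "ennreal \<dots> = (\<Prod>b\<in>Basis. emeasure (distr M lborel (\<lambda>\<omega>. g \<omega> \<bullet> b)) (?I b))"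
      by (simp add: prod_ennreal emeasure_distr emeasure_eq_measure flip: prod_ennreal)
    also have "\<dots> = (\<Prod>b\<in>Basis. emeasure (density lborel (\<lambda>x. ennreal (std_normal_density x))) (?I b))"
      using d by (intro prod.cong) (auto simp: distributed_def)
    finally show "emeasure (distr M borel g) (box l u) = emeasure gauss (box l u)"
      by (simp add: emeasure_gauss_box)
  qed simp
qed

lemma std_normal_matrix_distr:
  fixes G :: "'a \<Rightarrow> 'b::euclidean_space^'c^'r"
  assumes "std_normal_matrix G"
  shows "random_variable borel G" "distr M borel G = gauss"
proof -
  let ?X = "\<lambda>(i, j) \<omega>. G \<omega> $ i $ j"
  have indep: "indep_vars (\<lambda>_. borel) ?X UNIV" and s: "\<And>i j. std_normal_scalar (\<lambda>\<omega>. G \<omega> $ i $ j)"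
    using assms by (auto simp: std_normal_matrix_def)
  note [measurable] = std_normal_scalar_distr(1)[OF s]
  have "random_variable borel (\<lambda>\<omega>. \<chi> i j. G \<omega> $ i $ j)" by measurable
  then show [measurable]: "random_variable borel G" by simp
  show "distr M borel G = gauss"
  proof (rule gauss_eqI)
    fix l u :: "'b^'c^'r"
    have "emeasure (distr M borel G) (box l u) =
       emeasure M {\<omega> \<in> space M. \<forall>ij. ?X ij \<omega> \<in> box ((\<lambda>(i, j). l $ i $ j) ij) ((\<lambda>(i, j). u $ i $ j) ij)}"
      by (subst emeasure_distr) (auto simp: mem_box_vec intro!: arg_cong[where f="emeasure M"])
    also have "\<dots> = (\<Prod>ij\<in>UNIV. emeasure (distr M borel (?X ij)) (box ((\<lambda>(i, j). l $ i $ j) ij) ((\<lambda>(i, j). u $ i $ j) ij)))"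
      by (rule emeasure_box_indep[OF indep])
    also have "\<dots> = (\<Prod>i\<in>UNIV. \<Prod>j\<in>UNIV. emeasure gauss (box (l $ i $ j) (u $ i $ j)))"
      by (simp add: prod.cartesian_product std_normal_scalar_distr(2)[OF s] case_prod_unfold)
    finally show "emeasure (distr M borel G) (box l u) = emeasure gauss (box l u)"
      by (simp add: emeasure_gauss_box_vec)
  qed simp
qed

lemma indep_vars4_distr:
  fixes X1 :: "'a \<Rightarrow> 'b::euclidean_space" and X2 :: "'a \<Rightarrow> 'c::euclidean_space"
    and X3 :: "'a \<Rightarrow> 'd::euclidean_space" and X4 :: "'a \<Rightarrow> 'e::euclidean_space"
  assumes indep: "indep_vars4 X1 X2 X3 X4"
    and m [measurable]: "random_variable borel X1" "random_variable borel X2" "random_variable borel X3" "random_variable borel X4"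
    and d: "distr M borel X1 = gauss" "distr M borel X2 = gauss" "distr M borel X3 = gauss" "distr M borel X4 = gauss"
  shows "distr M borel (\<lambda>\<omega>. (X1 \<omega>, X2 \<omega>, X3 \<omega>, X4 \<omega>)) = gauss"
proof (rule gauss_eqI)
  fix l u :: "'b \<times> 'c \<times> 'd \<times> 'e"
  obtain l1 l2 l3 l4 u1 u2 u3 u4 where lu: "l = (l1, l2, l3, l4)" "u = (u1, u2, u3, u4)"
    by (metis prod.exhaust)
  let ?A = "\<lambda>i. [X1 -` box l1 u1 \<inter> space M, X2 -` box l2 u2 \<inter> space M, X3 -` box l3 u3 \<inter> space M, X4 -` box l4 u4 \<inter> space M] ! i"
  have I: "{..<4::nat} = {0, 1, 2, 3}" by auto
  have e: "emeasure gauss (box l1 u1) = ennreal (prob (?A 0))" "emeasure gauss (box l2 u2) = ennreal (prob (?A 1))"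
    "emeasure gauss (box l3 u3) = ennreal (prob (?A 2))" "emeasure gauss (box l4 u4) = ennreal (prob (?A 3))"
    unfolding d(1)[symmetric] by (simp add: emeasure_distr emeasure_eq_measure)
      (simp_all add: emeasure_distr emeasure_eq_measure flip: d(2) d(3) d(4))
  have "(\<lambda>\<omega>. (X1 \<omega>, X2 \<omega>, X3 \<omega>, X4 \<omega>)) -` box l u \<inter> space M = (\<Inter>i\<in>{..<4}. ?A i)"
    unfolding I by (auto simp: lu box_Pair)
  then have "emeasure (distr M borel (\<lambda>\<omega>. (X1 \<omega>, X2 \<omega>, X3 \<omega>, X4 \<omega>))) (box l u) = ennreal (prob (\<Inter>i\<in>{..<4}. ?A i))"
    by (subst emeasure_distr) (auto simp: emeasure_eq_measure borel_measurable_Pair)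
  also have "prob (\<Inter>i\<in>{..<4}. ?A i) = (\<Prod>i\<in>{..<4}. prob (?A i))"
    by (rule indep_setsD[OF indep[unfolded indep_vars4_def]]) (auto simp: I rv_events_def)
  also have "ennreal \<dots> = emeasure gauss (box l u)"
    by (simp add: I lu box_Pair emeasure_gauss_Times borel_Times e ennreal_mult' mult.assoc)
  finally show "emeasure (distr M borel (\<lambda>\<omega>. (X1 \<omega>, X2 \<omega>, X3 \<omega>, X4 \<omega>))) (box l u) = emeasure gauss (box l u)" .
qed simp

text \<open>Leaves the probability space for iterated integrals. In the application \<Upsilon> and
  \<Omega> are outermost, so that \<open>P\<close> and \<open>Q\<close> are constants while \<Phi>
  and \<Psi> are integrated.\<close>

lemma nn_integral_indep_gauss4:
  fixes X1 :: "'a \<Rightarrow> 'b::euclidean_space" and X2 :: "'a \<Rightarrow> 'c::euclidean_space"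
    and X3 :: "'a \<Rightarrow> 'd::euclidean_space" and X4 :: "'a \<Rightarrow> 'e::euclidean_space"
  assumes indep: "indep_vars4 X1 X2 X3 X4"
    and m [measurable]: "random_variable borel X1" "random_variable borel X2" "random_variable borel X3" "random_variable borel X4"
    and d: "distr M borel X1 = gauss" "distr M borel X2 = gauss" "distr M borel X3 = gauss" "distr M borel X4 = gauss"
    and f: "f \<in> borel_measurable borel"
  shows "(\<integral>\<^sup>+\<omega>. f (X1 \<omega>, X2 \<omega>, X3 \<omega>, X4 \<omega>) \<partial>M) =
    (\<integral>\<^sup>+x1. \<integral>\<^sup>+x2. \<integral>\<^sup>+x3. \<integral>\<^sup>+x4. f (x1, x2, x3, x4) \<partial>gauss \<partial>gauss \<partial>gauss \<partial>gauss)"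
proof -
  have [measurable]: "random_variable borel (\<lambda>\<omega>. (X1 \<omega>, X2 \<omega>, X3 \<omega>, X4 \<omega>))"
    by (intro borel_measurable_Pair m)
  have 1: "(\<lambda>y. f (x, y)) \<in> borel_measurable borel" for x
    by (rule measurable_compose[OF _ f]) (intro borel_measurable_Pair; simp)
  have 2: "(\<lambda>z. f (x, y, z)) \<in> borel_measurable borel" for x y
    by (rule measurable_compose[OF _ f]) (intro borel_measurable_Pair; simp)
  have "(\<integral>\<^sup>+\<omega>. f (X1 \<omega>, X2 \<omega>, X3 \<omega>, X4 \<omega>) \<partial>M) = (\<integral>\<^sup>+z. f z \<partial>distr M borel (\<lambda>\<omega>. (X1 \<omega>, X2 \<omega>, X3 \<omega>, X4 \<omega>)))"
    by (rule nn_integral_distr[symmetric]) (use f in simp_all)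
  also have "\<dots> = (\<integral>\<^sup>+z. f z \<partial>gauss)"
    unfolding indep_vars4_distr[OF indep m d] ..
  also have "\<dots> = (\<integral>\<^sup>+x1. \<integral>\<^sup>+x2. \<integral>\<^sup>+x3. \<integral>\<^sup>+x4. f (x1, x2, x3, x4) \<partial>gauss \<partial>gauss \<partial>gauss \<partial>gauss)"
    by (simp add: nn_integral_gauss_Pair[OF f] nn_integral_gauss_Pair[OF 1] nn_integral_gauss_Pair[OF 2])
  finally show ?thesis .
qed

section \<open>The error of the sketch against low-rank competitors\<close>

lemma nn_integral_initial_approx_le:
  fixes A B :: "'f::rc_scalar^'n^'m" and \<Upsilon> :: "'a \<Rightarrow> 'f^'m^'k::{finite,linorder}" and \<Omega> :: "'a \<Rightarrow> 'f^'n^'k::_"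
    and \<Phi> :: "'a \<Rightarrow> 'f^'m^'s" and \<Psi> :: "'a \<Rightarrow> 'f^'n^'s"
  assumes normal: "std_normal_matrix \<Upsilon>" "std_normal_matrix \<Omega>" "std_normal_matrix \<Phi>" "std_normal_matrix \<Psi>"
    and indep: "indep_vars4 \<Upsilon> \<Omega> \<Phi> \<Psi>"
    and qr: "thin_qr_procedure qr1" "thin_qr_procedure qr2"
    and dk: "DIM('f) * CARD('k) + 2 < DIM('f) * (CARD('s) + 1)" and ks: "CARD('k) \<le> CARD('s)"
    and c1: "proj_coef DIM('f) CARD('k) CARD('s) \<le> 1"
    and B: "rank B \<le> r" and r: "r < CARD('k)" and dr: "DIM('f) * r + 2 < DIM('f) * (CARD('k) + 1)"
  shows "(\<integral>\<^sup>+\<omega>. ennreal ((norm (A - initial_approx qr1 qr2 (\<Phi> \<omega>) (\<Psi> \<omega>)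
        (\<Upsilon> \<omega> ** A) (A ** ctranspose (\<Omega> \<omega>)) (\<Phi> \<omega> ** A ** ctranspose (\<Psi> \<omega>))))\<^sup>2) \<partial>M)
    \<le> ennreal ((1 + proj_coef DIM('f) CARD('k) CARD('s)) * ((1 + 2 * proj_coef DIM('f) r CARD('k)) * (norm (A - B))\<^sup>2))"
proof -
  define p where "p U = qr1 (ctranspose (U ** A))" for U :: "'f^'m^'k::_"
  define q where "q W = qr2 (A ** ctranspose W)" for W :: "'f^'n^'k::_"
  define c where "c = proj_coef DIM('f) CARD('k) CARD('s)"
  have c0: "0 \<le> c" unfolding c_def using dk by (rule proj_coef_nonneg)
  have [measurable]: "qr1 \<in> borel_measurable borel" "qr2 \<in> borel_measurable borel"
    using qr by (auto simp: thin_qr_procedure_def)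
  have pm [measurable]: "p \<in> borel_measurable borel" and qm [measurable]: "q \<in> borel_measurable borel"
    unfolding p_def q_def by measurable
  have p: "orthonormal_cols UNIV (p U)" "\<exists>R. ctranspose A ** ctranspose U = p U ** R" for U
    using qr(1) unfolding thin_qr_procedure_def orthonormal_cols_UNIV_iff p_def ctranspose_mult by blast+
  have q: "orthonormal_cols UNIV (q W)" "\<exists>R. A ** ctranspose W = q W ** R" for W
    using qr(2) unfolding thin_qr_procedure_def orthonormal_cols_UNIV_iff q_def by blast+
  define f where "f = (\<lambda>(U, W, F, G). ennreal ((norm (A - q W ** (left_inv UNIV ((F :: 'f^'m^'s) ** q W) ** (F ** A ** ctranspose G)
       ** ctranspose (left_inv UNIV ((G :: 'f^'n^'s) ** p U))) ** ctranspose (p U)))\<^sup>2))"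
  \<comment> \<open>The indicator of the event that one of the two Gram matrices is singular. Being
    a measurable function of all four matrices, it goes through the same transfer formula as the
    error, which shows that the event is null.\<close>
  define g where "g = (\<lambda>(U, W, F, G). if det (gram UNIV ((F :: 'f^'m^'s) ** q W)) = 0 \<or>
       det (gram UNIV ((G :: 'f^'n^'s) ** p U)) = 0 then 1 else 0 :: ennreal)"
  have f: "f \<in> borel_measurable borel"
    unfolding f_def case_prod_unfold by (simp only: borel_prod[symmetric]) measurable
  have [measurable]: "(\<lambda>z. det (gram UNIV (h z :: 'f^'k::_^'s))) \<in> borel_measurable N"
    if [measurable]: "h \<in> borel_measurable N" for h and N :: "'z measure"
    by (intro borel_measurable_det) measurable
  have g: "g \<in> borel_measurable borel"
    unfolding g_def case_prod_unfold by (simp only: borel_prod[symmetric]) measurable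
  note normal_distr = normal[THEN std_normal_matrix_distr(1)] normal[THEN std_normal_matrix_distr(2)]
  note transfer = nn_integral_indep_gauss4[OF indep normal_distr]
  have "(\<integral>\<^sup>+\<omega>. g (\<Upsilon> \<omega>, \<Omega> \<omega>, \<Phi> \<omega>, \<Psi> \<omega>) \<partial>M) =
     (\<integral>\<^sup>+U. \<integral>\<^sup>+W. \<integral>\<^sup>+F. \<integral>\<^sup>+G. g (U, W, F, G) \<partial>gauss \<partial>gauss \<partial>gauss \<partial>gauss)"
    by (rule transfer[OF g])
  also have "\<dots> = 0"
  proof -
    have "(\<integral>\<^sup>+F. \<integral>\<^sup>+G. g (U, W, F, G) \<partial>gauss \<partial>gauss) = (\<integral>\<^sup>+F. 0 \<partial>(gauss :: ('f^'m^'s) measure))" for U W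
    proof (rule nn_integral_cong_AE, use AE_gram_nonsingular[OF q(1) ks] in eventually_elim)
      fix F :: "'f^'m^'s" assume F: "det (gram UNIV (F ** q W)) \<noteq> 0"
      have "(\<integral>\<^sup>+G. g (U, W, F, G) \<partial>gauss) = (\<integral>\<^sup>+G. 0 \<partial>(gauss :: ('f^'n^'s) measure))"
        by (rule nn_integral_cong_AE, use AE_gram_nonsingular[OF p(1) ks] in eventually_elim) (use F in \<open>simp add: g_def\<close>)
      then show "(\<integral>\<^sup>+G. g (U, W, F, G) \<partial>gauss) = 0" by simp
    qed
    then show ?thesis by simp
  qed
  finally have g0: "(\<integral>\<^sup>+\<omega>. g (\<Upsilon> \<omega>, \<Omega> \<omega>, \<Phi> \<omega>, \<Psi> \<omega>) \<partial>M) = 0" .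
  have "(\<lambda>\<omega>. g (\<Upsilon> \<omega>, \<Omega> \<omega>, \<Phi> \<omega>, \<Psi> \<omega>)) \<in> borel_measurable M"
    by (rule measurable_compose[OF _ g]) (intro borel_measurable_Pair normal_distr)
  with g0 have AE: "AE \<omega> in M. g (\<Upsilon> \<omega>, \<Omega> \<omega>, \<Phi> \<omega>, \<Psi> \<omega>) = 0"
    by (simp add: nn_integral_0_iff_AE)
  \<comment> \<open>Off the null event the pseudoinverses are left inverses, so the error agrees
    almost everywhere with the measurable function \<open>f\<close> of the four matrices.\<close>
  have "(\<integral>\<^sup>+\<omega>. ennreal ((norm (A - initial_approx qr1 qr2 (\<Phi> \<omega>) (\<Psi> \<omega>)
        (\<Upsilon> \<omega> ** A) (A ** ctranspose (\<Omega> \<omega>)) (\<Phi> \<omega> ** A ** ctranspose (\<Psi> \<omega>))))\<^sup>2) \<partial>M) =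
     (\<integral>\<^sup>+\<omega>. f (\<Upsilon> \<omega>, \<Omega> \<omega>, \<Phi> \<omega>, \<Psi> \<omega>) \<partial>M)"
  proof (rule nn_integral_cong_AE, use AE in eventually_elim)
    fix \<omega> assume "g (\<Upsilon> \<omega>, \<Omega> \<omega>, \<Phi> \<omega>, \<Psi> \<omega>) = 0"
    then have "det (gram UNIV (\<Phi> \<omega> ** q (\<Omega> \<omega>))) \<noteq> 0" "det (gram UNIV (\<Psi> \<omega> ** p (\<Upsilon> \<omega>))) \<noteq> 0"
      by (auto simp: g_def split: if_splits)
    then show "ennreal ((norm (A - initial_approx qr1 qr2 (\<Phi> \<omega>) (\<Psi> \<omega>)
        (\<Upsilon> \<omega> ** A) (A ** ctranspose (\<Omega> \<omega>)) (\<Phi> \<omega> ** A ** ctranspose (\<Psi> \<omega>))))\<^sup>2) = f (\<Upsilon> \<omega>, \<Omega> \<omega>, \<Phi> \<omega>, \<Psi> \<omega>)"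
      by (simp add: f_def initial_approx_def Let_def pseudoinverse_eq_left_inv flip: p_def q_def)
  qed
  also have "\<dots> = (\<integral>\<^sup>+U. \<integral>\<^sup>+W. \<integral>\<^sup>+F. \<integral>\<^sup>+G. f (U, W, F, G) \<partial>gauss \<partial>gauss \<partial>gauss \<partial>gauss)"
    by (rule transfer[OF f])
  also have "\<dots> \<le> (\<integral>\<^sup>+U. \<integral>\<^sup>+W. ennreal ((1 + c) * ((norm (A - A ** p U ** ctranspose (p U)))\<^sup>2 +
       (norm ((A - q W ** ctranspose (q W) ** A) ** p U))\<^sup>2)) \<partial>gauss \<partial>gauss)"
    unfolding f_def c_def prod.case
    by (intro nn_integral_mono nn_integral_core q(1) p(1) dk ks c1)
  also have "\<dots> = ennreal (1 + c) * (\<integral>\<^sup>+U. \<integral>\<^sup>+W. ennreal ((norm (A - A ** p U ** ctranspose (p U)))\<^sup>2 +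
       (norm ((A - q W ** ctranspose (q W) ** A) ** p U))\<^sup>2) \<partial>gauss \<partial>gauss)"
    using c0 by (simp add: ennreal_mult' nn_integral_cmult del: ennreal_plus)
  also have "\<dots> \<le> ennreal (1 + c) * ennreal ((1 + 2 * proj_coef DIM('f) r CARD('k)) * (norm (A - B))\<^sup>2)"
    by (intro mult_left_mono nn_integral_two_sided_range_finder p q B r dr pm qm) simp
  also have "\<dots> = ennreal ((1 + c) * ((1 + 2 * proj_coef DIM('f) r CARD('k)) * (norm (A - B))\<^sup>2))"
    using c0 by (simp add: ennreal_mult')
  finally show ?thesis by (simp add: c_def)
qed

lemma nn_integral_initial_approx_le_tail_energy:
  fixes A :: "'f::rc_scalar^'n^'m" and \<Upsilon> :: "'a \<Rightarrow> 'f^'m^'k::{finite,linorder}" and \<Omega> :: "'a \<Rightarrow> 'f^'n^'k::_"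
    and \<Phi> :: "'a \<Rightarrow> 'f^'m^'s" and \<Psi> :: "'a \<Rightarrow> 'f^'n^'s"
  assumes normal: "std_normal_matrix \<Upsilon>" "std_normal_matrix \<Omega>" "std_normal_matrix \<Phi>" "std_normal_matrix \<Psi>"
    and indep: "indep_vars4 \<Upsilon> \<Omega> \<Phi> \<Psi>"
    and qr: "thin_qr_procedure qr1" "thin_qr_procedure qr2"
    and dk: "DIM('f) * CARD('k) + 2 < DIM('f) * (CARD('s) + 1)" and ks: "CARD('k) \<le> CARD('s)"
    and c1: "proj_coef DIM('f) CARD('k) CARD('s) \<le> 1"
    and r: "r < CARD('k)" and dr: "DIM('f) * r + 2 < DIM('f) * (CARD('k) + 1)"
  shows "(\<integral>\<^sup>+\<omega>. ennreal ((norm (A - initial_approx qr1 qr2 (\<Phi> \<omega>) (\<Psi> \<omega>)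
        (\<Upsilon> \<omega> ** A) (A ** ctranspose (\<Omega> \<omega>)) (\<Phi> \<omega> ** A ** ctranspose (\<Psi> \<omega>))))\<^sup>2) \<partial>M)
    \<le> ennreal (1 + proj_coef DIM('f) CARD('k) CARD('s)) *
       ennreal ((1 + 2 * proj_coef DIM('f) r CARD('k)) * tail_energy r A)"
proof -
  define C where "C = (1 + proj_coef DIM('f) CARD('k) CARD('s)) * (1 + 2 * proj_coef DIM('f) r CARD('k))"
  let ?I = "\<integral>\<^sup>+\<omega>. ennreal ((norm (A - initial_approx qr1 qr2 (\<Phi> \<omega>) (\<Psi> \<omega>)
        (\<Upsilon> \<omega> ** A) (A ** ctranspose (\<Omega> \<omega>)) (\<Phi> \<omega> ** A ** ctranspose (\<Psi> \<omega>))))\<^sup>2) \<partial>M"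
  have c0: "0 \<le> proj_coef DIM('f) CARD('k) CARD('s)" "0 \<le> proj_coef DIM('f) r CARD('k)"
    using proj_coef_nonneg[OF dk] proj_coef_nonneg[OF dr] .
  then have C: "C > 0" by (simp add: C_def add_pos_nonneg)
  have le: "?I \<le> ennreal (C * (norm (A - B))\<^sup>2)" if "rank B \<le> r" for B
    using nn_integral_initial_approx_le[OF normal indep qr dk ks c1 that r dr]
    by (simp add: C_def mult.assoc)
  have rank0: "rank (0 :: 'f^'n^'m) \<le> r"
  proof -
    have "rows (0 :: 'f^'n^'m) \<subseteq> {0}" by (auto simp: rows_def row_def vec_eq_iff)
    then have "vec.dim (rows (0 :: 'f^'n^'m)) = 0" by (simp only: vec.dim_eq_0)
    then show ?thesis unfolding row_rank_def_gen by linarith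
  qed
  \<comment> \<open>The competitor \<open>B = 0\<close> shows that the integral is finite, so it is
    a real number \<open>e\<close> and can be compared with the real infimum.\<close>
  have "?I < top" using le[OF rank0] ennreal_less_top le_less_trans by blast
  then obtain e where e: "?I = ennreal e" "e \<ge> 0" by (cases ?I) auto
  have "e / C \<le> (norm (A - B))\<^sup>2" if "rank B \<le> r" for B
    using le[OF that] C unfolding e(1) by (subst (asm) ennreal_le_iff) (auto simp: field_simps)
  then have "e / C \<le> tail_energy r A"
    unfolding tail_energy_def using rank0 by (intro cINF_greatest) auto
  then have "?I \<le> ennreal (C * tail_energy r A)"
    using C unfolding e(1) by (intro ennreal_leI) (simp add: field_simps)
  also have "\<dots> = ennreal (1 + proj_coef DIM('f) CARD('k) CARD('s)) *
       ennreal ((1 + 2 * proj_coef DIM('f) r CARD('k)) * tail_energy r A)"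
    using c0 by (subst ennreal_mult'[symmetric]) (simp_all add: C_def mult.assoc)
  finally show ?thesis .
qed

end

text \<open>Dividing by \<open>c\<close> makes the left side a lower bound of all
  \<open>f r\<close>. The index set may be empty: for real scalars and \<open>CARD('k) = 1\<close>
  there is no admissible rank, and the infimum is \<open>top\<close>.\<close>

lemma le_ennreal_mult_INF:
  fixes I :: ennreal
  assumes c: "0 < c" and le: "\<And>r. r \<in> R \<Longrightarrow> I \<le> ennreal c * f r"
  shows "I \<le> ennreal c * (INF r\<in>R. f r)"
proof -
  have inv: "ennreal (1 / c) * ennreal c = 1"
    using c by (simp flip: ennreal_mult)
  have "ennreal (1 / c) * I \<le> f r" if "r \<in> R" for r
    using mult_left_mono[OF le[OF that], of "ennreal (1 / c)"] by (simp add: inv flip: mult.assoc)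
  then have "ennreal c * (ennreal (1 / c) * I) \<le> ennreal c * (INF r\<in>R. f r)"
    by (intro mult_left_mono INF_greatest) auto
  then show ?thesis
    using inv by (simp add: mult.commute[of "ennreal c"] flip: mult.assoc)
qed

theorem theorem5p1:
  fixes W :: "'w measure"
  assumes "prob_space W"
    and "CARD('k::{finite,linorder}) \<le> CARD('s::finite)"
    and "CARD('s) \<le> min CARD('m::finite) CARD('n::finite)"
  shows
    "(\<forall>(A :: real^'n^'m) (\<Upsilon> :: 'w \<Rightarrow> real^'m^'k::_) (\<Omega> :: 'w \<Rightarrow> real^'n^'k::_)
          (\<Phi> :: 'w \<Rightarrow> real^'m^'s) (\<Psi> :: 'w \<Rightarrow> real^'n^'s) qr1 qr2.
        CARD('s) \<ge> 2 * CARD('k) + 1 \<and>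
        prob_space.std_normal_matrix W \<Upsilon> \<and> prob_space.std_normal_matrix W \<Omega> \<and>
        prob_space.std_normal_matrix W \<Phi> \<and> prob_space.std_normal_matrix W \<Psi> \<and>
        prob_space.indep_vars4 W \<Upsilon> \<Omega> \<Phi> \<Psi> \<and>
        thin_qr_procedure qr1 \<and> thin_qr_procedure qr2 \<longrightarrow>
        (\<integral>\<^sup>+\<omega>. ennreal ((norm (A - initial_approx qr1 qr2 (\<Phi> \<omega>) (\<Psi> \<omega>)
              (\<Upsilon> \<omega> ** A) (A ** ctranspose (\<Omega> \<omega>)) (\<Phi> \<omega> ** A ** ctranspose (\<Psi> \<omega>))))\<^sup>2) \<partial>W)
        \<le> ennreal ((real CARD('s) - 1) / (real CARD('s) - real CARD('k) - 1)) *
            (INF \<rho> \<in> {\<rho>::nat. \<rho> + 1 < CARD('k)}.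
               ennreal ((real CARD('k) + real \<rho> - 1) / (real CARD('k) - real \<rho> - 1) * tail_energy \<rho> A))) \<and>
     (\<forall>(A :: complex^'n^'m) (\<Upsilon> :: 'w \<Rightarrow> complex^'m^'k::_) (\<Omega> :: 'w \<Rightarrow> complex^'n^'k::_)
          (\<Phi> :: 'w \<Rightarrow> complex^'m^'s) (\<Psi> :: 'w \<Rightarrow> complex^'n^'s) qr1 qr2.
        CARD('s) \<ge> 2 * CARD('k) \<and>
        prob_space.std_normal_matrix W \<Upsilon> \<and> prob_space.std_normal_matrix W \<Omega> \<and>
        prob_space.std_normal_matrix W \<Phi> \<and> prob_space.std_normal_matrix W \<Psi> \<and>
        prob_space.indep_vars4 W \<Upsilon> \<Omega> \<Phi> \<Psi> \<and>
        thin_qr_procedure qr1 \<and> thin_qr_procedure qr2 \<longrightarrow>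
        (\<integral>\<^sup>+\<omega>. ennreal ((norm (A - initial_approx qr1 qr2 (\<Phi> \<omega>) (\<Psi> \<omega>)
              (\<Upsilon> \<omega> ** A) (A ** ctranspose (\<Omega> \<omega>)) (\<Phi> \<omega> ** A ** ctranspose (\<Psi> \<omega>))))\<^sup>2) \<partial>W)
        \<le> ennreal ((real CARD('s)) / (real CARD('s) - real CARD('k))) *
            (INF \<rho> \<in> {\<rho>::nat. \<rho> < CARD('k)}.
               ennreal ((real CARD('k) + real \<rho>) / (real CARD('k) - real \<rho>) * tail_energy \<rho> A)))"
proof (intro conjI allI impI)
  interpret prob_space W by fact
  have k1: "real CARD('k) \<ge> 1" by (simp add: Suc_leI)
  {
    fix A :: "real^'n^'m" and \<Upsilon> :: "'w \<Rightarrow> real^'m^'k::_" and \<Omega> :: "'w \<Rightarrow> real^'n^'k::_"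
      and \<Phi> :: "'w \<Rightarrow> real^'m^'s" and \<Psi> :: "'w \<Rightarrow> real^'n^'s"
      and qr1 :: "real^'k::_^'n \<Rightarrow> real^'k::_^'n" and qr2 :: "real^'k::_^'m \<Rightarrow> real^'k::_^'m"
    assume H: "CARD('s) \<ge> 2 * CARD('k) + 1 \<and>
        std_normal_matrix \<Upsilon> \<and> std_normal_matrix \<Omega> \<and> std_normal_matrix \<Phi> \<and> std_normal_matrix \<Psi> \<and>
        indep_vars4 \<Upsilon> \<Omega> \<Phi> \<Psi> \<and> thin_qr_procedure qr1 \<and> thin_qr_procedure qr2"
    then have s: "real CARD('s) \<ge> 2 * real CARD('k) + 1"
      by (metis (mono_tags, lifting) of_nat_1 of_nat_add of_nat_le_iff of_nat_mult of_nat_numeral)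
    have ck: "proj_coef DIM(real) CARD('k) CARD('s) = real CARD('k) / (real CARD('s) - real CARD('k) - 1)"
      by (simp add: proj_coef_def)
    \<comment> \<open>\<open>s >= 2 * k + 1\<close> states that the denominator
      \<open>s - k - 1\<close> is at least \<open>k\<close>.\<close>
    have c1: "proj_coef DIM(real) CARD('k) CARD('s) \<le> 1"
      unfolding ck divide_le_eq_1 using s k1 by (intro disjI1 conjI) linarith+
    show "(\<integral>\<^sup>+\<omega>. ennreal ((norm (A - initial_approx qr1 qr2 (\<Phi> \<omega>) (\<Psi> \<omega>)
              (\<Upsilon> \<omega> ** A) (A ** ctranspose (\<Omega> \<omega>)) (\<Phi> \<omega> ** A ** ctranspose (\<Psi> \<omega>))))\<^sup>2) \<partial>W)
        \<le> ennreal ((real CARD('s) - 1) / (real CARD('s) - real CARD('k) - 1)) *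
            (INF \<rho> \<in> {\<rho>::nat. \<rho> + 1 < CARD('k)}.
               ennreal ((real CARD('k) + real \<rho> - 1) / (real CARD('k) - real \<rho> - 1) * tail_energy \<rho> A))"
    proof (rule le_ennreal_mult_INF)
      show "0 < (real CARD('s) - 1) / (real CARD('s) - real CARD('k) - 1)"
        using s k1 by (intro divide_pos_pos) linarith+
      fix r assume "r \<in> {\<rho>. \<rho> + 1 < CARD('k)}"
      then have r: "r + 1 < CARD('k)" by simp
      then have r': "real r + 1 < real CARD('k)" by linarith
      have "1 + proj_coef DIM(real) CARD('k) CARD('s) = (real CARD('s) - 1) / (real CARD('s) - real CARD('k) - 1)"
      proof -
        have "real CARD('s) - real CARD('k) - 1 \<noteq> 0" using s k1 by linarith
        then show ?thesis unfolding ck by (subst add_divide_eq_iff) auto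
      qed
      moreover have "1 + 2 * proj_coef DIM(real) r CARD('k) = (real CARD('k) + real r - 1) / (real CARD('k) - real r - 1)"
        using r' by (simp add: proj_coef_def field_simps)
      ultimately show "(\<integral>\<^sup>+\<omega>. ennreal ((norm (A - initial_approx qr1 qr2 (\<Phi> \<omega>) (\<Psi> \<omega>)
              (\<Upsilon> \<omega> ** A) (A ** ctranspose (\<Omega> \<omega>)) (\<Phi> \<omega> ** A ** ctranspose (\<Psi> \<omega>))))\<^sup>2) \<partial>W)
          \<le> ennreal ((real CARD('s) - 1) / (real CARD('s) - real CARD('k) - 1)) *
             ennreal ((real CARD('k) + real r - 1) / (real CARD('k) - real r - 1) * tail_energy r A)"
        \<comment> \<open>With one real dimension per scalar the numerical hypotheses read
          \<open>k + 2 < s + 1\<close> and \<open>r + 2 < k + 1\<close>.\<close>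
        using nn_integral_initial_approx_le_tail_energy[of \<Upsilon> \<Omega> \<Phi> \<Psi> qr1 qr2 r A] H r s k1 c1
        by simp
    qed
  next
    fix A :: "complex^'n^'m" and \<Upsilon> :: "'w \<Rightarrow> complex^'m^'k::_" and \<Omega> :: "'w \<Rightarrow> complex^'n^'k::_"
      and \<Phi> :: "'w \<Rightarrow> complex^'m^'s" and \<Psi> :: "'w \<Rightarrow> complex^'n^'s"
      and qr1 :: "complex^'k::_^'n \<Rightarrow> complex^'k::_^'n" and qr2 :: "complex^'k::_^'m \<Rightarrow> complex^'k::_^'m"
    assume H: "CARD('s) \<ge> 2 * CARD('k) \<and>
        std_normal_matrix \<Upsilon> \<and> std_normal_matrix \<Omega> \<and> std_normal_matrix \<Phi> \<and> std_normal_matrix \<Psi> \<and>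
        indep_vars4 \<Upsilon> \<Omega> \<Phi> \<Psi> \<and> thin_qr_procedure qr1 \<and> thin_qr_procedure qr2"
    then have s: "real CARD('s) \<ge> 2 * real CARD('k)"
      by (metis (mono_tags, lifting) of_nat_le_iff of_nat_mult of_nat_numeral)
    have ck: "proj_coef DIM(complex) CARD('k) CARD('s) = real CARD('k) / (real CARD('s) - real CARD('k))"
    proof -
      \<comment> \<open>With two real dimensions per scalar, the 2 subtracted in the denominator
        cancels the contribution of \<open>+ 1\<close>; this is the case
        \<open>\<alpha> = 0\<close>.\<close>
      have eq: "2 * (real CARD('s) - real CARD('k) + 1) - 2 = 2 * (real CARD('s) - real CARD('k))" by simp
      show ?thesis
        unfolding proj_coef_def DIM_complex of_nat_numeral eq by (rule mult_divide_mult_cancel_left) simp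
    qed
    have c1: "proj_coef DIM(complex) CARD('k) CARD('s) \<le> 1"
      unfolding ck divide_le_eq_1 using s k1 by (intro disjI1 conjI) linarith+
    show "(\<integral>\<^sup>+\<omega>. ennreal ((norm (A - initial_approx qr1 qr2 (\<Phi> \<omega>) (\<Psi> \<omega>)
              (\<Upsilon> \<omega> ** A) (A ** ctranspose (\<Omega> \<omega>)) (\<Phi> \<omega> ** A ** ctranspose (\<Psi> \<omega>))))\<^sup>2) \<partial>W)
        \<le> ennreal (real CARD('s) / (real CARD('s) - real CARD('k))) *
            (INF \<rho> \<in> {\<rho>::nat. \<rho> < CARD('k)}.
               ennreal ((real CARD('k) + real \<rho>) / (real CARD('k) - real \<rho>) * tail_energy \<rho> A))"
    proof (rule le_ennreal_mult_INF)
      show "0 < real CARD('s) / (real CARD('s) - real CARD('k))"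
        using s k1 by (intro divide_pos_pos) linarith+
      fix r assume "r \<in> {\<rho>. \<rho> < CARD('k)}"
      then have r: "r < CARD('k)" by simp
      then have r': "real r < real CARD('k)" by linarith
      have "1 + proj_coef DIM(complex) CARD('k) CARD('s) = real CARD('s) / (real CARD('s) - real CARD('k))"
      proof -
        have "real CARD('s) - real CARD('k) \<noteq> 0" using s k1 by linarith
        then show ?thesis unfolding ck by (subst add_divide_eq_iff) auto
      qed
      moreover have "1 + 2 * proj_coef DIM(complex) r CARD('k) = (real CARD('k) + real r) / (real CARD('k) - real r)"
        using r' by (simp add: proj_coef_def field_simps)
      ultimately show "(\<integral>\<^sup>+\<omega>. ennreal ((norm (A - initial_approx qr1 qr2 (\<Phi> \<omega>) (\<Psi> \<omega>)
              (\<Upsilon> \<omega> ** A) (A ** ctranspose (\<Omega> \<omega>)) (\<Phi> \<omega> ** A ** ctranspose (\<Psi> \<omega>))))\<^sup>2) \<partial>W)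
          \<le> ennreal (real CARD('s) / (real CARD('s) - real CARD('k))) *
             ennreal ((real CARD('k) + real r) / (real CARD('k) - real r) * tail_energy r A)"
        using nn_integral_initial_approx_le_tail_energy[of \<Upsilon> \<Omega> \<Phi> \<Psi> qr1 qr2 r A] H r s k1 c1
        by simp
    qed
  }
qed

end
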